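(* Let $f\in S=\mathbb{C}[x_0,\ldots,x_n]$ be a homogeneous polynomial of degree $d$, and assume that the hypersurface $V(f)\subset\mathbb{P}^n$ has at most isolated singularities. Let $J=J_f$ be the Jacobian ideal of $f$ and let $I=\sqrt{J}$ be its radical. Let $G_1$ and $G_2$ be standard (Gröbner) bases of $J$ and $I$ respectively, let $\mathrm{mult}_1$ be the degree (multiplicity) of $G_1$, i.e. of the ideal $J$, and let $\mathrm{mult}_2$ be the degree (multiplicity) of $G_2$, i.e. of the ideal $I$. Then: (a) if $\mathrm{mult}_1<(d-1)^{n+1}$, then the hypersurface $V(f)$ is singular and $\mathrm{mult}_2$ is the number of singularities of $V(f)$; (b) if $\mathrm{mult}_1=(d-1)^{n+1}$, then the hypersurface $V(f)$ is smooth.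
   Context: $V(f)$ is the hypersurface $f=0$ in the complex projective space $\mathbb{P}^n$. The Jacobian ideal $J_f\subset S$ is the ideal generated by the partial derivatives $\partial f/\partial x_0,\ldots,\partial f/\partial x_n$. The singularities (singular points) of $V(f)$ are the points of $\mathbb{P}^n$ at which all these partial derivatives vanish; $V(f)$ is smooth if there are none, and singular otherwise. "At most isolated singularities" means that the set of singular points is finite (possibly empty). The degree (multiplicity) of a homogeneous ideal $K\subset S$ (the quantity computed by the command mult, in the computer algebra system Singular, applied to a standard/Gröbner basis of $K$) is defined as follows. If $S/K$ is finite dimensional over $\mathbb{C}$, it is $\dim_{\mathbb{C}}S/K$. Otherwise, if the Hilbert polynomial of $S/K$ has degree $r\ge 0$, it is $r!$ times the leading coefficient of this Hilbert polynomial; in particular, when the zero set of $K$ in $\mathbb{P}^n$ is finite and nonempty, it is the common value of $\dim_{\mathbb{C}}(S/K)_k$ for all sufficiently large $k$.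
   Formalization: Part (b) is proved only for d ≠ 2 or n = 0, since it fails for d = 2, n ≥ 1: f = x_0²+…+x_{n-1}² has mult_1 = 1 = (d-1)^{n+1} but V(f) is singular; f is also taken to be nonzero. *)

theory Defs
  imports
    Complex_Main
    "HOL-Library.Poly_Mapping"
    "HOL-Computational_Algebra.Polynomial"
begin

text \<open>
  A monomial is its exponent vector. The types admit infinitely many variables
  \<open>x\<^sub>0, x\<^sub>1, \<dots>\<close>; the ring \<open>S = \<complex>[x\<^sub>0, \<dots>, x\<^sub>n]\<close> is the carrier set \<open>poly_ring n\<close>.
\<close>

type_synonym monom = "nat \<Rightarrow>\<^sub>0 nat"
type_synonym mpoly = "monom \<Rightarrow>\<^sub>0 complex"

definition monoms :: "nat \<Rightarrow> monom set" where
  "monoms n = {m. Poly_Mapping.keys m \<subseteq> {..n}}"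

definition poly_ring :: "nat \<Rightarrow> mpoly set" where
  "poly_ring n = {p. Poly_Mapping.keys p \<subseteq> monoms n}"

definition mdeg :: "monom \<Rightarrow> nat" where
  "mdeg m = (\<Sum>i\<in>Poly_Mapping.keys m. Poly_Mapping.lookup m i)"

definition homogeneous :: "nat \<Rightarrow> mpoly \<Rightarrow> bool" where
  "homogeneous d p \<longleftrightarrow> (\<forall>m\<in>Poly_Mapping.keys p. mdeg m = d)"

definition graded_part :: "nat \<Rightarrow> nat \<Rightarrow> mpoly set" where
  "graded_part n k = {p \<in> poly_ring n. homogeneous k p}"

definition eval_mpoly :: "(nat \<Rightarrow> complex) \<Rightarrow> mpoly \<Rightarrow> complex" where
  "eval_mpoly a p =
     (\<Sum>m\<in>Poly_Mapping.keys p.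
        Poly_Mapping.lookup p m * (\<Prod>i\<in>Poly_Mapping.keys m. a i ^ Poly_Mapping.lookup m i))"

text \<open>
  Subtraction of exponents truncates at 0, but then the coefficient is multiplied by 0.
\<close>

definition partial_deriv :: "nat \<Rightarrow> mpoly \<Rightarrow> mpoly" where
  "partial_deriv i p =
     (\<Sum>m\<in>Poly_Mapping.keys p. Poly_Mapping.single (m - Poly_Mapping.single i 1)
                    (of_nat (Poly_Mapping.lookup m i) * Poly_Mapping.lookup p m))"


definition ideal_gen :: "nat \<Rightarrow> mpoly set \<Rightarrow> mpoly set" where
  "ideal_gen n G =
     {\<Sum>g\<in>F. q g * g | F q. finite F \<and> F \<subseteq> G \<and> (\<forall>g\<in>F. q g \<in> poly_ring n)}"

definition radical :: "nat \<Rightarrow> mpoly set \<Rightarrow> mpoly set" where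
  "radical n K = {p \<in> poly_ring n. \<exists>k::nat. p ^ k \<in> K}"

definition jacobian_ideal :: "nat \<Rightarrow> mpoly \<Rightarrow> mpoly set" where
  "jacobian_ideal n f = ideal_gen n {partial_deriv i f | i. i \<le> n}"


text \<open>
  Points of projective space are the punctured lines \<open>{c v | c \<noteq> 0}\<close>, where \<open>\<complex>\<^sup>n\<^sup>+\<^sup>1\<close> consists of
  the functions vanishing at all indices above \<open>n\<close>. The partial derivatives are evaluated at
  all representatives of a point; for homogeneous \<open>f\<close> one representative decides.
\<close>

definition punctured_space :: "nat \<Rightarrow> (nat \<Rightarrow> complex) set" where
  "punctured_space n = {v. (\<forall>i>n. v i = 0) \<and> (\<exists>i. v i \<noteq> 0)}"

definition proportional :: "((nat \<Rightarrow> complex) \<times> (nat \<Rightarrow> complex)) set" where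
  "proportional = {(v, w). \<exists>c. c \<noteq> 0 \<and> w = (\<lambda>i. c * v i)}"

definition proj_space :: "nat \<Rightarrow> (nat \<Rightarrow> complex) set set" where
  "proj_space n = punctured_space n // proportional"

definition singular_points :: "nat \<Rightarrow> mpoly \<Rightarrow> (nat \<Rightarrow> complex) set set" where
  "singular_points n f =
     {X \<in> proj_space n. \<forall>v\<in>X. \<forall>i\<le>n. eval_mpoly v (partial_deriv i f) = 0}"

definition smooth_hypersurface :: "nat \<Rightarrow> mpoly \<Rightarrow> bool" where
  "smooth_hypersurface n f \<longleftrightarrow> singular_points n f = {}"


text \<open>
  For \<open>\<complex>\<close>-subspaces \<open>V\<close> and \<open>W\<close> of the polynomials, \<open>quotient_basis V W B\<close> says that the
  elements of \<open>B\<close> represent, pairwise distinctly, a basis of \<open>V / (V \<inter> W)\<close>. Every quotient has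
  such a \<open>B\<close>, and all of them have the same cardinality; \<open>quotient_dim\<close> is meaningful when
  they are finite.
\<close>

definition scale :: "complex \<Rightarrow> mpoly \<Rightarrow> mpoly" where
  "scale c p = Poly_Mapping.single 0 c * p"

definition quotient_basis :: "mpoly set \<Rightarrow> mpoly set \<Rightarrow> mpoly set \<Rightarrow> bool" where
  "quotient_basis V W B \<longleftrightarrow>
     B \<subseteq> V \<and>
     (\<forall>F c. finite F \<and> F \<subseteq> B \<and> (\<Sum>b\<in>F. scale (c b) b) \<in> W \<longrightarrow> (\<forall>b\<in>F. c b = 0)) \<and>
     (\<forall>v\<in>V. \<exists>F c. finite F \<and> F \<subseteq> B \<and> v - (\<Sum>b\<in>F. scale (c b) b) \<in> W)"

definition finite_dim_quotient :: "mpoly set \<Rightarrow> mpoly set \<Rightarrow> bool" where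
  "finite_dim_quotient V W \<longleftrightarrow> (\<exists>B. finite B \<and> quotient_basis V W B)"

definition quotient_dim :: "mpoly set \<Rightarrow> mpoly set \<Rightarrow> nat" where
  "quotient_dim V W = card (SOME B. quotient_basis V W B)"

definition hilbert_function :: "nat \<Rightarrow> mpoly set \<Rightarrow> nat \<Rightarrow> nat" where
  "hilbert_function n K k = quotient_dim (graded_part n k) K"

definition hilbert_polynomial :: "nat \<Rightarrow> mpoly set \<Rightarrow> rat poly" where
  "hilbert_polynomial n K =
     (THE P. \<forall>\<^sub>F k in sequentially. poly P (of_nat k) = of_nat (hilbert_function n K k))"

definition ideal_multiplicity :: "nat \<Rightarrow> mpoly set \<Rightarrow> rat" where
  "ideal_multiplicity n K =
     (if finite_dim_quotient (poly_ring n) K then of_nat (quotient_dim (poly_ring n) K)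
      else fact (Polynomial.degree (hilbert_polynomial n K)) * lead_coeff (hilbert_polynomial n K))"


text \<open>
  A (global) monomial order on \<open>x\<^sub>0, \<dots>, x\<^sub>n\<close>, as a relation: \<open>(s, t) \<in> ord\<close> means \<open>s \<le> t\<close>.
\<close>

definition monomial_order :: "nat \<Rightarrow> (monom \<times> monom) set \<Rightarrow> bool" where
  "monomial_order n ord \<longleftrightarrow>
     linear_order_on (monoms n) ord \<and>
     (\<forall>t\<in>monoms n. (0, t) \<in> ord) \<and>
     (\<forall>s t u. (s, t) \<in> ord \<and> u \<in> monoms n \<longrightarrow> (s + u, t + u) \<in> ord)"

definition lead_monom :: "(monom \<times> monom) set \<Rightarrow> mpoly \<Rightarrow> mpoly" where
  "lead_monom ord p =
     Poly_Mapping.single (THE t. t \<in> Poly_Mapping.keys p \<and> (\<forall>s\<in>Poly_Mapping.keys p. (s, t) \<in> ord)) 1"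

definition lead_ideal :: "nat \<Rightarrow> (monom \<times> monom) set \<Rightarrow> mpoly set \<Rightarrow> mpoly set" where
  "lead_ideal n ord G = ideal_gen n (lead_monom ord ` (G - {0}))"

text \<open>
  That \<open>G\<close> generates \<open>K\<close> already follows from the other conditions when \<open>K\<close> is an ideal;
  it is included as in the usual textbook definition.
\<close>

definition groebner_basis ::
  "nat \<Rightarrow> (monom \<times> monom) set \<Rightarrow> mpoly set \<Rightarrow> mpoly set \<Rightarrow> bool" where
  "groebner_basis n ord G K \<longleftrightarrow>
     finite G \<and> G \<subseteq> K \<and> ideal_gen n G = K \<and> lead_ideal n ord G = lead_ideal n ord K"

end

theory Submission
  imports
    Defs
    "HOL-Library.FuncSet"
    "HOL-Analysis.Continuum_Not_Denumerable"
    "HOL-Computational_Algebra.Fundamental_Theorem_Algebra"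
begin

text \<open>
  The Jacobian ideal \<open>J\<close> is generated by \<open>n + 1\<close> forms of degree \<open>e = d - 1\<close> in \<open>n + 1\<close> variables.
  If \<open>V(f)\<close> is smooth, these forms have finite colength, which is \<open>e\<^sup>n\<^sup>+\<^sup>1\<close> by Bezout's theorem.
  If \<open>V(f)\<close> has singular points, a linear form \<open>l\<close> vanishing at none of them makes the Hilbert
  function of \<open>S/J\<close> eventually constant, with value \<open>\<tau> \<ge> 1\<close>. Noether normalization replaces the
  \<open>n + 2\<close> forms generating \<open>J + (l\<^sup>e)\<close> by \<open>n + 1\<close> linear combinations of finite colength \<open>e\<^sup>n\<^sup>+\<^sup>1\<close>;
  since \<open>S/(J + (l\<^sup>e))\<close> has dimension at least \<open>e \<tau>\<close>, it follows that \<open>\<tau> \<le> e\<^sup>n\<close>, which is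
  smaller than \<open>e\<^sup>n\<^sup>+\<^sup>1\<close> for \<open>e \<ge> 2\<close>. The radical of \<open>J\<close> is the vanishing ideal of the singular
  points by the Nullstellensatz, and interpolation shows that its Hilbert function is eventually
  their number.

  Bezout's theorem is proved by replacing the forms one at a time by generic linear forms. That the
  forms are a regular sequence comes from a lower bound for the growth of Hilbert functions, which
  shows that the colength cannot be smaller than the product of the degrees.
\<close>

section \<open>Polynomials, homogeneous components and evaluation\<close>

text \<open>Ideals are studied through the dimensions of their graded quotients alone. The source of
  all estimates is the exact sequence of multiplication by a form,
  \<open>S/(I : g) -> S/I -> S/(I + gS)\<close>, together with \<open>I \<subseteq> I : g\<close>.
  Growth is measured against binomial coefficients with a free shift, so that every intermediate
  inequality holds in all degrees and a limit is taken only at the very end. The form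
  \<open>l ^ e\<close> is adjoined to \<open>J\<close> instead of \<open>l\<close> because linear
  combinations are homogeneous only for forms of one degree; the factor \<open>e\<close> paid for
  this returns as \<open>e\<close> equal values of the Hilbert function. The Nullstellensatz serves
  three purposes: ideals without projective zeros fill all high degrees, the radical becomes a
  vanishing ideal, and a nonzero polynomial has a nonzero value. The inequality
  \<open>e^n < e^(n+1)\<close> is not strict for \<open>e = 1\<close>, and a quadric cone with a
  single vertex attains equality. This is why part (b) is stated for \<open>d \<noteq> 2\<close> or
  \<open>n = 0\<close>. The degrees 0 and 1 are treated directly.\<close>

abbreviation "lkp \<equiv> Poly_Mapping.lookup"
abbreviation "sngl \<equiv> Poly_Mapping.single"

lemma lookup_single_if: "lkp (sngl k v) m = (if m = k then v else 0)"
  by (simp add: lookup_single when_def)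

lemma poly_mapping_sum_single:
  assumes "finite A" "Poly_Mapping.keys p \<subseteq> A"
  shows "(\<Sum>m\<in>A. sngl m (lkp p m)) = p"
proof (rule poly_mapping_eqI)
  fix k
  have "lkp (\<Sum>m\<in>A. sngl m (lkp p m)) k = (\<Sum>m\<in>A. if k = m then lkp p m else 0)"
    by (simp add: lookup_sum lookup_single_if)
  also have "\<dots> = lkp p k"
    using assms by (auto simp: in_keys_iff)
  finally show "lkp (\<Sum>m\<in>A. sngl m (lkp p m)) k = lkp p k" .
qed

lemma lookup_scale: "lkp (scale c p) m = c * lkp p m"
  unfolding scale_def mult_map_scale_conv_mult[symmetric]
  by transfer (simp add: when_def)

interpretation mp: vector_space scale
  by unfold_locales (auto intro!: poly_mapping_eqI simp: lookup_scale lookup_add algebra_simps)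

lemma scale_mult_left: "scale c p * q = scale c (p * q)"
  by (simp add: scale_def mult.assoc)

lemma scale_single: "scale c (sngl m a) = sngl m (c * a)"
  by (simp add: scale_def mult_single)

lemma keys_scale: "Poly_Mapping.keys (scale c p) \<subseteq> Poly_Mapping.keys p"
  by (auto simp: in_keys_iff lookup_scale)

lemma keys_add_nat: "Poly_Mapping.keys (m + m') = Poly_Mapping.keys m \<union> Poly_Mapping.keys (m' :: monom)"
  by (auto simp: in_keys_iff lookup_add)

lemma mdeg_superset: "finite A \<Longrightarrow> Poly_Mapping.keys m \<subseteq> A \<Longrightarrow> mdeg m = sum (lkp m) A"
  unfolding mdeg_def by (rule sum.mono_neutral_left) (auto simp: in_keys_iff)

lemma mdeg_add: "mdeg (m + m') = mdeg m + mdeg m'"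
proof -
  let ?A = "Poly_Mapping.keys m \<union> Poly_Mapping.keys m'"
  have "mdeg (m + m') = sum (lkp (m + m')) ?A" "mdeg m = sum (lkp m) ?A" "mdeg m' = sum (lkp m') ?A"
    by (auto intro!: mdeg_superset simp: keys_add_nat)
  then show ?thesis by (simp add: lookup_add sum.distrib)
qed

lemma mdeg_0 [simp]: "mdeg 0 = 0"
  by (simp add: mdeg_def)

lemma mdeg_single [simp]: "mdeg (sngl i k) = k"
  by (simp add: mdeg_def)

lemma mdeg_eq_0_iff: "mdeg m = 0 \<longleftrightarrow> m = 0"
proof
  assume "mdeg m = 0"
  then show "m = 0" by (intro poly_mapping_eqI) (auto simp: mdeg_def in_keys_iff)
qed simp

lemma monoms_0 [simp]: "0 \<in> monoms n"
  by (simp add: monoms_def)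

lemma monoms_add: "m \<in> monoms n \<Longrightarrow> m' \<in> monoms n \<Longrightarrow> m + m' \<in> monoms n"
  by (auto simp: monoms_def keys_add_nat)

lemma monoms_single: "i \<le> n \<Longrightarrow> sngl i k \<in> monoms n"
  by (auto simp: monoms_def)

lemma keys_mult_mem:
  assumes "m \<in> Poly_Mapping.keys (p * q :: mpoly)"
  obtains a b where "a \<in> Poly_Mapping.keys p" "b \<in> Poly_Mapping.keys q" "m = a + b"
  using keys_mult[of p q] assms by blast

lemma poly_ring_iff: "p \<in> poly_ring n \<longleftrightarrow> Poly_Mapping.keys p \<subseteq> monoms n"
  by (simp add: poly_ring_def)

lemma poly_ring_0 [simp]: "0 \<in> poly_ring n"
  by (simp add: poly_ring_def)

lemma poly_ring_single: "m \<in> monoms n \<Longrightarrow> sngl m c \<in> poly_ring n"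
  by (auto simp: poly_ring_def)

lemma poly_ring_const [simp]: "sngl 0 c \<in> poly_ring n"
  by (rule poly_ring_single) simp

lemma poly_ring_1 [simp]: "1 \<in> poly_ring n"
  by (simp add: poly_ring_def)

lemma poly_ring_add [simp]: "p \<in> poly_ring n \<Longrightarrow> q \<in> poly_ring n \<Longrightarrow> p + q \<in> poly_ring n"
  using keys_add[of p q] by (auto simp: poly_ring_iff)

lemma poly_ring_uminus [simp]: "p \<in> poly_ring n \<Longrightarrow> - p \<in> poly_ring n"
  by (auto simp: poly_ring_iff in_keys_iff)

lemma poly_ring_diff [simp]: "p \<in> poly_ring n \<Longrightarrow> q \<in> poly_ring n \<Longrightarrow> p - q \<in> poly_ring n"
  using poly_ring_add[of p n "- q"] by simp

lemma poly_ring_mult [simp]: "p \<in> poly_ring n \<Longrightarrow> q \<in> poly_ring n \<Longrightarrow> p * q \<in> poly_ring n"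
  by (auto simp: poly_ring_iff elim!: keys_mult_mem intro!: monoms_add)

lemma poly_ring_scale [simp]: "p \<in> poly_ring n \<Longrightarrow> scale c p \<in> poly_ring n"
  by (simp add: scale_def)

lemma poly_ring_power [simp]: "p \<in> poly_ring n \<Longrightarrow> p ^ k \<in> poly_ring n"
  by (induction k) auto

lemma poly_ring_sum: "(\<And>x. x \<in> A \<Longrightarrow> g x \<in> poly_ring n) \<Longrightarrow> sum g A \<in> poly_ring n"
  by (induction A rule: infinite_finite_induct) auto

lemma graded_part_iff:
  "p \<in> graded_part n k \<longleftrightarrow> (\<forall>m\<in>Poly_Mapping.keys p. m \<in> monoms n \<and> mdeg m = k)"
  by (auto simp: graded_part_def poly_ring_def homogeneous_def)

lemma graded_part_poly_ring: "p \<in> graded_part n k \<Longrightarrow> p \<in> poly_ring n"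
  by (simp add: graded_part_def)

lemma graded_part_0 [simp]: "0 \<in> graded_part n k"
  by (simp add: graded_part_iff)

lemma graded_part_add [simp]:
  "p \<in> graded_part n k \<Longrightarrow> q \<in> graded_part n k \<Longrightarrow> p + q \<in> graded_part n k"
  using keys_add[of p q] unfolding graded_part_iff by blast

lemma graded_part_scale [simp]: "p \<in> graded_part n k \<Longrightarrow> scale c p \<in> graded_part n k"
  using keys_scale[of c p] unfolding graded_part_iff by blast

lemma subspace_graded_part: "mp.subspace (graded_part n k)"
  by (rule mp.subspaceI) auto

lemmas graded_part_diff [simp] = mp.subspace_diff[OF subspace_graded_part]

lemma graded_part_mult:
  "p \<in> graded_part n j \<Longrightarrow> q \<in> graded_part n k \<Longrightarrow> p * q \<in> graded_part n (j + k)"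
  by (auto simp: graded_part_iff mdeg_add elim!: keys_mult_mem intro!: monoms_add)

lemma graded_part_1 [simp]: "1 \<in> graded_part n 0"
  by (simp add: graded_part_iff)

lemma graded_part_power: "p \<in> graded_part n k \<Longrightarrow> p ^ N \<in> graded_part n (N * k)"
  by (induction N) (auto dest: graded_part_mult)

lemma graded_part_sum: "(\<And>x. x \<in> A \<Longrightarrow> g x \<in> graded_part n k) \<Longrightarrow> sum g A \<in> graded_part n k"
  by (rule mp.subspace_sum[OF subspace_graded_part])

lemma graded_part_prod:
  "(\<And>x. x \<in> A \<Longrightarrow> g x \<in> graded_part n (e x)) \<Longrightarrow> prod g A \<in> graded_part n (sum e A)"
  by (induction A rule: infinite_finite_induct) (auto intro: graded_part_mult)

lemma graded_part_single: "m \<in> monoms n \<Longrightarrow> sngl m c \<in> graded_part n (mdeg m)"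
  by (auto simp: graded_part_iff)

definition xvar :: "nat \<Rightarrow> mpoly" where
  "xvar i = sngl (sngl i 1) 1"

lemma xvar_graded: "i \<le> n \<Longrightarrow> xvar i \<in> graded_part n 1"
  unfolding xvar_def by (metis graded_part_single mdeg_single monoms_single)

lemma xvar_poly_ring: "i \<le> n \<Longrightarrow> xvar i \<in> poly_ring n"
  by (rule graded_part_poly_ring[OF xvar_graded])

section \<open>Homogeneous components\<close>

definition hcomp :: "nat \<Rightarrow> mpoly \<Rightarrow> mpoly" where
  "hcomp k p = (\<Sum>m\<in>{m \<in> Poly_Mapping.keys p. mdeg m = k}. sngl m (lkp p m))"

lemma lookup_hcomp: "lkp (hcomp k p) m = (if mdeg m = k then lkp p m else 0)"
  unfolding hcomp_def lookup_sum lookup_single_if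
  by (subst sum.delta') (auto simp: in_keys_iff)

lemma keys_hcomp: "Poly_Mapping.keys (hcomp k p) = {m \<in> Poly_Mapping.keys p. mdeg m = k}"
  by (auto simp: in_keys_iff lookup_hcomp split: if_splits)

lemma hcomp_0 [simp]: "hcomp k 0 = 0"
  by (simp add: hcomp_def)

lemma hcomp_add: "hcomp k (p + q) = hcomp k p + hcomp k q"
  by (rule poly_mapping_eqI) (simp add: lookup_hcomp lookup_add)

lemma hcomp_scale: "hcomp k (scale c p) = scale c (hcomp k p)"
  by (rule poly_mapping_eqI) (simp add: lookup_hcomp lookup_scale)

lemma hcomp_sum: "hcomp k (sum g A) = (\<Sum>x\<in>A. hcomp k (g x))"
  by (induction A rule: infinite_finite_induct) (auto simp: hcomp_add)

lemma hcomp_graded: "p \<in> poly_ring n \<Longrightarrow> hcomp k p \<in> graded_part n k"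
  by (auto simp: graded_part_iff keys_hcomp poly_ring_iff)

lemma hcomp_of_graded: "p \<in> graded_part n j \<Longrightarrow> hcomp k p = (if k = j then p else 0)"
  by (rule poly_mapping_eqI) (auto simp: lookup_hcomp graded_part_iff in_keys_iff)

lemma sum_hcomp:
  assumes "finite A" "mdeg ` Poly_Mapping.keys p \<subseteq> A"
  shows "(\<Sum>k\<in>A. hcomp k p) = p"
proof (rule poly_mapping_eqI)
  fix m
  have "lkp (\<Sum>k\<in>A. hcomp k p) m = (\<Sum>k\<in>A. if mdeg m = k then lkp p m else 0)"
    by (simp add: lookup_sum lookup_hcomp)
  also have "\<dots> = lkp p m"
    using assms by (cases "m \<in> Poly_Mapping.keys p") (auto simp: in_keys_iff)
  finally show "lkp (\<Sum>k\<in>A. hcomp k p) m = lkp p m" .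
qed

lemma sum_hcomp_keys: "(\<Sum>k\<in>mdeg ` Poly_Mapping.keys p. hcomp k p) = p"
  by (rule sum_hcomp) auto

lemma hcomp_mult_graded:
  assumes "p \<in> poly_ring n" "g \<in> graded_part n e"
  shows "hcomp k (p * g) = (if e \<le> k then hcomp (k - e) p * g else 0)"
proof -
  let ?A = "mdeg ` Poly_Mapping.keys p"
  have "hcomp k (p * g) = (\<Sum>j\<in>?A. hcomp k (hcomp j p * g))"
    by (subst (1) sum_hcomp_keys[symmetric]) (simp add: sum_distrib_right hcomp_sum)
  also have "\<dots> = (\<Sum>j\<in>?A. if k = j + e then hcomp j p * g else 0)"
    by (intro sum.cong refl hcomp_of_graded[where n = n] graded_part_mult[OF hcomp_graded[OF assms(1)] assms(2)])
  \<comment> \<open>The index \<open>k - e\<close> is inserted so that one summand can be singled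
    out even if \<open>p\<close> has no component of that degree. The truncated difference is
    harmless, since the guard \<open>k = j + e\<close> fails for \<open>k < e\<close>.\<close>
  also have "\<dots> = (\<Sum>j\<in>insert (k - e) ?A. if k = j + e then hcomp j p * g else 0)"
  proof (rule sum.mono_neutral_left)
    have "hcomp (k - e) p = 0" if "k - e \<notin> ?A"
      using that by (intro poly_mapping_eqI) (metis image_eqI in_keys_iff lookup_hcomp lookup_zero)
    then show "\<forall>i\<in>insert (k - e) ?A - ?A. (if k = i + e then hcomp i p * g else 0) = 0"
      by auto
  qed auto
  also have "\<dots> = (\<Sum>j\<in>insert (k - e) ?A. if j = k - e then (if e \<le> k then hcomp (k - e) p * g else 0) else 0)"
    by (intro sum.cong) auto
  also have "\<dots> = (if e \<le> k then hcomp (k - e) p * g else 0)"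
    by simp
  finally show ?thesis .
qed

section \<open>Evaluation at points of affine space\<close>

definition monom_val :: "(nat \<Rightarrow> complex) \<Rightarrow> monom \<Rightarrow> complex" where
  "monom_val a m = (\<Prod>i\<in>Poly_Mapping.keys m. a i ^ lkp m i)"

lemma monom_val_superset:
  "finite A \<Longrightarrow> Poly_Mapping.keys m \<subseteq> A \<Longrightarrow> monom_val a m = (\<Prod>i\<in>A. a i ^ lkp m i)"
  unfolding monom_val_def by (rule prod.mono_neutral_left) (auto simp: in_keys_iff)

lemma monom_val_add: "monom_val a (m + m') = monom_val a m * monom_val a m'"
proof -
  let ?A = "Poly_Mapping.keys m \<union> Poly_Mapping.keys m'"
  have "monom_val a (m + m') = (\<Prod>i\<in>?A. a i ^ lkp (m + m') i)"
    "monom_val a m = (\<Prod>i\<in>?A. a i ^ lkp m i)" "monom_val a m' = (\<Prod>i\<in>?A. a i ^ lkp m' i)"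
    by (auto intro!: monom_val_superset simp: keys_add_nat)
  then show ?thesis by (simp add: lookup_add power_add prod.distrib)
qed

lemma eval_superset:
  "finite A \<Longrightarrow> Poly_Mapping.keys p \<subseteq> A \<Longrightarrow> eval_mpoly a p = (\<Sum>m\<in>A. lkp p m * monom_val a m)"
  unfolding eval_mpoly_def monom_val_def[symmetric]
  by (rule sum.mono_neutral_left) (auto simp: in_keys_iff)

lemma eval_0 [simp]: "eval_mpoly a 0 = 0"
  by (simp add: eval_mpoly_def)

lemma eval_single: "eval_mpoly a (sngl m c) = c * monom_val a m"
  by (subst eval_superset[of "{m}"]) auto

lemma eval_const [simp]: "eval_mpoly a (sngl 0 c) = c"
  by (simp add: eval_single monom_val_def)

lemma eval_1 [simp]: "eval_mpoly a 1 = 1"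
  using eval_const[of a 1] by simp

lemma eval_xvar [simp]: "eval_mpoly a (xvar i) = a i"
  by (simp add: xvar_def eval_single monom_val_def)

lemma eval_add [simp]: "eval_mpoly a (p + q) = eval_mpoly a p + eval_mpoly a q"
proof -
  let ?A = "Poly_Mapping.keys p \<union> Poly_Mapping.keys q"
  have "eval_mpoly a (p + q) = (\<Sum>m\<in>?A. lkp (p + q) m * monom_val a m)"
    "eval_mpoly a p = (\<Sum>m\<in>?A. lkp p m * monom_val a m)"
    "eval_mpoly a q = (\<Sum>m\<in>?A. lkp q m * monom_val a m)"
    using keys_add[of p q] by (auto intro!: eval_superset)
  then show ?thesis by (simp add: lookup_add algebra_simps sum.distrib)
qed

lemma eval_sum: "eval_mpoly a (sum g A) = (\<Sum>x\<in>A. eval_mpoly a (g x))"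
  by (induction A rule: infinite_finite_induct) auto

lemma eval_mult [simp]: "eval_mpoly a (p * q) = eval_mpoly a p * eval_mpoly a q"
proof -
  have "p * q = (\<Sum>m\<in>Poly_Mapping.keys p. sngl m (lkp p m)) * (\<Sum>m\<in>Poly_Mapping.keys q. sngl m (lkp q m))"
    by (simp add: poly_mapping_sum_single)
  also have "eval_mpoly a \<dots> = (\<Sum>m\<in>Poly_Mapping.keys p. \<Sum>m'\<in>Poly_Mapping.keys q.
      (lkp p m * monom_val a m) * (lkp q m' * monom_val a m'))"
    by (simp add: sum_product mult_single eval_sum eval_single monom_val_add mult_ac)
  also have "\<dots> = eval_mpoly a p * eval_mpoly a q"
    by (simp add: eval_mpoly_def monom_val_def sum_product)
  finally show ?thesis .
qed

lemma eval_scale [simp]: "eval_mpoly a (scale c p) = c * eval_mpoly a p"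
  by (simp add: scale_def)

lemma eval_diff [simp]: "eval_mpoly a (p - q) = eval_mpoly a p - eval_mpoly a q"
  using eval_add[of a "p - q" q] by (simp add: algebra_simps)

lemma eval_power [simp]: "eval_mpoly a (p ^ k) = eval_mpoly a p ^ k"
  by (induction k) auto

lemma eval_prod: "eval_mpoly a (prod g A) = (\<Prod>x\<in>A. eval_mpoly a (g x))"
  by (induction A rule: infinite_finite_induct) auto

lemma monom_val_cmult: "monom_val (\<lambda>i. t * a i) m = t ^ mdeg m * monom_val a m"
  by (simp add: monom_val_def mdeg_def power_mult_distrib prod.distrib power_sum)

lemma eval_cmult:
  "p \<in> graded_part n k \<Longrightarrow> eval_mpoly (\<lambda>i. t * a i) p = t ^ k * eval_mpoly a p"
  by (simp add: eval_mpoly_def monom_val_def[symmetric] monom_val_cmult graded_part_iff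
      sum_distrib_left mult_ac cong: sum.cong)

text \<open>Points are functions on all indices. The Nullstellensatz deals with arbitrary ones,
  while projective points vanish above \<open>n\<close>; this lemma mediates between the
  two.\<close>

lemma eval_cong:
  assumes "p \<in> poly_ring n" "\<And>i. i \<le> n \<Longrightarrow> a i = b i"
  shows "eval_mpoly a p = eval_mpoly b p"
proof -
  have "monom_val a m = monom_val b m" if "m \<in> Poly_Mapping.keys p" for m
  proof -
    have "Poly_Mapping.keys m \<subseteq> {..n}"
      using assms(1) that by (auto simp: poly_ring_iff monoms_def)
    then show ?thesis using assms(2) unfolding monom_val_def by (intro prod.cong) auto
  qed
  then show ?thesis by (simp add: eval_mpoly_def monom_val_def[symmetric])
qed

section \<open>Quotient spaces\<close>

text \<open>The quotient by \<open>W\<close> is realized inside the same space, by projection along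
  \<open>W\<close> onto a complement. Independence and span modulo \<open>W\<close> become ordinary
  independence and span of the images.\<close>

lemma (in vector_space) exists_linear_with_kernel:
  assumes "subspace W"
  obtains \<pi> where "Vector_Spaces.linear scale scale \<pi>" "\<And>x. \<pi> x = 0 \<longleftrightarrow> x \<in> W"
proof -
  interpret pair: vector_space_pair scale scale ..
  obtain Bw where Bw: "Bw \<subseteq> W" "independent Bw" "W \<subseteq> span Bw"
    using maximal_independent_subset by blast
  obtain Bu where Bu: "Bw \<subseteq> Bu" "independent Bu" "UNIV \<subseteq> span Bu"
    using maximal_independent_subset_extend[OF _ Bw(2), of UNIV] by auto
  define \<pi> where "\<pi> = pair.construct Bu (\<lambda>b. if b \<in> Bw then 0 else b)"
  have lin: "Vector_Spaces.linear scale scale \<pi>"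
    unfolding \<pi>_def by (rule pair.linear_construct[OF Bu(2)])
  have basis: "\<pi> b = (if b \<in> Bw then 0 else b)" if "b \<in> Bu" for b
    unfolding \<pi>_def by (rule pair.construct_basis[OF Bu(2) that])
  have zero: "\<pi> x = 0" if "x \<in> span Bw" for x
    by (rule pair.linear_eq_0_on_span[OF lin _ that]) (use basis Bu(1) in auto)
  have ident: "\<pi> x = x" if "x \<in> span (Bu - Bw)" for x
    using pair.linear_eq_on[OF lin linear_id that] basis Bu(1) by auto
  have "\<pi> x = 0 \<longleftrightarrow> x \<in> W" for x
  proof -
    have "x \<in> span (Bw \<union> (Bu - Bw))"
      using Bu by (simp add: Un_absorb1 subset_iff)
    then obtain w u where x: "x = w + u" "w \<in> span Bw" "u \<in> span (Bu - Bw)"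
      unfolding span_Un by blast
    have "\<pi> x = u"
      using zero[OF x(2)] ident[OF x(3)] pair.linear_add[OF lin] x(1) by simp
    moreover have "span Bw = W"
      using Bw assms by (metis span_minimal subset_antisym)
    ultimately show ?thesis using zero x by auto
  qed
  with lin show ?thesis by (rule that)
qed

lemma quotient_basisI:
  assumes "B \<subseteq> V"
    and "\<And>F c b. finite F \<Longrightarrow> F \<subseteq> B \<Longrightarrow> (\<Sum>b\<in>F. scale (c b) b) \<in> W \<Longrightarrow> b \<in> F \<Longrightarrow> c b = 0"
    and "\<And>v. v \<in> V \<Longrightarrow> \<exists>F c. finite F \<and> F \<subseteq> B \<and> v - (\<Sum>b\<in>F. scale (c b) b) \<in> W"
  shows "quotient_basis V W B"
  unfolding quotient_basis_def
proof (intro conjI allI impI ballI)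
  fix F c b assume "finite F \<and> F \<subseteq> B \<and> (\<Sum>b\<in>F. scale (c b) b) \<in> W" "b \<in> F"
  then show "c b = 0" using assms(2)[of F c b] by simp
next
  fix v assume "v \<in> V"
  then show "\<exists>F c. finite F \<and> F \<subseteq> B \<and> v - (\<Sum>b\<in>F. scale (c b) b) \<in> W"
    by (rule assms(3))
qed (rule assms(1))

lemma quotient_basis_subset: "quotient_basis V W B \<Longrightarrow> B \<subseteq> V"
  by (simp add: quotient_basis_def)

lemma quotient_basis_indep:
  "quotient_basis V W B \<Longrightarrow> finite F \<Longrightarrow> F \<subseteq> B \<Longrightarrow> (\<Sum>b\<in>F. scale (c b) b) \<in> W \<Longrightarrow> b \<in> F \<Longrightarrow> c b = 0"
  unfolding quotient_basis_def by simp

lemma quotient_basis_span: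
  assumes "quotient_basis V W B" "v \<in> V"
  obtains F c where "finite F" "F \<subseteq> B" "v - (\<Sum>b\<in>F. scale (c b) b) \<in> W"
proof -
  have "\<exists>F c. finite F \<and> F \<subseteq> B \<and> v - (\<Sum>b\<in>F. scale (c b) b) \<in> W"
    using assms unfolding quotient_basis_def by simp
  then show ?thesis using that by auto
qed

lemma quotient_basis_not_mem:
  assumes "quotient_basis V W B" "b \<in> B"
  shows "b \<notin> W"
  using quotient_basis_indep[OF assms(1), of "{b}" "\<lambda>_. 1" b] assms(2) by auto

lemma quotient_basis_iff_image:
  assumes lin: "Vector_Spaces.linear scale scale \<pi>" and ker: "\<And>x. \<pi> x = 0 \<longleftrightarrow> x \<in> W"
  shows "quotient_basis V W B \<longleftrightarrow>
    B \<subseteq> V \<and> inj_on \<pi> B \<and> mp.independent (\<pi> ` B) \<and> \<pi> ` V \<subseteq> mp.span (\<pi> ` B)"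
    (is "_ \<longleftrightarrow> ?R")
proof
  interpret \<pi>: Vector_Spaces.linear scale scale \<pi> by (rule lin)
  assume qb: "quotient_basis V W B"
  have inj: "inj_on \<pi> B"
  proof (rule inj_onI, rule ccontr)
    fix a b assume ab: "a \<in> B" "b \<in> B" "\<pi> a = \<pi> b" "a \<noteq> b"
    then have "a - b \<in> W" by (simp add: ker[symmetric] \<pi>.diff)
    then have "(\<Sum>x\<in>{a, b}. scale (if x = a then 1 else - 1) x) \<in> W"
      using ab by simp
    from quotient_basis_indep[OF qb _ _ this, of a] ab show False by auto
  qed
  have "mp.independent (\<pi> ` B)"
    unfolding mp.independent_explicit_finite_subsets
  proof (intro allI impI ballI)
    fix S u v assume S: "S \<subseteq> \<pi> ` B" "finite S" "(\<Sum>v\<in>S. scale (u v) v) = 0" "v \<in> S"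
    then obtain F where F: "F \<subseteq> B" "finite F" "S = \<pi> ` F"
      by (meson finite_subset_image)
    have "inj_on \<pi> F" using inj F(1) by (rule inj_on_subset)
    then have "(\<Sum>v\<in>S. scale (u v) v) = \<pi> (\<Sum>b\<in>F. scale (u (\<pi> b)) b)"
      by (simp add: F(3) sum.reindex \<pi>.sum \<pi>.scale)
    with S(3) have "(\<Sum>b\<in>F. scale (u (\<pi> b)) b) \<in> W" by (simp add: ker)
    from quotient_basis_indep[OF qb F(2,1) this] S(4) F(3) show "u v = 0" by auto
  qed
  moreover have "\<pi> ` V \<subseteq> mp.span (\<pi> ` B)"
  proof
    fix y assume "y \<in> \<pi> ` V"
    then obtain v where v: "v \<in> V" "y = \<pi> v" by auto
    obtain F c where F: "finite F" "F \<subseteq> B" "v - (\<Sum>b\<in>F. scale (c b) b) \<in> W"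
      by (rule quotient_basis_span[OF qb v(1)])
    then have y: "y = (\<Sum>b\<in>F. scale (c b) (\<pi> b))"
      using ker[of "v - (\<Sum>b\<in>F. scale (c b) b)"] v(2) by (simp add: \<pi>.diff \<pi>.sum \<pi>.scale)
    then show "y \<in> mp.span (\<pi> ` B)"
      unfolding y using F(2) by (intro mp.span_sum mp.span_scale mp.span_base) auto
  qed
  ultimately show ?R using inj quotient_basis_subset[OF qb] by simp
next
  interpret \<pi>: Vector_Spaces.linear scale scale \<pi> by (rule lin)
  assume R: ?R
  show "quotient_basis V W B"
  proof (rule quotient_basisI)
    fix F c b assume F: "finite F" "F \<subseteq> B" "(\<Sum>b\<in>F. scale (c b) b) \<in> W" "b \<in> F"
    have inj: "inj_on \<pi> F" using R F(2) inj_on_subset by blast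
    define u where "u y = c (the_inv_into F \<pi> y)" for y
    have u: "u (\<pi> b) = c b" if "b \<in> F" for b
      using the_inv_into_f_f[OF inj that] by (simp add: u_def)
    have "(\<Sum>v\<in>\<pi> ` F. scale (u v) v) = \<pi> (\<Sum>b\<in>F. scale (c b) b)"
      by (simp add: sum.reindex[OF inj] \<pi>.sum \<pi>.scale u)
    also have "\<dots> = 0" using F(3) ker by simp
    finally have sum0: "(\<Sum>v\<in>\<pi> ` F. scale (u v) v) = 0" .
    have "mp.independent (\<pi> ` B)" "\<pi> ` F \<subseteq> \<pi> ` B" using R F(2) by auto
    then have "u (\<pi> b) = 0"
      using sum0 F(1,4) unfolding mp.independent_explicit_finite_subsets by simp
    then show "c b = 0" using u F(4) by simp
  next
    fix v assume "v \<in> V"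
    then have "\<pi> v \<in> mp.span (\<pi> ` B)" using R by blast
    then obtain S r where S: "finite S" "S \<subseteq> \<pi> ` B" "\<pi> v = (\<Sum>a\<in>S. scale (r a) a)"
      unfolding mp.span_explicit by auto
    then obtain F where F: "F \<subseteq> B" "finite F" "S = \<pi> ` F"
      by (meson finite_subset_image)
    have "inj_on \<pi> F" using R F(1) inj_on_subset by blast
    then have "\<pi> (v - (\<Sum>b\<in>F. scale (r (\<pi> b)) b)) = 0"
      by (simp add: S(3) F(3) sum.reindex \<pi>.diff \<pi>.sum \<pi>.scale)
    then show "\<exists>F c. finite F \<and> F \<subseteq> B \<and> v - (\<Sum>b\<in>F. scale (c b) b) \<in> W"
      using F(1,2) ker by (intro exI[of _ F] exI[of _ "\<lambda>b. r (\<pi> b)"]) simp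
  qed (use R in blast)
qed

lemma quotient_basis_exists:
  assumes "mp.subspace W"
  obtains B where "quotient_basis V W B"
proof -
  obtain \<pi> where \<pi>: "Vector_Spaces.linear scale scale \<pi>" "\<And>x. \<pi> x = 0 \<longleftrightarrow> x \<in> W"
    using mp.exists_linear_with_kernel[OF assms] by blast
  obtain C where C: "C \<subseteq> \<pi> ` V" "mp.independent C" "\<pi> ` V \<subseteq> mp.span C"
    using mp.maximal_independent_subset by blast
  then obtain B where "B \<subseteq> V" "inj_on \<pi> B" "\<pi> ` B = C"
    by (metis subset_image_inj)
  then have "quotient_basis V W B"
    unfolding quotient_basis_iff_image[OF \<pi>] using C by simp
  then show ?thesis by (rule that)
qed

text \<open>Steinitz exchange among the images under a projection with kernel \<open>W\<close>,
  where \<open>W\<close> itself contributes only zero.\<close>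

lemma quotient_basis_card_le:
  assumes "mp.subspace W" "quotient_basis V W B" "V \<subseteq> mp.span (S \<union> W)" "finite S"
  shows "finite B \<and> card B \<le> card S"
proof -
  obtain \<pi> where \<pi>: "Vector_Spaces.linear scale scale \<pi>" "\<And>x. \<pi> x = 0 \<longleftrightarrow> x \<in> W"
    using mp.exists_linear_with_kernel[OF assms(1)] by blast
  interpret \<pi>: Vector_Spaces.linear scale scale \<pi> by (rule \<pi>(1))
  note B = assms(2)[unfolded quotient_basis_iff_image[OF \<pi>]]
  have "\<pi> ` V \<subseteq> mp.span (\<pi> ` (S \<union> W))"
    using assms(3) by (auto simp: \<pi>.span_image)
  also have "\<dots> \<subseteq> mp.span (insert 0 (\<pi> ` S))"
    using \<pi>(2) by (intro mp.span_mono) auto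
  finally have "\<pi> ` B \<subseteq> mp.span (\<pi> ` S)" using B by auto
  then have "finite (\<pi> ` B) \<and> card (\<pi> ` B) \<le> card (\<pi> ` S)"
    using B assms(4) by (intro mp.independent_span_bound) auto
  moreover have "card (\<pi> ` S) \<le> card S" by (rule card_image_le[OF assms(4)])
  ultimately show ?thesis using B by (auto simp: card_image dest: finite_imageD)
qed

lemma quotient_basis_card_mono:
  assumes "mp.subspace W" "V' \<subseteq> V" "quotient_basis V' W B'" "quotient_basis V W B" "finite B"
  shows "finite B' \<and> card B' \<le> card B"
proof (rule quotient_basis_card_le[OF assms(1,3) _ assms(5)])
  show "V' \<subseteq> mp.span (B \<union> W)"
  proof
    fix v assume "v \<in> V'"
    then obtain F c where F: "finite F" "F \<subseteq> B" "v - (\<Sum>b\<in>F. scale (c b) b) \<in> W"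
      using quotient_basis_span[OF assms(4)] assms(2) by blast
    have "(\<Sum>b\<in>F. scale (c b) b) + (v - (\<Sum>b\<in>F. scale (c b) b)) \<in> mp.span (B \<union> W)"
      using F by (intro mp.span_add mp.span_sum mp.span_scale mp.span_base) auto
    then show "v \<in> mp.span (B \<union> W)" by simp
  qed
qed

text \<open>The choice inside \<open>quotient_dim\<close> is immaterial: two bases bound each
  other's size, and if one is infinite then so is the other, with \<open>card\<close> equal to 0 for
  both.\<close>

lemma quotient_dim_eq_card:
  assumes "mp.subspace W" "quotient_basis V W B"
  shows "quotient_dim V W = card B"
proof -
  let ?B = "SOME B. quotient_basis V W B"
  have "quotient_basis V W ?B" using assms(2) by (rule someI)
  then have "card ?B = card B"
    using quotient_basis_card_mono[OF assms(1) subset_refl \<open>quotient_basis V W ?B\<close> assms(2)]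
      quotient_basis_card_mono[OF assms(1) subset_refl assms(2) \<open>quotient_basis V W ?B\<close>]
    by (cases "finite B"; cases "finite ?B") auto
  then show ?thesis by (simp add: quotient_dim_def)
qed

lemma finite_quotient_basis:
  "mp.subspace W \<Longrightarrow> finite_dim_quotient V W \<Longrightarrow> quotient_basis V W B \<Longrightarrow> finite B"
  unfolding finite_dim_quotient_def using quotient_basis_card_mono by blast

text \<open>Hilbert functions divide the forms of one degree by a whole ideal, so only the trace of
  \<open>W\<close> on \<open>V\<close> may matter.\<close>

lemma quotient_basis_cong:
  assumes "mp.subspace V" "V \<inter> W = V \<inter> W'" "quotient_basis V W B"
  shows "quotient_basis V W' B"
proof (rule quotient_basisI)
  have mem: "(\<Sum>b\<in>F. scale (c b) b) \<in> V" if "F \<subseteq> B" for F c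
    using that quotient_basis_subset[OF assms(3)]
    by (intro mp.subspace_sum[OF assms(1)] mp.subspace_scale[OF assms(1)]) auto
  show "c b = 0" if "finite F" "F \<subseteq> B" "(\<Sum>b\<in>F. scale (c b) b) \<in> W'" "b \<in> F" for F c b
  proof (rule quotient_basis_indep[OF assms(3) that(1,2) _ that(4)])
    show "(\<Sum>b\<in>F. scale (c b) b) \<in> W" using that(3) mem[OF that(2)] assms(2) by blast
  qed
  fix v assume v: "v \<in> V"
  obtain F c where F: "finite F" "F \<subseteq> B" "v - (\<Sum>b\<in>F. scale (c b) b) \<in> W"
    by (rule quotient_basis_span[OF assms(3) v])
  then have "v - (\<Sum>b\<in>F. scale (c b) b) \<in> W'"
    using mp.subspace_diff[OF assms(1) v mem[OF F(2)]] assms(2) by blast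
  then show "\<exists>F c. finite F \<and> F \<subseteq> B \<and> v - (\<Sum>b\<in>F. scale (c b) b) \<in> W'"
    using F(1,2) by blast
qed (rule quotient_basis_subset[OF assms(3)])

lemma quotient_dim_cong:
  assumes "mp.subspace V" "mp.subspace W" "mp.subspace W'" "V \<inter> W = V \<inter> W'"
  shows "quotient_dim V W = quotient_dim V W'"
proof -
  obtain B where B: "quotient_basis V W B" using quotient_basis_exists[OF assms(2)] .
  show ?thesis
    using quotient_dim_eq_card[OF assms(2) B]
      quotient_dim_eq_card[OF assms(3) quotient_basis_cong[OF assms(1,4) B]] by simp
qed

lemma quotient_dim_mono:
  assumes "mp.subspace W" "V' \<subseteq> V" "finite_dim_quotient V W"
  shows "quotient_dim V' W \<le> quotient_dim V W"
proof -
  obtain B where B: "finite B" "quotient_basis V W B"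
    using assms(3) by (auto simp: finite_dim_quotient_def)
  obtain B' where B': "quotient_basis V' W B'" using quotient_basis_exists[OF assms(1)] .
  show ?thesis
    using quotient_basis_card_mono[OF assms(1,2) B' B(2,1)]
      quotient_dim_eq_card[OF assms(1) B(2)] quotient_dim_eq_card[OF assms(1) B'] by simp
qed

lemma quotient_dim_saturate:
  assumes "mp.subspace W" "V' \<subseteq> V" "\<And>v. v \<in> V \<Longrightarrow> \<exists>v'\<in>V'. v - v' \<in> W"
  shows "quotient_dim V W = quotient_dim V' W"
proof -
  obtain B where B: "quotient_basis V' W B" using quotient_basis_exists[OF assms(1)] .
  have "quotient_basis V W B"
  proof (rule quotient_basisI)
    fix v assume "v \<in> V"
    then obtain v' where v': "v' \<in> V'" "v - v' \<in> W" using assms(3) by blast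
    obtain F c where F: "finite F" "F \<subseteq> B" "v' - (\<Sum>b\<in>F. scale (c b) b) \<in> W"
      by (rule quotient_basis_span[OF B v'(1)])
    have "(v - v') + (v' - (\<Sum>b\<in>F. scale (c b) b)) \<in> W"
      by (rule mp.subspace_add[OF assms(1) v'(2) F(3)])
    then show "\<exists>F c. finite F \<and> F \<subseteq> B \<and> v - (\<Sum>b\<in>F. scale (c b) b) \<in> W"
      using F by auto
  next
    show "B \<subseteq> V" using quotient_basis_subset[OF B] assms(2) by simp
  qed (rule quotient_basis_indep[OF B])
  from quotient_dim_eq_card[OF assms(1) this] quotient_dim_eq_card[OF assms(1) B]
  show ?thesis by simp
qed

text \<open>First isomorphism theorem: if \<open>\<pi>\<close> has kernel \<open>W\<close>, then
  \<open>\<pi> \<circ> \<phi>\<close> has the preimage of \<open>W\<close> as its kernel, and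
  \<open>\<phi>\<close> carries a basis of one quotient to a basis of the other.\<close>

lemma quotient_dim_image:
  assumes lin: "Vector_Spaces.linear scale scale \<phi>" and "mp.subspace W"
  shows "quotient_dim (\<phi> ` V) W = quotient_dim V {x. \<phi> x \<in> W}"
proof -
  interpret \<phi>: Vector_Spaces.linear scale scale \<phi> by (rule lin)
  have sub: "mp.subspace {x. \<phi> x \<in> W}"
    using \<phi>.subspace_vimage[OF assms(2)] by (simp add: vimage_def)
  obtain B where B: "quotient_basis V {x. \<phi> x \<in> W} B" using quotient_basis_exists[OF sub] .
  obtain \<pi> where \<pi>: "Vector_Spaces.linear scale scale \<pi>" "\<And>x. \<pi> x = 0 \<longleftrightarrow> x \<in> W"
    using mp.exists_linear_with_kernel[OF assms(2)] by blast
  have \<pi>\<phi>: "Vector_Spaces.linear scale scale (\<pi> \<circ> \<phi>)" "\<And>x. (\<pi> \<circ> \<phi>) x = 0 \<longleftrightarrow> x \<in> {x. \<phi> x \<in> W}"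
    using Vector_Spaces.linear_compose[OF lin \<pi>(1)] \<pi>(2) by auto
  have "quotient_basis (\<phi> ` V) W (\<phi> ` B)" "inj_on \<phi> B"
    using B unfolding quotient_basis_iff_image[OF \<pi>] quotient_basis_iff_image[OF \<pi>\<phi>]
    by (auto simp: image_comp intro: inj_on_imageI inj_on_imageI2)
  then show ?thesis
    using quotient_dim_eq_card[OF assms(2), of "\<phi> ` V" "\<phi> ` B"] quotient_dim_eq_card[OF sub B]
    by (simp add: card_image)
qed

text \<open>Additivity along the filtration by \<open>V \<inter> W'\<close>: a basis of that part
  modulo \<open>W\<close> and lifts of a basis modulo \<open>W'\<close> together form a basis.
  Finiteness keeps \<open>card\<close> additive.\<close>

lemma quotient_dim_add:
  assumes V: "mp.subspace V" and W: "mp.subspace W" and W': "mp.subspace W'" and "W \<subseteq> W'"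
    and fin: "finite_dim_quotient V W"
  shows "quotient_dim V W = quotient_dim V W' + quotient_dim (V \<inter> W') W"
proof -
  obtain B1 where B1: "quotient_basis V W' B1" using quotient_basis_exists[OF W'] .
  obtain B2 where B2: "quotient_basis (V \<inter> W') W B2" using quotient_basis_exists[OF W] .
  have disj: "B1 \<inter> B2 = {}"
    using quotient_basis_not_mem[OF B1] quotient_basis_subset[OF B2] by auto
  have "quotient_basis V W (B1 \<union> B2)"
  proof (rule quotient_basisI)
    show "B1 \<union> B2 \<subseteq> V" using quotient_basis_subset[OF B1] quotient_basis_subset[OF B2] by auto
  next
    fix F c b assume F: "finite F" "F \<subseteq> B1 \<union> B2" "(\<Sum>b\<in>F. scale (c b) b) \<in> W" "b \<in> F"
    have split: "(\<Sum>b\<in>F. scale (c b) b) = (\<Sum>b\<in>F \<inter> B1. scale (c b) b) + (\<Sum>b\<in>F \<inter> B2. scale (c b) b)"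
      using F disj by (subst sum.union_disjoint[symmetric]) (auto intro!: sum.cong)
    \<comment> \<open>Modulo \<open>W'\<close> the \<open>B2\<close> part disappears, which kills
      the coefficients on \<open>B1\<close>; what remains is a relation among elements of
      \<open>B2\<close> modulo \<open>W\<close>.\<close>
    have "(\<Sum>b\<in>F \<inter> B2. scale (c b) b) \<in> W'"
      using quotient_basis_subset[OF B2]
      by (intro mp.subspace_sum[OF W'] mp.subspace_scale[OF W']) auto
    then have "(\<Sum>b\<in>F. scale (c b) b) - (\<Sum>b\<in>F \<inter> B2. scale (c b) b) \<in> W'"
      using F(3) assms(4) by (intro mp.subspace_diff[OF W']) auto
    then have "(\<Sum>b\<in>F \<inter> B1. scale (c b) b) \<in> W'"
      unfolding split by simp
    from quotient_basis_indep[OF B1 _ _ this] F(1) have c1: "c b = 0" if "b \<in> F \<inter> B1" for b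
      using that by blast
    then have "(\<Sum>b\<in>F \<inter> B2. scale (c b) b) \<in> W"
      using F(3) unfolding split by simp
    from quotient_basis_indep[OF B2 _ _ this] F(1) have "c b = 0" if "b \<in> F \<inter> B2" for b
      using that by blast
    with c1 F show "c b = 0" by blast
  next
    fix v assume v: "v \<in> V"
    obtain F c where F: "finite F" "F \<subseteq> B1" "v - (\<Sum>b\<in>F. scale (c b) b) \<in> W'"
      by (rule quotient_basis_span[OF B1 v])
    have "v - (\<Sum>b\<in>F. scale (c b) b) \<in> V"
      using quotient_basis_subset[OF B1] F(2)
      by (intro mp.subspace_diff[OF V v] mp.subspace_sum[OF V] mp.subspace_scale[OF V]) auto
    then obtain F' c' where F': "finite F'" "F' \<subseteq> B2"
      "v - (\<Sum>b\<in>F. scale (c b) b) - (\<Sum>b\<in>F'. scale (c' b) b) \<in> W"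
      using quotient_basis_span[OF B2] F(3) by blast
    let ?c = "\<lambda>b. if b \<in> B1 then c b else c' b"
    have "(\<Sum>b\<in>F \<union> F'. scale (?c b) b) = (\<Sum>b\<in>F. scale (?c b) b) + (\<Sum>b\<in>F'. scale (?c b) b)"
      using F F' disj by (intro sum.union_disjoint) auto
    also have "(\<Sum>b\<in>F. scale (?c b) b) = (\<Sum>b\<in>F. scale (c b) b)"
      using F by (intro sum.cong) auto
    also have "(\<Sum>b\<in>F'. scale (?c b) b) = (\<Sum>b\<in>F'. scale (c' b) b)"
      using F' disj by (intro sum.cong) auto
    finally have "v - (\<Sum>b\<in>F \<union> F'. scale (?c b) b) \<in> W" using F'(3) by (simp add: algebra_simps)
    then show "\<exists>F c. finite F \<and> F \<subseteq> B1 \<union> B2 \<and> v - (\<Sum>b\<in>F. scale (c b) b) \<in> W"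
      using F F' by (intro exI[of _ "F \<union> F'"] exI[of _ ?c]) auto
  qed
  moreover from this have "finite (B1 \<union> B2)" by (rule finite_quotient_basis[OF W fin])
  ultimately show ?thesis
    using quotient_dim_eq_card[OF W] quotient_dim_eq_card[OF W' B1] quotient_dim_eq_card[OF W B2] disj
    by (simp add: card_Un_disjoint)
qed

lemma finite_dim_quotient_span:
  assumes "mp.subspace W" "V \<subseteq> mp.span S" "finite S"
  shows "finite_dim_quotient V W"
proof -
  obtain B where "quotient_basis V W B" using quotient_basis_exists[OF assms(1)] .
  moreover have "V \<subseteq> mp.span (S \<union> W)"
    using assms(2) mp.span_mono[of S "S \<union> W"] by blast
  ultimately show ?thesis
    using quotient_basis_card_le[OF assms(1) _ _ assms(3)] unfolding finite_dim_quotient_def by blast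
qed

lemma quotient_dim_eq_0_iff:
  assumes "mp.subspace W" "finite_dim_quotient V W"
  shows "quotient_dim V W = 0 \<longleftrightarrow> V \<subseteq> W"
proof -
  obtain B where B: "quotient_basis V W B" using quotient_basis_exists[OF assms(1)] .
  have "quotient_dim V W = 0 \<longleftrightarrow> B = {}"
    using quotient_dim_eq_card[OF assms(1) B] finite_quotient_basis[OF assms B] by simp
  also have "\<dots> \<longleftrightarrow> V \<subseteq> W"
  proof
    assume "B = {}"
    show "V \<subseteq> W"
    proof
      fix v assume v: "v \<in> V"
      obtain F c where "F \<subseteq> B" "v - (\<Sum>b\<in>F. scale (c b) b) \<in> W"
        by (rule quotient_basis_span[OF B v])
      then show "v \<in> W" using \<open>B = {}\<close> by simp
    qed
  next
    assume "V \<subseteq> W"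
    then show "B = {}" using quotient_basis_subset[OF B] quotient_basis_not_mem[OF B] by blast
  qed
  finally show ?thesis .
qed

section \<open>Homogeneous ideals and their Hilbert functions\<close>

definition is_ideal :: "nat \<Rightarrow> mpoly set \<Rightarrow> bool" where
  "is_ideal n I \<longleftrightarrow> I \<subseteq> poly_ring n \<and> 0 \<in> I \<and> (\<forall>p\<in>I. \<forall>q\<in>I. p + q \<in> I) \<and>
     (\<forall>p\<in>I. \<forall>q\<in>poly_ring n. q * p \<in> I)"

definition homogeneous_ideal :: "nat \<Rightarrow> mpoly set \<Rightarrow> bool" where
  "homogeneous_ideal n I \<longleftrightarrow> is_ideal n I \<and> (\<forall>p\<in>I. \<forall>k. hcomp k p \<in> I)"

definition ideal_adjoin :: "nat \<Rightarrow> mpoly set \<Rightarrow> mpoly \<Rightarrow> mpoly set" where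
  "ideal_adjoin n I g = {a + q * g | a q. a \<in> I \<and> q \<in> poly_ring n}"

definition colon :: "nat \<Rightarrow> mpoly set \<Rightarrow> mpoly \<Rightarrow> mpoly set" where
  "colon n I g = {q \<in> poly_ring n. q * g \<in> I}"

text \<open>Generators are indexed instead of collected in a set: partial derivatives may coincide,
  and the degree counts need \<open>card A\<close> generators with repetition.\<close>

definition ideal_span :: "nat \<Rightarrow> (nat \<Rightarrow> mpoly) \<Rightarrow> nat set \<Rightarrow> mpoly set" where
  "ideal_span n h A = {\<Sum>i\<in>A. q i * h i | q. \<forall>i\<in>A. q i \<in> poly_ring n}"

lemma
  assumes "is_ideal n I"
  shows ideal_poly_ring: "p \<in> I \<Longrightarrow> p \<in> poly_ring n"
    and ideal_0: "0 \<in> I"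
    and ideal_add: "p \<in> I \<Longrightarrow> q \<in> I \<Longrightarrow> p + q \<in> I"
    and ideal_mult: "p \<in> I \<Longrightarrow> r \<in> poly_ring n \<Longrightarrow> r * p \<in> I"
    and ideal_mult': "p \<in> I \<Longrightarrow> r \<in> poly_ring n \<Longrightarrow> p * r \<in> I"
  using assms by (auto simp: is_ideal_def mult.commute)

lemma ideal_subspace: "is_ideal n I \<Longrightarrow> mp.subspace I"
  by (rule mp.subspaceI) (auto simp: ideal_0 ideal_add scale_def intro: ideal_mult)

lemma ideal_diff: "is_ideal n I \<Longrightarrow> p \<in> I \<Longrightarrow> q \<in> I \<Longrightarrow> p - q \<in> I"
  by (rule mp.subspace_diff[OF ideal_subspace])

lemma ideal_sum: "is_ideal n I \<Longrightarrow> (\<And>x. x \<in> A \<Longrightarrow> g x \<in> I) \<Longrightarrow> sum g A \<in> I"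
  by (rule mp.subspace_sum[OF ideal_subspace])

lemma homogeneous_ideal_is_ideal: "homogeneous_ideal n I \<Longrightarrow> is_ideal n I"
  by (simp add: homogeneous_ideal_def)

lemma homogeneous_ideal_hcomp: "homogeneous_ideal n I \<Longrightarrow> p \<in> I \<Longrightarrow> hcomp k p \<in> I"
  by (simp add: homogeneous_ideal_def)

lemma ideal_adjoinI: "p = a + q * g \<Longrightarrow> a \<in> I \<Longrightarrow> q \<in> poly_ring n \<Longrightarrow> p \<in> ideal_adjoin n I g"
  by (auto simp: ideal_adjoin_def)

lemma ideal_adjoinE:
  assumes "p \<in> ideal_adjoin n I g"
  obtains a q where "p = a + q * g" "a \<in> I" "q \<in> poly_ring n"
  using assms by (auto simp: ideal_adjoin_def)

lemma is_ideal_adjoin: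
  assumes "is_ideal n I" "g \<in> poly_ring n"
  shows "is_ideal n (ideal_adjoin n I g)"
  unfolding is_ideal_def
proof (intro conjI ballI)
  note I = ideal_poly_ring[OF assms(1)] ideal_0[OF assms(1)] ideal_add[OF assms(1)] ideal_mult[OF assms(1)]
  show "ideal_adjoin n I g \<subseteq> poly_ring n"
    using I assms(2) by (auto elim!: ideal_adjoinE)
  show "0 \<in> ideal_adjoin n I g"
    by (rule ideal_adjoinI[of _ 0 0]) (use I(2) in auto)
  fix p assume "p \<in> ideal_adjoin n I g"
  then obtain a q where p: "p = a + q * g" "a \<in> I" "q \<in> poly_ring n"
    by (rule ideal_adjoinE)
  {
    fix p' assume "p' \<in> ideal_adjoin n I g"
    then obtain a' q' where p': "p' = a' + q' * g" "a' \<in> I" "q' \<in> poly_ring n"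
      by (rule ideal_adjoinE)
    have "p + p' = (a + a') + (q + q') * g" by (simp add: p p' algebra_simps)
    then show "p + p' \<in> ideal_adjoin n I g"
      by (rule ideal_adjoinI) (use I(3) p p' in auto)
  next
    fix r assume r: "r \<in> poly_ring n"
    have "r * p = r * a + (r * q) * g" by (simp add: p algebra_simps)
    then show "r * p \<in> ideal_adjoin n I g"
      by (rule ideal_adjoinI) (use I(4) p r in auto)
  }
qed

lemma ideal_adjoin_superset: "I \<subseteq> ideal_adjoin n I g"
proof
  fix p assume "p \<in> I"
  then show "p \<in> ideal_adjoin n I g" by (intro ideal_adjoinI[of _ p 0]) auto
qed

lemma ideal_adjoin_mult: "is_ideal n I \<Longrightarrow> q \<in> poly_ring n \<Longrightarrow> q * g \<in> ideal_adjoin n I g"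
  by (rule ideal_adjoinI[of _ 0 q]) (auto simp: ideal_0)

lemma ideal_adjoin_mem: "is_ideal n I \<Longrightarrow> g \<in> ideal_adjoin n I g"
  using ideal_adjoin_mult[of n I 1 g] by simp

lemma homogeneous_ideal_adjoin:
  assumes I: "homogeneous_ideal n I" and g: "g \<in> graded_part n e"
  shows "homogeneous_ideal n (ideal_adjoin n I g)"
  unfolding homogeneous_ideal_def
proof (intro conjI ballI allI)
  note I' = homogeneous_ideal_is_ideal[OF I]
  show "is_ideal n (ideal_adjoin n I g)"
    by (rule is_ideal_adjoin[OF I' graded_part_poly_ring[OF g]])
  fix p k assume "p \<in> ideal_adjoin n I g"
  then obtain a q where p: "p = a + q * g" "a \<in> I" "q \<in> poly_ring n"
    by (rule ideal_adjoinE)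
  have "hcomp k p = hcomp k a + (if e \<le> k then hcomp (k - e) q else 0) * g"
    by (simp add: p hcomp_add hcomp_mult_graded[OF p(3) g])
  moreover have "(if e \<le> k then hcomp (k - e) q else 0) \<in> poly_ring n"
    using graded_part_poly_ring[OF hcomp_graded[OF p(3)]] by simp
  ultimately show "hcomp k p \<in> ideal_adjoin n I g"
    by (rule ideal_adjoinI[OF _ homogeneous_ideal_hcomp[OF I p(2)]])
qed

lemma is_ideal_colon:
  assumes "is_ideal n I" "g \<in> poly_ring n"
  shows "is_ideal n (colon n I g)"
  using assms by (auto simp: is_ideal_def colon_def distrib_right mult.assoc)

lemma colon_superset: "is_ideal n I \<Longrightarrow> g \<in> poly_ring n \<Longrightarrow> I \<subseteq> colon n I g"
  by (auto simp: colon_def ideal_poly_ring intro: ideal_mult')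

lemma homogeneous_ideal_zero: "homogeneous_ideal n {0}"
  by (simp add: homogeneous_ideal_def is_ideal_def)

lemma ideal_span_empty [simp]: "ideal_span n h {} = {0}"
  by (simp add: ideal_span_def)

lemma ideal_span_insert:
  assumes "finite A" "j \<notin> A"
  shows "ideal_span n h (insert j A) = ideal_adjoin n (ideal_span n h A) (h j)"
proof (intro equalityI subsetI)
  fix p assume "p \<in> ideal_span n h (insert j A)"
  then show "p \<in> ideal_adjoin n (ideal_span n h A) (h j)"
    using assms by (force simp: ideal_span_def ideal_adjoin_def add.commute)
next
  fix p assume "p \<in> ideal_adjoin n (ideal_span n h A) (h j)"
  then obtain q r where q: "p = (\<Sum>i\<in>A. q i * h i) + r * h j" "\<forall>i\<in>A. q i \<in> poly_ring n" "r \<in> poly_ring n"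
    by (auto simp: ideal_span_def ideal_adjoin_def)
  have "(\<Sum>i\<in>A. q i * h i) = (\<Sum>i\<in>A. (q(j := r)) i * h i)"
    using assms by (intro sum.cong) auto
  then have "p = (\<Sum>i\<in>insert j A. (q(j := r)) i * h i)"
    using assms q(1) by (simp add: add.commute)
  then show "p \<in> ideal_span n h (insert j A)"
    unfolding ideal_span_def using q by (intro CollectI exI[of _ "q(j := r)"]) auto
qed

lemma is_ideal_span: "finite A \<Longrightarrow> (\<And>i. i \<in> A \<Longrightarrow> h i \<in> poly_ring n) \<Longrightarrow> is_ideal n (ideal_span n h A)"
  by (induction A rule: finite_induct)
    (auto simp: ideal_span_insert is_ideal_adjoin homogeneous_ideal_is_ideal[OF homogeneous_ideal_zero])

lemma homogeneous_ideal_span: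
  "finite A \<Longrightarrow> (\<And>i. i \<in> A \<Longrightarrow> h i \<in> graded_part n (e i)) \<Longrightarrow> homogeneous_ideal n (ideal_span n h A)"
  by (induction A rule: finite_induct)
    (auto simp: ideal_span_insert homogeneous_ideal_zero intro!: homogeneous_ideal_adjoin)

lemma ideal_span_mem:
  assumes "finite A" "i \<in> A"
  shows "h i \<in> ideal_span n h A"
proof -
  have "h i = (\<Sum>j\<in>A. (if j = i then 1 else 0) * h j)"
    using assms by (simp add: if_distrib[of "\<lambda>x. x * _"] cong: if_cong)
  then show ?thesis unfolding ideal_span_def by (intro CollectI exI[of _ "\<lambda>j. if j = i then 1 else 0"]) auto
qed

lemma ideal_span_subset: "is_ideal n I \<Longrightarrow> (\<And>i. i \<in> A \<Longrightarrow> h i \<in> I) \<Longrightarrow> ideal_span n h A \<subseteq> I"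
  by (auto simp: ideal_span_def intro!: ideal_sum ideal_mult)

lemma ideal_span_cong: "(\<And>i. i \<in> A \<Longrightarrow> h i = h' i) \<Longrightarrow> ideal_span n h A = ideal_span n h' A"
  by (simp add: ideal_span_def cong: sum.cong)

text \<open>From left to right one index is selected for each generator; from right to left the
  coefficients at equal generators are added up.\<close>

lemma ideal_gen_eq_span:
  assumes "finite A"
  shows "ideal_gen n (h ` A) = ideal_span n h A"
proof (intro equalityI subsetI)
  fix p assume "p \<in> ideal_gen n (h ` A)"
  then obtain F q where F: "finite F" "F \<subseteq> h ` A" "\<forall>g\<in>F. q g \<in> poly_ring n" "p = (\<Sum>g\<in>F. q g * g)"
    by (auto simp: ideal_gen_def)
  from F(2) obtain A' where A': "A' \<subseteq> A" "inj_on h A'" "F = h ` A'"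
    by (auto simp: subset_image_inj)
  have "p = (\<Sum>i\<in>A'. q (h i) * h i)"
    by (simp add: F(4) A' sum.reindex)
  also have "\<dots> = (\<Sum>i\<in>A. (if i \<in> A' then q (h i) else 0) * h i)"
    using A'(1) assms by (intro sum.mono_neutral_cong_left) auto
  finally show "p \<in> ideal_span n h A"
    unfolding ideal_span_def using F(3)[unfolded A'(3)]
    by (intro CollectI exI[of _ "\<lambda>i. if i \<in> A' then q (h i) else 0"]) auto
next
  fix p assume "p \<in> ideal_span n h A"
  then obtain q where q: "p = (\<Sum>i\<in>A. q i * h i)" "\<forall>i\<in>A. q i \<in> poly_ring n"
    by (auto simp: ideal_span_def)
  have "p = (\<Sum>g\<in>h ` A. \<Sum>i\<in>{i \<in> A. h i = g}. q i * h i)"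
    unfolding q(1) by (rule sum.image_gen[OF assms])
  also have "\<dots> = (\<Sum>g\<in>h ` A. (\<Sum>i\<in>{i \<in> A. h i = g}. q i) * g)"
    by (simp add: sum_distrib_right)
  finally show "p \<in> ideal_gen n (h ` A)"
    unfolding ideal_gen_def using q(2) assms
    by (intro CollectI exI[of _ "h ` A"] exI[of _ "\<lambda>g. \<Sum>i\<in>{i \<in> A. h i = g}. q i"])
      (auto intro!: poly_ring_sum)
qed

section \<open>Monomials of fixed degree and Hilbert functions\<close>

definition monoms_of_degree :: "nat \<Rightarrow> nat \<Rightarrow> monom set" where
  "monoms_of_degree n k = {m \<in> monoms n. mdeg m = k}"

lemma lookup_le_mdeg: "lkp m i \<le> mdeg m"
proof (cases "i \<in> Poly_Mapping.keys m")
  case True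
  then show ?thesis unfolding mdeg_def by (intro member_le_sum) auto
qed (simp add: in_keys_iff)

lemma finite_monoms_of_degree: "finite (monoms_of_degree n k)"
proof (rule finite_imageD)
  have "lkp ` monoms_of_degree n k \<subseteq>
      {g. \<forall>i. (i \<in> {..n} \<longrightarrow> g i \<in> {..k}) \<and> (i \<notin> {..n} \<longrightarrow> g i = 0)}"
    using lookup_le_mdeg by (auto simp: monoms_of_degree_def monoms_def in_keys_iff)
  then show "finite (lkp ` monoms_of_degree n k)"
    by (rule finite_subset) (rule finite_set_of_finite_funs, auto)
  show "inj_on lkp (monoms_of_degree n k)"
    by (auto intro!: inj_onI poly_mapping_eqI)
qed

lemma graded_part_span: "graded_part n k \<subseteq> mp.span ((\<lambda>m. sngl m 1) ` monoms_of_degree n k)"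
proof
  fix p assume p: "p \<in> graded_part n k"
  have "p = (\<Sum>m\<in>Poly_Mapping.keys p. scale (lkp p m) (sngl m 1))"
    by (simp add: scale_single poly_mapping_sum_single)
  also have "\<dots> \<in> mp.span ((\<lambda>m. sngl m 1) ` monoms_of_degree n k)"
    using p by (intro mp.span_sum mp.span_scale mp.span_base)
      (auto simp: graded_part_iff monoms_of_degree_def)
  finally show "p \<in> mp.span ((\<lambda>m. sngl m 1) ` monoms_of_degree n k)" .
qed

lemma finite_dim_graded_part: "mp.subspace W \<Longrightarrow> finite_dim_quotient (graded_part n k) W"
  by (rule finite_dim_quotient_span[OF _ graded_part_span]) (auto simp: finite_monoms_of_degree)

lemma hilbert_function_antimono:
  assumes "is_ideal n I" "is_ideal n K" "I \<subseteq> K"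
  shows "hilbert_function n K k \<le> hilbert_function n I k"
  unfolding hilbert_function_def
  using quotient_dim_add[OF subspace_graded_part ideal_subspace[OF assms(1)] ideal_subspace[OF assms(2)] assms(3)]
    finite_dim_graded_part ideal_subspace[OF assms(1)] by (metis le_add1)

text \<open>Equality leaves no room for a kernel of \<open>S/I -> S/K\<close> in degree
  \<open>k\<close>. In this way numerical coincidences are turned into regularity of forms.\<close>

lemma hilbert_function_eq_subset:
  assumes "is_ideal n I" "is_ideal n K" "I \<subseteq> K" "hilbert_function n K k = hilbert_function n I k"
    and "p \<in> K" "p \<in> graded_part n k"
  shows "p \<in> I"
proof -
  note sub = ideal_subspace[OF assms(1)]
  have "quotient_dim (graded_part n k \<inter> K) I = 0"
    using quotient_dim_add[OF subspace_graded_part sub ideal_subspace[OF assms(2)] assms(3)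
      finite_dim_graded_part[OF sub], of n k] assms(4) by (simp add: hilbert_function_def)
  moreover have "finite_dim_quotient (graded_part n k \<inter> K) I"
    using graded_part_span
    by (intro finite_dim_quotient_span[OF sub, of _ "(\<lambda>m. sngl m 1) ` monoms_of_degree n k"])
      (auto simp: finite_monoms_of_degree)
  ultimately show ?thesis using quotient_dim_eq_0_iff[OF sub] assms(5,6) by blast
qed

lemma hilbert_function_eq_0_iff:
  "is_ideal n I \<Longrightarrow> hilbert_function n I k = 0 \<longleftrightarrow> graded_part n k \<subseteq> I"
  unfolding hilbert_function_def
  by (intro quotient_dim_eq_0_iff finite_dim_graded_part ideal_subspace)

lemma linear_mult: "Vector_Spaces.linear scale scale (\<lambda>q. q * g)"
  by unfold_locales (auto simp: distrib_right scale_mult_left)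

text \<open>
  Multiplication by \<open>g\<close> maps \<open>S\<^sub>k / (I : g)\<^sub>k\<close> isomorphically onto the kernel of
  \<open>S\<^sub>k\<^sub>+\<^sub>e / I\<^sub>k\<^sub>+\<^sub>e \<rightarrow> S\<^sub>k\<^sub>+\<^sub>e / (I + gS)\<^sub>k\<^sub>+\<^sub>e\<close>.
\<close>

lemma hilbert_function_adjoin:
  assumes I: "homogeneous_ideal n I" and g: "g \<in> graded_part n e"
  shows "hilbert_function n I (k + e) =
    hilbert_function n (ideal_adjoin n I g) (k + e) + hilbert_function n (colon n I g) k"
proof -
  let ?J = "ideal_adjoin n I g"
  note I' = homogeneous_ideal_is_ideal[OF I]
  note sub = ideal_subspace[OF I']
  have J: "mp.subspace ?J"
    by (rule ideal_subspace[OF is_ideal_adjoin[OF I' graded_part_poly_ring[OF g]]])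
  have colon_sub: "mp.subspace (colon n I g)"
    by (rule ideal_subspace[OF is_ideal_colon[OF I' graded_part_poly_ring[OF g]]])
  have "quotient_dim (graded_part n (k + e) \<inter> ?J) I = quotient_dim ((\<lambda>q. q * g) ` graded_part n k) I"
  proof (rule quotient_dim_saturate[OF sub])
    show "(\<lambda>q. q * g) ` graded_part n k \<subseteq> graded_part n (k + e) \<inter> ?J"
      using g by (auto intro: graded_part_mult ideal_adjoin_mult[OF I'] graded_part_poly_ring)
    fix v assume v: "v \<in> graded_part n (k + e) \<inter> ?J"
    then obtain a q where aq: "v = a + q * g" "a \<in> I" "q \<in> poly_ring n"
      by (blast elim: ideal_adjoinE)
    \<comment> \<open>The multiplier \<open>q\<close> need not be homogeneous; its component of
      degree \<open>k\<close> does the same work up to an element of \<open>I\<close>.\<close>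
    have "v = hcomp (k + e) v" using v hcomp_of_graded by auto
    also have "\<dots> = hcomp (k + e) a + hcomp k q * g"
      by (simp add: aq hcomp_add hcomp_mult_graded[OF aq(3) g])
    finally have "v - hcomp k q * g = hcomp (k + e) a" by (simp add: algebra_simps)
    then show "\<exists>v'\<in>(\<lambda>q. q * g) ` graded_part n k. v - v' \<in> I"
      using homogeneous_ideal_hcomp[OF I aq(2)] hcomp_graded[OF aq(3)] by force
  qed
  also have "\<dots> = quotient_dim (graded_part n k) {q. q * g \<in> I}"
    by (rule quotient_dim_image[OF linear_mult sub])
  also have "\<dots> = quotient_dim (graded_part n k) (colon n I g)"
  proof (rule quotient_dim_cong[OF subspace_graded_part _ colon_sub])
    interpret m: Vector_Spaces.linear scale scale "\<lambda>q. q * g" by (rule linear_mult)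
    show "mp.subspace {q. q * g \<in> I}"
      using m.subspace_vimage[OF sub] by (simp add: vimage_def)
  qed (auto simp: colon_def graded_part_poly_ring)
  finally show ?thesis
    using quotient_dim_add[OF subspace_graded_part sub J ideal_adjoin_superset finite_dim_graded_part[OF sub]]
    by (simp add: hilbert_function_def)
qed

text \<open>All components of a multiple of \<open>g\<close> have degree at least \<open>e\<close>,
  so nothing new appears in lower degrees.\<close>

lemma hilbert_function_adjoin_low:
  assumes I: "homogeneous_ideal n I" and g: "g \<in> graded_part n e" and "k < e"
  shows "hilbert_function n (ideal_adjoin n I g) k = hilbert_function n I k"
  unfolding hilbert_function_def
proof (rule quotient_dim_cong[OF subspace_graded_part])
  note I' = homogeneous_ideal_is_ideal[OF I]
  show "mp.subspace I" "mp.subspace (ideal_adjoin n I g)"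
    using ideal_subspace I' is_ideal_adjoin[OF I' graded_part_poly_ring[OF g]] by auto
  have "v \<in> I" if v: "v \<in> graded_part n k" "v \<in> ideal_adjoin n I g" for v
  proof -
    obtain a q where aq: "v = a + q * g" "a \<in> I" "q \<in> poly_ring n"
      using v(2) by (rule ideal_adjoinE)
    have "v = hcomp k v" using v hcomp_of_graded by auto
    also have "\<dots> = hcomp k a"
      using \<open>k < e\<close> by (simp add: aq hcomp_add hcomp_mult_graded[OF aq(3) g])
    finally show "v \<in> I" using homogeneous_ideal_hcomp[OF I aq(2)] by metis
  qed
  then show "graded_part n k \<inter> ideal_adjoin n I g = graded_part n k \<inter> I"
    using ideal_adjoin_superset[of I n g] by auto
qed

lemma hilbert_function_zero: "hilbert_function n {0} k = card (monoms_of_degree n k)"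
proof -
  let ?s = "\<lambda>m. sngl m (1 :: complex)"
  have inj: "inj ?s" by (auto intro!: injI dest: arg_cong[where f = Poly_Mapping.keys])
  have "quotient_basis (graded_part n k) {0} (?s ` monoms_of_degree n k)"
  proof (rule quotient_basisI)
    show "?s ` monoms_of_degree n k \<subseteq> graded_part n k"
      by (auto simp: monoms_of_degree_def intro: graded_part_single)
  next
    fix F c b assume F: "finite F" "F \<subseteq> ?s ` monoms_of_degree n k" "(\<Sum>b\<in>F. scale (c b) b) \<in> {0}" "b \<in> F"
    then obtain M where M: "F = ?s ` M" by (meson subset_imageE)
    have fin: "finite M"
      using F(1) unfolding M by (rule finite_imageD) (rule inj_on_subset[OF inj], simp)
    obtain m where m: "m \<in> M" "b = ?s m" using F(4) M by auto
    have "0 = lkp (\<Sum>b\<in>F. scale (c b) b) m" using F(3) by simp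
    also have "\<dots> = lkp (\<Sum>m\<in>M. sngl m (c (?s m))) m"
      unfolding M by (subst sum.reindex) (auto simp: scale_single intro: inj_on_subset[OF inj])
    also have "\<dots> = c b"
      using fin m by (simp add: lookup_sum lookup_single_if)
    finally show "c b = 0" by simp
  next
    fix v assume v: "v \<in> graded_part n k"
    have "(\<Sum>b\<in>?s ` Poly_Mapping.keys v. scale (lkp v (the_inv ?s b)) b) =
        (\<Sum>m\<in>Poly_Mapping.keys v. sngl m (lkp v m))"
      by (subst sum.reindex) (auto simp: scale_single the_inv_f_f[OF inj] intro: inj_on_subset[OF inj])
    also have "\<dots> = v" by (simp add: poly_mapping_sum_single)
    finally show "\<exists>F c. finite F \<and> F \<subseteq> ?s ` monoms_of_degree n k \<and> v - (\<Sum>b\<in>F. scale (c b) b) \<in> {0}"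
      using v by (intro exI[of _ "?s ` Poly_Mapping.keys v"] exI[of _ "\<lambda>b. lkp v (the_inv ?s b)"])
        (auto simp: graded_part_iff monoms_of_degree_def)
  qed
  then have "hilbert_function n {0} k = card (?s ` monoms_of_degree n k)"
    unfolding hilbert_function_def by (intro quotient_dim_eq_card) auto
  also have "\<dots> = card (monoms_of_degree n k)"
    by (rule card_image) (rule inj_on_subset[OF inj], simp)
  finally show ?thesis .
qed

text \<open>Stars and bars: exponent lists of length \<open>n + 1\<close> with sum \<open>k\<close>
  inject into the monomials, \<open>Poly_Mapping.nth\<close> padding them with zeros.\<close>

lemma card_monoms_of_degree: "(k + n) choose k \<le> card (monoms_of_degree n k)"
proof -
  let ?L = "{l :: nat list. length l = Suc n \<and> sum_list l = k}"
  have "(k + n) choose k = card ?L"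
    using card_length_sum_list[of "Suc n" k] by simp
  also have "\<dots> \<le> card (monoms_of_degree n k)"
  proof (rule card_inj_on_le[OF _ _ finite_monoms_of_degree])
    show "inj_on Poly_Mapping.nth ?L"
    proof (rule inj_onI, rule nth_equalityI)
      fix l l' i
      assume l: "l \<in> ?L" "l' \<in> ?L" "Poly_Mapping.nth l = Poly_Mapping.nth l'" and i: "i < length l"
      from l(3) have "nth_default 0 l i = nth_default 0 l' i" by (metis lookup_nth)
      then show "l ! i = l' ! i" using l(1,2) i by (simp add: nth_default_nth)
    qed auto
    show "Poly_Mapping.nth ` ?L \<subseteq> monoms_of_degree n k"
    proof
      fix m assume "m \<in> Poly_Mapping.nth ` ?L"
      then obtain l where l: "m = Poly_Mapping.nth l" "length l = Suc n" "sum_list l = k" by auto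
      have keys: "Poly_Mapping.keys m \<subseteq> {..<Suc n}"
        using l by (auto simp: in_keys_iff nth_default_def simp del: keys_nth split: if_splits)
      then have "mdeg m = sum (lkp m) {..<Suc n}" by (intro mdeg_superset) auto
      also have "\<dots> = k"
        using l by (simp add: nth_default_nth sum_list_sum_nth atLeast0LessThan del: sum.lessThan_Suc)
      finally show "m \<in> monoms_of_degree n k"
        using keys by (auto simp: monoms_of_degree_def monoms_def)
    qed
  qed
  finally show ?thesis .
qed

text \<open>Hockey-stick identity. The whole ring has cumulated growth of order
  \<open>n + 1\<close>, the standard against which ideals are compared.\<close>

lemma sum_hilbert_function_zero: "(k + Suc n) choose (Suc n) \<le> (\<Sum>j\<le>k. hilbert_function n {0} j)"
proof -
  have "(k + Suc n) choose (Suc n) = Suc (n + k) choose k"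
    using binomial_symmetric[of k "Suc (n + k)"] by (simp add: add.commute)
  also have "\<dots> = (\<Sum>j\<le>k. (j + n) choose j)"
    using sum_choose_lower[of n k] by (simp add: add.commute)
  also have "\<dots> \<le> (\<Sum>j\<le>k. hilbert_function n {0} j)"
    by (intro sum_mono) (simp add: hilbert_function_zero card_monoms_of_degree)
  finally show ?thesis .
qed

section \<open>Growth of Hilbert functions\<close>

text \<open>The exact sequence of multiplication by \<open>g\<close>, weakened by
  \<open>I \<subseteq> colon n I g\<close> and summed over the degrees up to \<open>k\<close>. The
  case distinction guards the truncated \<open>k - e\<close>.\<close>

lemma sum_hilbert_function_adjoin_le:
  assumes I: "homogeneous_ideal n I" and g: "g \<in> graded_part n e"
  shows "(\<Sum>j\<le>k. hilbert_function n I j) \<le> (\<Sum>j\<le>k. hilbert_function n (ideal_adjoin n I g) j) +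
    (if e \<le> k then \<Sum>j\<le>k - e. hilbert_function n I j else 0)"
proof -
  let ?H = "hilbert_function n I" and ?H' = "hilbert_function n (ideal_adjoin n I g)"
  note I' = homogeneous_ideal_is_ideal[OF I]
  have step: "?H j \<le> ?H' j + (if e \<le> j then ?H (j - e) else 0)" for j
  proof (cases "e \<le> j")
    case True
    have "hilbert_function n (colon n I g) (j - e) \<le> ?H (j - e)"
      by (intro hilbert_function_antimono I' is_ideal_colon colon_superset graded_part_poly_ring[OF g])
    then show ?thesis using hilbert_function_adjoin[OF I g, of "j - e"] True by simp
  next
    case False
    then show ?thesis using hilbert_function_adjoin_low[OF I g, of j] by simp
  qed
  have "(\<Sum>j\<le>k. ?H j) \<le> (\<Sum>j\<le>k. ?H' j + (if e \<le> j then ?H (j - e) else 0))"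
    by (intro sum_mono step)
  also have "\<dots> = (\<Sum>j\<le>k. ?H' j) + (\<Sum>j\<le>k. if e \<le> j then ?H (j - e) else 0)"
    by (rule sum.distrib)
  also have "(\<Sum>j\<le>k. if e \<le> j then ?H (j - e) else 0) = (\<Sum>j\<in>{j. e \<le> j \<and> j \<le> k}. ?H (j - e))"
    by (intro sum.mono_neutral_cong_right) auto
  also have "\<dots> = (if e \<le> k then \<Sum>j\<le>k - e. ?H j else 0)"
  proof (cases "e \<le> k")
    case True
    have "(\<Sum>j\<in>{j. e \<le> j \<and> j \<le> k}. ?H (j - e)) = (\<Sum>j\<le>k - e. ?H j)"
      by (rule sum.reindex_bij_witness[of _ "\<lambda>j. j + e" "\<lambda>j. j - e"]) (use True in auto)
    then show ?thesis using True by simp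
  qed (auto intro: sum.neutral)
  finally show ?thesis .
qed

text \<open>Pascal's rule is applied \<open>e\<close> times, each time adding at least
  \<open>(m + r) choose r\<close>. This is a discrete form of integrating a polynomial of degree
  \<open>r\<close>.\<close>

lemma choose_growth:
  fixes m r e :: nat
  shows "((m + Suc r) choose (Suc r)) + e * ((m + r) choose r) \<le> (m + e + Suc r) choose (Suc r)"
proof (induction e)
  case (Suc e)
  have "(m + r) choose r \<le> (m + e + Suc r) choose r" by (rule binomial_right_mono) simp
  with Suc show ?case by simp
qed simp

text \<open>The rational leading coefficient \<open>D / q\<close> is kept as a pair of natural
  numbers, and the shift \<open>s\<close> absorbs the terms of lower order. The estimate thus has
  the same shape before and after the step and can be iterated.\<close>

lemma hilbert_growth_step:
  assumes I: "homogeneous_ideal n I" and g: "g \<in> graded_part n e" and e: "e \<ge> 1"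
    and bound: "\<And>k. q * (\<Sum>j\<le>k. hilbert_function n (ideal_adjoin n I g) j) \<le> D * ((k + s + r) choose r)"
  shows "e * q * (\<Sum>j\<le>k. hilbert_function n I j) \<le> D * ((k + (s + e) + Suc r) choose (Suc r))"
proof (induction k rule: less_induct)
  case (less k)
  let ?C = "\<lambda>k. \<Sum>j\<le>k. hilbert_function n I j"
    and ?C' = "\<lambda>k. \<Sum>j\<le>k. hilbert_function n (ideal_adjoin n I g) j"
  \<comment> \<open>At \<open>k - e\<close> the enlarged shift \<open>s + e\<close> yields
    \<open>k + s\<close> again, so this bound and \<open>bound\<close> at \<open>k\<close> supply
    the two summands of \<open>choose_growth\<close>.\<close>
  have "e * q * (if e \<le> k then ?C (k - e) else 0) \<le> D * ((k + s + Suc r) choose (Suc r))"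
    using less[of "k - e"] e by auto
  moreover have "e * q * ?C' k \<le> e * (D * ((k + s + r) choose r))"
    using bound[of k] by (simp add: mult.assoc)
  moreover have "e * q * ?C k \<le> e * q * ?C' k + e * q * (if e \<le> k then ?C (k - e) else 0)"
    using mult_le_mono2[OF sum_hilbert_function_adjoin_le[OF I g, of k], of "e * q"]
    by (simp only: distrib_left)
  ultimately have "e * q * ?C k \<le> e * (D * ((k + s + r) choose r)) + D * ((k + s + Suc r) choose (Suc r))"
    by linarith
  also have "\<dots> = D * (((k + s + Suc r) choose (Suc r)) + e * ((k + s + r) choose r))"
    by (simp only: distrib_left mult_ac add.commute)
  also have "\<dots> \<le> D * ((k + s + e + Suc r) choose (Suc r))"
    by (intro mult_le_mono2 choose_growth)
  finally show ?case by (simp add: algebra_simps)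
qed

text \<open>By absorption, passing from \<open>m\<close> to \<open>m + 1\<close> multiplies the
  ratio by \<open>1 + s / (k + m + 1)\<close>, which tends to 1.\<close>

lemma choose_shift_ratio_tendsto:
  "(\<lambda>k. real ((k + s + m) choose m) / real ((k + m) choose m)) \<longlonglongrightarrow> 1"
proof (induction m)
  case (Suc m)
  have "(\<lambda>k. real s / real (k + Suc m)) \<longlonglongrightarrow> 0"
    by (rule LIMSEQ_ignore_initial_segment[OF lim_const_over_n])
  from tendsto_add[OF tendsto_const[of 1] this]
  have lim: "(\<lambda>k. 1 + real s / real (k + Suc m)) \<longlonglongrightarrow> 1" by simp
  have "real ((k + s + Suc m) choose Suc m) / real ((k + Suc m) choose Suc m) =
      real ((k + s + m) choose m) / real ((k + m) choose m) * (1 + real s / real (k + Suc m))" for k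
  proof -
    have absorb: "real (Suc m) * real ((i + Suc m) choose Suc m) = real (i + Suc m) * real ((i + m) choose m)" for i
      using Suc_times_binomial[of m "i + m"] by (metis add_Suc_right of_nat_mult)
    have "real ((i + Suc m) choose Suc m) = real (i + Suc m) * real ((i + m) choose m) / real (Suc m)" for i
      using absorb[of i] by (simp add: field_simps del: of_nat_Suc binomial_Suc_Suc)
    moreover have "real ((k + m) choose m) > 0" by simp
    moreover have "1 + real s / real (k + Suc m) = real (k + s + Suc m) / real (k + Suc m)"
      by (simp add: field_simps)
    moreover have "a * A / c / (b * B / c) = A / B * (a / b)" if "c \<noteq> 0" for a A b B c :: real
      using that by (simp add: mult.commute)
    ultimately show ?thesis by (metis of_nat_neq_0)
  qed
  then show ?case using tendsto_mult[OF Suc lim] by simp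
qed simp

text \<open>A shift of the argument does not change the leading coefficient, so dividing by the
  binomial coefficient and letting \<open>k\<close> grow removes \<open>s\<close>.\<close>

lemma choose_growth_cancel:
  fixes q D :: nat
  assumes "\<And>k. q * ((k + m) choose m) \<le> D * ((k + s + m) choose m)"
  shows "q \<le> D"
proof -
  have "real q \<le> real D * (real ((k + s + m) choose m) / real ((k + m) choose m))" for k
  proof -
    have "real q * real ((k + m) choose m) \<le> real D * real ((k + s + m) choose m)"
      using assms[of k] by (metis of_nat_le_iff of_nat_mult)
    moreover have "real ((k + m) choose m) > 0" by simp
    ultimately show ?thesis by (simp add: field_simps)
  qed
  moreover have "(\<lambda>k. real D * (real ((k + s + m) choose m) / real ((k + m) choose m))) \<longlonglongrightarrow> real D * 1"
    by (intro tendsto_mult tendsto_const choose_shift_ratio_tendsto)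
  ultimately have "real q \<le> real D * 1"
    by (intro LIMSEQ_le_const) auto
  then show ?thesis by simp
qed

text \<open>
  Omitting a generator of degree \<open>e\<close> raises the order of growth by at most one and divides the
  leading coefficient by at least \<open>e\<close>. When all generators are omitted, the known growth of the
  whole ring gives the bound.
\<close>

lemma hilbert_growth:
  assumes "finite A" and "\<And>i. i \<in> A \<Longrightarrow> h i \<in> graded_part n (e i)" and "\<And>i. i \<in> A \<Longrightarrow> e i \<ge> 1"
    and "card A + r = Suc n"
    and "\<And>k. q * (\<Sum>j\<le>k. hilbert_function n (ideal_span n h A) j) \<le> D * ((k + s + r) choose r)"
  shows "q * (\<Prod>i\<in>A. e i) \<le> D"
  using assms
proof (induction A arbitrary: q s r rule: finite_induct)
  case empty
  then have "r = Suc n" by simp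
  show ?case
  proof (rule choose_growth_cancel)
    fix k
    have "q * ((k + Suc n) choose (Suc n)) \<le> q * (\<Sum>j\<le>k. hilbert_function n {0} j)"
      by (intro mult_le_mono2 sum_hilbert_function_zero)
    also have "\<dots> \<le> D * ((k + s + Suc n) choose (Suc n))"
      using empty.prems(4)[of k] \<open>r = Suc n\<close> by simp
    finally show "q * (\<Prod>i\<in>{}. e i) * ((k + Suc n) choose (Suc n)) \<le> D * ((k + s + Suc n) choose (Suc n))"
      by simp
  qed
next
  case (insert x A)
  have I: "homogeneous_ideal n (ideal_span n h A)"
    by (rule homogeneous_ideal_span) (use insert in auto)
  have "e x * q * (\<Prod>i\<in>A. e i) \<le> D"
  proof (rule insert.IH)
    show "e x * q * (\<Sum>j\<le>k. hilbert_function n (ideal_span n h A) j) \<le> D * ((k + (s + e x) + Suc r) choose (Suc r))" for k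
    proof (rule hilbert_growth_step[OF I])
      show "q * (\<Sum>j\<le>k. hilbert_function n (ideal_adjoin n (ideal_span n h A) (h x)) j) \<le> D * ((k + s + r) choose r)" for k
        using insert.prems(4)[of k] insert.hyps by (simp add: ideal_span_insert)
    qed (use insert in auto)
  qed (use insert in auto)
  then show ?case using insert.hyps by (simp add: mult_ac)
qed

section \<open>The Nullstellensatz\<close>

text \<open>The set of values of a family with repetitions can be independent although the family is
  not; in that case the relation is the difference of two equal members.\<close>

lemma family_dependent:
  assumes "finite C" "finite S" "card S < card C" "\<And>c. c \<in> C \<Longrightarrow> q c \<in> mp.span S"
  obtains u c where "(\<Sum>c\<in>C. scale (u c) (q c)) = 0" "c \<in> C" "u c \<noteq> 0"
proof (cases "inj_on q C")
  case True
  have "mp.dependent (q ` C)"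
  proof (rule ccontr)
    assume "mp.independent (q ` C)"
    then have "card (q ` C) \<le> card S"
      using mp.independent_span_bound[OF assms(2)] assms(4) by blast
    then show False using assms(3) True by (simp add: card_image)
  qed
  then obtain T u v where T: "T \<subseteq> q ` C" "(\<Sum>v\<in>T. scale (u v) v) = 0" "v \<in> T" "u v \<noteq> 0"
    unfolding mp.dependent_explicit by blast
  let ?u = "\<lambda>c. if q c \<in> T then u (q c) else 0"
  have "(\<Sum>c\<in>C. scale (?u c) (q c)) = (\<Sum>w\<in>q ` C. if w \<in> T then scale (u w) w else 0)"
    by (subst sum.reindex[OF True]) (auto intro!: sum.cong)
  also have "\<dots> = (\<Sum>v\<in>T. scale (u v) v)"
    using T(1) assms(1) by (subst sum.inter_restrict[symmetric]) (auto simp: Int_absorb1)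
  finally have "(\<Sum>c\<in>C. scale (?u c) (q c)) = 0" using T(2) by simp
  moreover obtain c where "c \<in> C" "v = q c" using T(1,3) by blast
  ultimately show ?thesis using that[of ?u c] T(3,4) by simp
next
  case False
  then obtain a b where ab: "a \<in> C" "b \<in> C" "a \<noteq> b" "q a = q b" by (auto simp: inj_on_def)
  let ?u = "\<lambda>c. if c = a then 1 else if c = b then - 1 else 0"
  have "(\<Sum>c\<in>C. scale (?u c) (q c)) = (\<Sum>c\<in>{a, b}. scale (?u c) (q c))"
    using ab assms(1) by (intro sum.mono_neutral_right) auto
  also have "\<dots> = 0" using ab by simp
  finally show ?thesis using that[of ?u a] ab by simp
qed

lemma poly_ring_span:
  assumes "q \<in> poly_ring n" "\<And>m. m \<in> Poly_Mapping.keys q \<Longrightarrow> mdeg m \<le> D"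
  shows "q \<in> mp.span ((\<lambda>m. sngl m 1) ` (\<Union>k\<le>D. monoms_of_degree n k))"
proof -
  have "q = (\<Sum>m\<in>Poly_Mapping.keys q. scale (lkp q m) (sngl m 1))"
    by (simp add: scale_single poly_mapping_sum_single)
  also have "\<dots> \<in> mp.span ((\<lambda>m. sngl m 1) ` (\<Union>k\<le>D. monoms_of_degree n k))"
    using assms by (intro mp.span_sum mp.span_scale mp.span_base)
      (auto simp: poly_ring_iff monoms_of_degree_def)
  finally show ?thesis .
qed

text \<open>The evaluation homomorphism at the ring element \<open>x\<close>, with complex
  coefficients embedded as constants by \<open>sngl 0\<close>.\<close>

definition poly_subst :: "mpoly \<Rightarrow> complex poly \<Rightarrow> mpoly" where
  "poly_subst x g = poly (map_poly (sngl 0) g) x"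

lemma poly_subst_0 [simp]: "poly_subst x 0 = 0"
  by (simp add: poly_subst_def)

lemma poly_subst_pCons [simp]: "poly_subst x (pCons a g) = sngl 0 a + x * poly_subst x g"
  by (simp add: poly_subst_def map_poly_pCons)

lemma poly_subst_add: "poly_subst x (f + g) = poly_subst x f + poly_subst x g"
  by (induction f g rule: poly_induct2) (auto simp: single_add algebra_simps)

lemma poly_subst_smult: "poly_subst x (smult c g) = sngl 0 c * poly_subst x g"
  by (induction g) (auto simp: mult_single algebra_simps)

lemma poly_subst_mult: "poly_subst x (f * g) = poly_subst x f * poly_subst x g"
  by (induction f) (auto simp: poly_subst_add poly_subst_smult algebra_simps)

lemma poly_subst_1 [simp]: "poly_subst x 1 = 1"
  by (simp add: one_pCons)

lemma poly_subst_linear: "poly_subst x [:- b, 1:] = x - sngl 0 b"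
  by (simp add: single_uminus)

lemma poly_subst_sum: "poly_subst x (sum g A) = (\<Sum>i\<in>A. poly_subst x (g i))"
  by (induction A rule: infinite_finite_induct) (auto simp: poly_subst_add)

lemma poly_subst_prod: "poly_subst x (prod g A) = (\<Prod>i\<in>A. poly_subst x (g i))"
  by (induction A rule: infinite_finite_induct) (auto simp: poly_subst_mult)

lemma poly_subst_poly_ring: "x \<in> poly_ring n \<Longrightarrow> poly_subst x g \<in> poly_ring n"
  by (induction g) auto

text \<open>Linear factors of \<open>g\<close> are cancelled one at a time: modulo \<open>K\<close>
  some power of \<open>p\<close> is a multiple of \<open>x - r\<close>, so at the price of a higher
  power of \<open>p\<close> the factor \<open>x - r\<close> may be dropped.\<close>

lemma power_mem_if_poly_subst:
  assumes K: "is_ideal n K" and p: "p \<in> poly_ring n" and x: "x \<in> poly_ring n"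
    and all: "\<And>c. \<exists>N. p ^ N \<in> ideal_adjoin n K (x - sngl 0 c)"
    and "g \<noteq> 0" "p ^ N * poly_subst x g \<in> K"
  shows "\<exists>N. p ^ N \<in> K"
  using assms(5,6)
proof (induction "Polynomial.degree g" arbitrary: g N rule: less_induct)
  case less
  show ?case
  proof (cases "Polynomial.degree g = 0")
    case True
    then obtain a where g: "g = [:a:]" by (rule degree_eq_zeroE)
    with less.prems have "a \<noteq> 0" by auto
    have "sngl 0 (1 / a) * (p ^ N * poly_subst x g) \<in> K"
      by (rule ideal_mult[OF K less.prems(2) poly_ring_const])
    also have "sngl 0 (1 / a) * (p ^ N * poly_subst x g) = p ^ N * (sngl 0 (1 / a) * sngl 0 a)"
      by (simp add: g mult_ac)
    also have "\<dots> = p ^ N" using \<open>a \<noteq> 0\<close> by (simp add: mult_single)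
    finally show ?thesis by blast
  next
    case False
    then obtain r where "poly g r = 0"
      using fundamental_theorem_of_algebra[of g] constant_degree by metis
    then obtain g' where g: "g = [:- r, 1:] * g'" by (metis poly_eq_0_iff_dvd dvdE)
    have "g' \<noteq> 0" using g less.prems by auto
    obtain N' where "p ^ N' \<in> ideal_adjoin n K (x - sngl 0 r)" using all by blast
    then obtain a q where aq: "p ^ N' = a + q * (x - sngl 0 r)" "a \<in> K" "q \<in> poly_ring n"
      by (rule ideal_adjoinE)
    let ?G = "poly_subst x g'"
    have sub: "poly_subst x g = (x - sngl 0 r) * ?G"
      unfolding g poly_subst_mult poly_subst_linear ..
    have "p ^ (N + N') * ?G = (p ^ N * ?G) * a + q * (p ^ N * poly_subst x g)"
      by (simp add: power_add aq(1) sub algebra_simps)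
    also have "\<dots> \<in> K"
      by (rule ideal_add[OF K ideal_mult[OF K aq(2)] ideal_mult[OF K less.prems(2) aq(3)]])
        (use p x in \<open>simp add: poly_subst_poly_ring\<close>)
    finally have "p ^ (N + N') * ?G \<in> K" .
    moreover have "Polynomial.degree g' < Polynomial.degree g"
      using \<open>g' \<noteq> 0\<close> by (simp add: g degree_mult_eq del: mult_pCons_left)
    ultimately show ?thesis using less.hyps \<open>g' \<noteq> 0\<close> by blast
  qed
qed

lemma uncountable_UNIV_complex: "\<not> countable (UNIV :: complex set)"
proof
  assume "countable (UNIV :: complex set)"
  then have "countable (range Re)" by blast
  moreover have "range Re = UNIV" by (metis Re_complex_of_real surjI)
  ultimately show False using uncountable_UNIV_real by simp
qed

text \<open>Countably many countable fibres cannot cover an uncountable set. Applied to an encoded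
  pair, this fixes two natural parameters at once on an infinite set.\<close>

lemma uncountable_pigeonhole:
  fixes f :: "complex \<Rightarrow> nat"
  obtains z where "infinite {c. f c = z}"
proof -
  have "(\<Union>z. {c. f c = z}) = UNIV" by auto
  then have "\<not> (\<forall>z. countable {c. f c = z})"
    using uncountable_UNIV_complex countable_UN[of UNIV "\<lambda>z. {c. f c = z}"] by auto
  then show ?thesis using that countable_finite by blast
qed

text \<open>
  The key step of the Nullstellensatz over an uncountable field: if \<open>x - c\<close> were invertible
  modulo \<open>K\<close> up to powers of \<open>p\<close> for all \<open>c\<close>, then uncountably many quotients would lie in a
  space of countable dimension. A linear relation between them yields a polynomial in \<open>x\<close> which
  annihilates a power of \<open>p\<close> modulo \<open>K\<close>.
\<close>

lemma exists_avoiding_adjoin: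
  assumes K: "is_ideal n K" and p: "p \<in> poly_ring n" and x: "x \<in> poly_ring n"
    and avoid: "\<And>N. p ^ N \<notin> K"
  obtains c where "\<And>N. p ^ N \<notin> ideal_adjoin n K (x - sngl 0 c)"
proof (rule ccontr)
  assume "\<not> thesis"
  then have all: "\<exists>N. p ^ N \<in> ideal_adjoin n K (x - sngl 0 c)" for c
    using that by blast
  have "\<exists>N q. q \<in> poly_ring n \<and> p ^ N - q * (x - sngl 0 c) \<in> K" for c
  proof -
    obtain N where "p ^ N \<in> ideal_adjoin n K (x - sngl 0 c)" using all by blast
    then show ?thesis by (auto elim!: ideal_adjoinE intro!: exI[of _ N])
  qed
  then obtain N q where q: "\<And>c. q c \<in> poly_ring n" "\<And>c. p ^ N c - q c * (x - sngl 0 c) \<in> K"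
    by metis
  define D where "D c = Max (insert 0 (mdeg ` Poly_Mapping.keys (q c)))" for c
  obtain z where inf: "infinite {c. prod_encode (N c, D c) = z}" by (rule uncountable_pigeonhole)
  obtain N0 D0 where z: "z = prod_encode (N0, D0)" by (metis prod_decode_inverse surj_pair)
  let ?S = "(\<lambda>m. sngl m (1 :: complex)) ` (\<Union>k\<le>D0. monoms_of_degree n k)"
  \<comment> \<open>One more constant than there are monomials of degree at most \<open>D0\<close>:
    this forces a linear relation among the quotients \<open>q c\<close>.\<close>
  obtain C where C: "finite C" "card C = Suc (card ?S)" "C \<subseteq> {c. prod_encode (N c, D c) = z}"
    using infinite_arbitrarily_large[OF inf] by blast
  have ND: "N c = N0" "D c = D0" if "c \<in> C" for c using C(3) that by (auto simp: z)
  have finS: "finite ?S" by (simp add: finite_monoms_of_degree)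
  have less: "card ?S < card C" using C(2) by simp
  have span: "q c \<in> mp.span ?S" if "c \<in> C" for c
    using ND(2)[OF that] q(1) by (intro poly_ring_span) (auto simp: D_def)
  obtain u c0 where u: "(\<Sum>c\<in>C. scale (u c) (q c)) = 0" "c0 \<in> C" "u c0 \<noteq> 0"
    by (rule family_dependent[OF C(1) finS less span])
  \<comment> \<open>These are Lagrange numerators: at \<open>c0\<close> only \<open>R c0\<close>
    survives, so \<open>g\<close> is nonzero. Multiplying the relation by all factors
    \<open>x - b\<close> and replacing \<open>q c * (x - c)\<close> by \<open>p ^ N0\<close> modulo
    \<open>K\<close> shows that \<open>p ^ N0 * poly_subst x g\<close> lies in
    \<open>K\<close>.\<close>
  define R where "R c = (\<Prod>b\<in>C - {c}. [:- b, 1:])" for c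
  define g where "g = (\<Sum>c\<in>C. smult (u c) (R c))"
  have "poly (R c) c0 = 0" if "c \<in> C - {c0}" for c
    unfolding R_def poly_prod using that u(2) C(1) by (intro prod_zero) auto
  then have "poly g c0 = u c0 * poly (R c0) c0"
    unfolding g_def poly_sum using u(2) C(1) by (subst sum.remove[OF C(1) u(2)]) simp
  moreover have "poly (R c0) c0 \<noteq> 0"
    using C(1) by (simp add: R_def poly_prod prod_zero_iff)
  ultimately have "g \<noteq> 0" using u(3) by auto
  define P where "P = (\<Prod>b\<in>C. x - sngl 0 b)"
  have P: "P = (x - sngl 0 c) * poly_subst x (R c)" if "c \<in> C" for c
    unfolding P_def R_def poly_subst_prod poly_subst_linear using that C(1) by (rule prod.remove[rotated])
  have "p ^ N0 * poly_subst x g = (\<Sum>c\<in>C. sngl 0 (u c) * (p ^ N0 * poly_subst x (R c)))"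
    by (simp add: g_def poly_subst_sum poly_subst_smult sum_distrib_left mult_ac)
  also have "\<dots> = (\<Sum>c\<in>C. sngl 0 (u c) * ((p ^ N0 - q c * (x - sngl 0 c)) * poly_subst x (R c)))
      + (\<Sum>c\<in>C. scale (u c) (q c)) * P"
    unfolding sum_distrib_right sum.distrib[symmetric]
    by (intro sum.cong refl) (simp add: P scale_def algebra_simps)
  also have "\<dots> = (\<Sum>c\<in>C. sngl 0 (u c) * ((p ^ N0 - q c * (x - sngl 0 c)) * poly_subst x (R c)))"
    by (simp add: u(1))
  also have "\<dots> \<in> K"
    using q(2) ND by (intro ideal_sum[OF K] ideal_mult[OF K] ideal_mult'[OF K] poly_subst_poly_ring x) auto
  finally have "\<exists>N. p ^ N \<in> K"
    by (rule power_mem_if_poly_subst[OF K p x all \<open>g \<noteq> 0\<close>])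
  then show False using avoid by blast
qed

lemma xvar_power: "xvar i ^ k = sngl (sngl i k) 1"
  by (induction k) (auto simp: xvar_def mult_single single_add[symmetric])

lemma single_eq_prod_xvar: "sngl m 1 = (\<Prod>i\<in>Poly_Mapping.keys m. xvar i ^ lkp m i)"
proof -
  have "(\<Prod>i\<in>A. xvar i ^ lkp m i) = sngl (\<Sum>i\<in>A. sngl i (lkp m i)) 1" if "finite A" for A
    using that by induction (auto simp: xvar_power mult_single)
  then show ?thesis using poly_mapping_sum_single[of "Poly_Mapping.keys m" m] by simp
qed

lemma single_split_xvar:
  assumes "m \<in> monoms n" "N \<le> lkp m i"
  shows "sngl m c = sngl (m - sngl i N) c * xvar i ^ N" "sngl (m - sngl i N) c \<in> poly_ring n"
proof -
  have "m = (m - sngl i N) + sngl i N"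
    using assms(2) by (intro poly_mapping_eqI) (auto simp: lookup_add lookup_minus lookup_single_if)
  then show "sngl m c = sngl (m - sngl i N) c * xvar i ^ N"
    by (metis mult.right_neutral mult_single xvar_power)
  have "Poly_Mapping.keys (m - sngl i N) \<subseteq> Poly_Mapping.keys m"
    by (auto simp: in_keys_iff lookup_minus)
  then show "sngl (m - sngl i N) c \<in> poly_ring n"
    using assms(1) by (intro poly_ring_single) (auto simp: monoms_def)
qed

lemma mem_ideal_if_monoms:
  "is_ideal n I \<Longrightarrow> (\<And>m. m \<in> Poly_Mapping.keys p \<Longrightarrow> sngl m (lkp p m) \<in> I) \<Longrightarrow> p \<in> I"
  using ideal_sum[of n I "Poly_Mapping.keys p" "\<lambda>m. sngl m (lkp p m)"]
  by (simp add: poly_mapping_sum_single)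

lemma poly_ring_induct [consumes 1, case_names const var add mult]:
  assumes "p \<in> poly_ring n" and const: "\<And>c. P (sngl 0 c)" and var: "\<And>i. i \<le> n \<Longrightarrow> P (xvar i)"
    and add: "\<And>p q. p \<in> poly_ring n \<Longrightarrow> q \<in> poly_ring n \<Longrightarrow> P p \<Longrightarrow> P q \<Longrightarrow> P (p + q)"
    and mult: "\<And>p q. p \<in> poly_ring n \<Longrightarrow> q \<in> poly_ring n \<Longrightarrow> P p \<Longrightarrow> P q \<Longrightarrow> P (p * q)"
  shows "P p"
proof -
  let ?P = "\<lambda>p. p \<in> poly_ring n \<and> P p"
  have one: "?P 1" using const[of 1] by simp
  have zero: "?P 0" using const[of 0] by simp
  have pow: "?P (q ^ k)" if "?P q" for q k
    using that one mult by (induction k) auto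
  have prod: "?P (prod g A)" if "\<And>i. i \<in> A \<Longrightarrow> ?P (g i)" for g and A :: "nat set"
    using that one mult by (induction A rule: infinite_finite_induct) auto
  have sum: "?P (sum g A)" if "\<And>i. i \<in> A \<Longrightarrow> ?P (g i)" for g and A :: "monom set"
    using that zero add by (induction A rule: infinite_finite_induct) auto
  have "?P (sngl 0 (lkp p m) * sngl m 1)" if "m \<in> Poly_Mapping.keys p" for m
  proof -
    have "Poly_Mapping.keys m \<subseteq> {..n}" using assms(1) that by (auto simp: poly_ring_iff monoms_def)
    then have "?P (sngl m 1)"
      unfolding single_eq_prod_xvar by (intro prod pow) (auto simp: var xvar_poly_ring)
    then show ?thesis using const mult by auto
  qed
  from sum[OF this] have "?P (\<Sum>m\<in>Poly_Mapping.keys p. sngl m (lkp p m))"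
    by (simp add: mult_single)
  then show ?thesis by (simp add: poly_mapping_sum_single)
qed

lemma eval_cong_mod_ideal:
  assumes K: "is_ideal n K" and a: "\<And>i. i \<le> n \<Longrightarrow> xvar i - sngl 0 (a i) \<in> K" and "p \<in> poly_ring n"
  shows "p - sngl 0 (eval_mpoly a p) \<in> K"
  using assms(3)
proof (induction p rule: poly_ring_induct)
  case (const c)
  then show ?case using ideal_0[OF K] by simp
next
  case (var i)
  then show ?case using a by simp
next
  case (add p q)
  have "p + q - sngl 0 (eval_mpoly a (p + q)) =
      (p - sngl 0 (eval_mpoly a p)) + (q - sngl 0 (eval_mpoly a q))"
    by (simp add: single_add)
  then show ?case by (simp only: ideal_add[OF K add.IH])
next
  case (mult p q)
  have "p * q - sngl 0 (eval_mpoly a (p * q)) =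
      p * (q - sngl 0 (eval_mpoly a q)) + sngl 0 (eval_mpoly a q) * (p - sngl 0 (eval_mpoly a p))"
    by (simp add: algebra_simps mult_single)
  also have "\<dots> \<in> K"
    by (intro ideal_add[OF K] ideal_mult[OF K] mult poly_ring_const)
  finally show ?case .
qed

text \<open>If no power of \<open>p\<close> lies in \<open>K\<close>, then \<open>K\<close> can be
  enlarged by \<open>x_0 - a_0\<close>, ..., \<open>x_n - a_n\<close> in turn without ever capturing
  a power of \<open>p\<close>. Modulo the resulting ideal every polynomial equals its value at
  \<open>a\<close>, so \<open>a\<close> is a zero of \<open>K\<close> but not of
  \<open>p\<close>.\<close>

theorem nullstellensatz:
  assumes K: "is_ideal n K" and p: "p \<in> poly_ring n"
    and zeros: "\<And>a. (\<And>k. k \<in> K \<Longrightarrow> eval_mpoly a k = 0) \<Longrightarrow> eval_mpoly a p = 0"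
  shows "\<exists>N. p ^ N \<in> K"
proof (rule ccontr)
  assume avoid: "\<nexists>N. p ^ N \<in> K"
  have "\<exists>a K'. is_ideal n K' \<and> K \<subseteq> K' \<and> (\<forall>N. p ^ N \<notin> K') \<and> (\<forall>i<m. xvar i - sngl 0 (a i) \<in> K')"
    if "m \<le> Suc n" for m
    using that
  proof (induction m)
    case 0
    then show ?case using K avoid by auto
  next
    case (Suc m)
    then obtain a K' where K': "is_ideal n K'" "K \<subseteq> K'" "\<And>N. p ^ N \<notin> K'"
      "\<And>i. i < m \<Longrightarrow> xvar i - sngl 0 (a i) \<in> K'" by auto
    have x: "xvar m \<in> poly_ring n" using Suc.prems by (intro xvar_poly_ring) simp
    obtain c where c: "\<And>N. p ^ N \<notin> ideal_adjoin n K' (xvar m - sngl 0 c)"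
      by (rule exists_avoiding_adjoin[OF K'(1) p x K'(3)]) blast
    let ?K = "ideal_adjoin n K' (xvar m - sngl 0 c)"
    have "is_ideal n ?K" using K'(1) x by (intro is_ideal_adjoin) auto
    moreover have "xvar i - sngl 0 ((a(m := c)) i) \<in> ?K" if "i < Suc m" for i
      using that K'(4)
      by (cases "i = m") (auto intro: ideal_adjoin_superset[THEN subsetD] ideal_adjoin_mem[OF K'(1)])
    ultimately show ?case using K'(2) c ideal_adjoin_superset[of K' n]
      by (intro exI[of _ "a(m := c)"] exI[of _ ?K]) blast
  qed
  from this[of "Suc n"] obtain a K' where K': "is_ideal n K'" "K \<subseteq> K'" "\<And>N. p ^ N \<notin> K'"
    "\<And>i. i \<le> n \<Longrightarrow> xvar i - sngl 0 (a i) \<in> K'" by (auto simp: less_Suc_eq_le)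
  have cong: "r - sngl 0 (eval_mpoly a r) \<in> K'" if "r \<in> poly_ring n" for r
    by (rule eval_cong_mod_ideal[OF K'(1) _ that]) (rule K'(4))
  have "eval_mpoly a k = 0" if "k \<in> K" for k
  proof (rule ccontr)
    assume nz: "eval_mpoly a k \<noteq> 0"
    have k: "k \<in> K'" "k \<in> poly_ring n" using that K'(2) ideal_poly_ring[OF K'(1)] by auto
    from ideal_diff[OF K'(1) k(1) cong[OF k(2)]] have "sngl 0 (eval_mpoly a k) \<in> K'" by simp
    then have "sngl 0 (1 / eval_mpoly a k) * sngl 0 (eval_mpoly a k) \<in> K'"
      by (rule ideal_mult[OF K'(1)]) simp
    \<comment> \<open>The unit is the power \<open>p ^ 0\<close>, so avoiding all powers of
      \<open>p\<close> includes properness of \<open>K'\<close>.\<close>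
    then have "p ^ 0 \<in> K'" using nz by (simp add: mult_single)
    then show False using K'(3) by blast
  qed
  then have "eval_mpoly a p = 0" by (rule zeros)
  then have "p ^ 1 \<in> K'" using cong[OF p] by simp
  then show False using K'(3) by blast
qed

section \<open>Projective zeros\<close>

text \<open>One vector is chosen for each projective zero of \<open>I\<close>. Values of forms,
  which interpolation requires, are defined at vectors but not at projective points.\<close>

definition zero_reps :: "nat \<Rightarrow> mpoly set \<Rightarrow> (nat \<Rightarrow> complex) set \<Rightarrow> bool" where
  "zero_reps n I V \<longleftrightarrow> finite V \<and> V \<subseteq> punctured_space n \<and>
     (\<forall>v\<in>V. \<forall>w\<in>V. (v, w) \<in> proportional \<longrightarrow> v = w) \<and>
     (\<forall>w\<in>punctured_space n. (\<forall>p\<in>I. eval_mpoly w p = 0) \<longleftrightarrow> (\<exists>v\<in>V. (v, w) \<in> proportional))"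

lemma proportional_refl: "(v, v) \<in> proportional"
  unfolding proportional_def by (auto intro!: exI[of _ 1])

lemma proportional_sym:
  assumes "(v, w) \<in> proportional"
  shows "(w, v) \<in> proportional"
proof -
  obtain c where "c \<noteq> 0" "w = (\<lambda>i. c * v i)" using assms by (auto simp: proportional_def)
  then have "1 / c \<noteq> 0 \<and> v = (\<lambda>i. 1 / c * w i)" by simp
  then show ?thesis unfolding proportional_def by blast
qed

lemma proportional_trans:
  assumes "(u, v) \<in> proportional" "(v, w) \<in> proportional"
  shows "(u, w) \<in> proportional"
proof -
  obtain c d where "c \<noteq> 0" "v = (\<lambda>i. c * u i)" "d \<noteq> 0" "w = (\<lambda>i. d * v i)"
    using assms by (auto simp: proportional_def)
  then have "d * c \<noteq> 0 \<and> w = (\<lambda>i. d * c * u i)" by (simp add: mult.assoc)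
  then show ?thesis unfolding proportional_def by blast
qed

lemma eval_proportional:
  assumes "(v, w) \<in> proportional" "p \<in> graded_part n k"
  shows "eval_mpoly w p = 0 \<longleftrightarrow> eval_mpoly v p = 0"
  using assms by (auto simp: proportional_def eval_cmult)

text \<open>Scaling acts differently on each degree, so vanishing is transferred component by
  component; the components again belong to \<open>I\<close>.\<close>

lemma zero_ideal_proportional:
  assumes I: "homogeneous_ideal n I" and "(v, w) \<in> proportional" "\<And>p. p \<in> I \<Longrightarrow> eval_mpoly v p = 0"
    and p: "p \<in> I"
  shows "eval_mpoly w p = 0"
proof -
  note I' = homogeneous_ideal_is_ideal[OF I]
  have "eval_mpoly w (hcomp k p) = 0" for k
    using eval_proportional[OF assms(2) hcomp_graded[OF ideal_poly_ring[OF I' p]]]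
      homogeneous_ideal_hcomp[OF I p] assms(3) by blast
  then have "eval_mpoly w (\<Sum>k\<in>mdeg ` Poly_Mapping.keys p. hcomp k p) = 0"
    by (simp add: eval_sum)
  then show ?thesis by (simp add: sum_hcomp_keys)
qed

lemma
  assumes "zero_reps n I V"
  shows zero_reps_finite: "finite V"
    and zero_reps_punctured: "v \<in> V \<Longrightarrow> v \<in> punctured_space n"
    and zero_reps_distinct: "v \<in> V \<Longrightarrow> w \<in> V \<Longrightarrow> (v, w) \<in> proportional \<Longrightarrow> v = w"
    and zero_reps_zero: "v \<in> V \<Longrightarrow> p \<in> I \<Longrightarrow> eval_mpoly v p = 0"
  using assms proportional_refl unfolding zero_reps_def by blast+

lemma zero_reps_cover:
  assumes "zero_reps n I V" "w \<in> punctured_space n" "\<And>p. p \<in> I \<Longrightarrow> eval_mpoly w p = 0"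
  obtains v where "v \<in> V" "(v, w) \<in> proportional"
  using assms unfolding zero_reps_def by blast

lemma punctured_nonzero:
  assumes "v \<in> punctured_space n"
  obtains i where "i \<le> n" "v i \<noteq> 0"
  using assms unfolding punctured_space_def by (auto simp: not_le[symmetric])

text \<open>Without projective zeros, \<open>I\<close> has at most the origin as a zero, and the
  Nullstellensatz puts a power of each variable into \<open>I\<close>. A monomial of degree at least
  \<open>(n + 1) * M\<close> contains some variable with exponent at least \<open>M\<close>.\<close>

lemma eventually_graded_subset:
  assumes I: "is_ideal n I"
    and "\<And>w. w \<in> punctured_space n \<Longrightarrow> \<exists>p\<in>I. eval_mpoly w p \<noteq> 0"
  obtains K where "\<And>k. k \<ge> K \<Longrightarrow> graded_part n k \<subseteq> I"
proof -
  have "\<exists>N. xvar i ^ N \<in> I" if i: "i \<le> n" for i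
  proof (rule nullstellensatz[OF I xvar_poly_ring[OF i]])
    fix a assume a: "\<And>k. k \<in> I \<Longrightarrow> eval_mpoly a k = 0"
    define w where "w = (\<lambda>i. if i \<le> n then a i else 0)"
    have "eval_mpoly w k = 0" if "k \<in> I" for k
      using a[OF that] eval_cong[OF ideal_poly_ring[OF I that], of w a] by (simp add: w_def)
    then have "w \<notin> punctured_space n" using assms(2) by blast
    then have "w i = 0" by (auto simp: punctured_space_def w_def)
    then show "eval_mpoly a (xvar i) = 0" using i by (simp add: w_def)
  qed
  then obtain N where N: "\<And>i. i \<le> n \<Longrightarrow> xvar i ^ N i \<in> I" by metis
  define M where "M = Max (N ` {..n})"
  have M: "N i \<le> M" if "i \<le> n" for i using that by (simp add: M_def)
  have "graded_part n k \<subseteq> I" if k: "k \<ge> Suc n * M" for k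
  proof
    fix p assume p: "p \<in> graded_part n k"
    have "sngl m (lkp p m) \<in> I" if m: "m \<in> Poly_Mapping.keys p" for m
    proof -
      have mm: "m \<in> monoms n" "mdeg m = k" using p m by (auto simp: graded_part_iff)
      have "\<exists>i\<le>n. N i \<le> lkp m i"
      proof (rule ccontr)
        assume "\<not> (\<exists>i\<le>n. N i \<le> lkp m i)"
        then have "(\<Sum>i\<le>n. lkp m i) < (\<Sum>i\<le>n. M)"
          using M by (intro sum_strict_mono) (auto simp: not_le, metis leD less_le_trans)
        moreover have "mdeg m = (\<Sum>i\<le>n. lkp m i)"
          using mm by (intro mdeg_superset) (auto simp: monoms_def)
        ultimately show False using mm k by simp
      qed
      then obtain i where i: "i \<le> n" "N i \<le> lkp m i" by blast
      note split = single_split_xvar[OF mm(1) i(2), of "lkp p m"]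
      from ideal_mult[OF I N[OF i(1)] split(2)] show ?thesis
        unfolding split(1) .
    qed
    then show "p \<in> I" by (rule mem_ideal_if_monoms[OF I])
  qed
  then show ?thesis by (rule that)
qed

text \<open>For forms with coefficients \<open>1, t, t^2, ...\<close>, vanishing at a given point is
  a nonzero polynomial condition on \<open>t\<close>, so finitely many points exclude only finitely
  many values of \<open>t\<close>.\<close>

lemma linear_form_avoiding:
  assumes "finite V" "V \<subseteq> punctured_space n"
  obtains l where "l \<in> graded_part n 1" "\<And>v. v \<in> V \<Longrightarrow> eval_mpoly v l \<noteq> 0"
proof -
  define P where "P v = (\<Sum>i\<le>n. Polynomial.monom (v i) i)" for v :: "nat \<Rightarrow> complex"
  have "P v \<noteq> 0" if v: "v \<in> V" for v
  proof -
    obtain i where "i \<le> n" "v i \<noteq> 0" using v assms(2) punctured_nonzero by blast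
    then have "Polynomial.coeff (P v) i \<noteq> 0" by (simp add: P_def coeff_sum)
    then show ?thesis by auto
  qed
  then have "finite (\<Union>v\<in>V. {t. poly (P v) t = 0})"
    using assms(1) poly_roots_finite by blast
  then obtain t where t: "t \<notin> (\<Union>v\<in>V. {t. poly (P v) t = 0})"
    using ex_new_if_finite[OF infinite_UNIV_char_0] by blast
  define l where "l = (\<Sum>i\<le>n. scale (t ^ i) (xvar i))"
  have "l \<in> graded_part n 1"
    unfolding l_def by (intro graded_part_sum graded_part_scale xvar_graded) auto
  moreover have "eval_mpoly v l = poly (P v) t" for v
    by (simp add: l_def P_def eval_sum poly_sum poly_monom mult.commute)
  ultimately show ?thesis using t by (intro that) auto
qed

text \<open>Vectors that are not proportional have a nonzero 2 by 2 minor, say in the columns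
  \<open>a\<close> and \<open>b\<close>. The form \<open>w b * x_a - w a * x_b\<close> vanishes at
  \<open>w\<close> and takes this minor as its value at \<open>v\<close>.\<close>

lemma linear_form_separating:
  assumes "v \<in> punctured_space n" "w \<in> punctured_space n" "(v, w) \<notin> proportional"
  obtains l where "l \<in> graded_part n 1" "eval_mpoly v l = 1" "eval_mpoly w l = 0"
proof -
  have "\<exists>a b. a \<le> n \<and> b \<le> n \<and> v a * w b \<noteq> v b * w a"
  proof (rule ccontr)
    assume "\<not> ?thesis"
    then have eq: "v a * w b = v b * w a" if "a \<le> n" "b \<le> n" for a b using that by blast
    obtain b where b: "b \<le> n" "v b \<noteq> 0" using assms(1) by (rule punctured_nonzero)
    obtain a where a: "a \<le> n" "w a \<noteq> 0" using assms(2) by (rule punctured_nonzero)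
    define c where "c = w b / v b"
    have "w b \<noteq> 0" using eq[OF a(1) b(1)] a b by auto
    then have "c \<noteq> 0" using b by (simp add: c_def)
    moreover have "w i = c * v i" for i
    proof (cases "i \<le> n")
      case True
      then show ?thesis using eq[OF True b(1)] b by (simp add: c_def field_simps)
    next
      case False
      then show ?thesis using assms(1,2) by (simp add: punctured_space_def)
    qed
    then have "w = (\<lambda>i. c * v i)" by (rule ext)
    ultimately have "(v, w) \<in> proportional"
      unfolding proportional_def by blast
    then show False using assms(3) by blast
  qed
  then obtain a b where ab: "a \<le> n" "b \<le> n" "v a * w b \<noteq> v b * w a" by blast
  let ?l = "scale (1 / (v a * w b - v b * w a)) (scale (w b) (xvar a) - scale (w a) (xvar b))"
  show ?thesis
  proof
    show "?l \<in> graded_part n 1"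
      using ab by (intro graded_part_scale graded_part_diff xvar_graded)
    show "eval_mpoly v ?l = 1" "eval_mpoly w ?l = 0"
      using ab(3) by (simp_all add: mult.commute[of "w b" "v a"] mult.commute[of "w a" "v b"] mult.commute[of "w b" "w a"])
  qed
qed

text \<open>One separating linear form for each other point gives a product of degree
  \<open>card V - 1\<close>; a power of a linear form with value 1 at \<open>v\<close> fills it up
  to degree \<open>k\<close>.\<close>

lemma interpolation_form:
  assumes "finite V" "V \<subseteq> punctured_space n" "v \<in> V" "card V \<le> k"
    and distinct: "\<And>w. w \<in> V \<Longrightarrow> (v, w) \<in> proportional \<Longrightarrow> v = w"
  obtains p where "p \<in> graded_part n k" "eval_mpoly v p = 1"
    "\<And>w. w \<in> V \<Longrightarrow> w \<noteq> v \<Longrightarrow> eval_mpoly w p = 0"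
proof -
  have "\<exists>l. l \<in> graded_part n 1 \<and> eval_mpoly v l = 1 \<and> eval_mpoly w l = 0" if "w \<in> V - {v}" for w
    using linear_form_separating[of v n w] assms that by blast
  then obtain L where L: "\<And>w. w \<in> V - {v} \<Longrightarrow> L w \<in> graded_part n 1"
    "\<And>w. w \<in> V - {v} \<Longrightarrow> eval_mpoly v (L w) = 1" "\<And>w. w \<in> V - {v} \<Longrightarrow> eval_mpoly w (L w) = 0"
    by metis
  obtain l0 where l0: "l0 \<in> graded_part n 1" "eval_mpoly v l0 \<noteq> 0"
    by (rule linear_form_avoiding[of "{v}" n]) (use assms(2,3) in auto)
  let ?l = "scale (1 / eval_mpoly v l0) l0"
  let ?p = "(\<Prod>w\<in>V - {v}. L w) * ?l ^ (k - card (V - {v}))"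
  have "?p \<in> graded_part n ((\<Sum>w\<in>V - {v}. 1) + (k - card (V - {v})) * 1)"
    using L(1) l0(1) by (intro graded_part_mult graded_part_prod graded_part_power graded_part_scale)
  moreover have "(\<Sum>w\<in>V - {v}. 1) + (k - card (V - {v})) * 1 = k"
    using assms(3,4) by simp
  ultimately have "?p \<in> graded_part n k" by simp
  moreover have "eval_mpoly v ?p = 1"
    using L(2) l0(2) by (simp add: eval_prod)
  moreover have "eval_mpoly w ?p = 0" if "w \<in> V" "w \<noteq> v" for w
    using L(3) that assms(1) by (auto simp: eval_prod intro!: prod_zero)
  ultimately show ?thesis by (rule that)
qed

lemma card_le_quotient_dim:
  assumes W: "mp.subspace W" and "mp.subspace V" "finite_dim_quotient V W" "B \<subseteq> V"
    and "\<And>F c b. finite F \<Longrightarrow> F \<subseteq> B \<Longrightarrow> (\<Sum>b\<in>F. scale (c b) b) \<in> W \<Longrightarrow> b \<in> F \<Longrightarrow> c b = 0"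
  shows "card B \<le> quotient_dim V W"
proof -
  have B: "quotient_basis (mp.span B) W B"
  proof (rule quotient_basisI)
    fix v assume "v \<in> mp.span B"
    then obtain F r where F: "finite F" "F \<subseteq> B" "v = (\<Sum>a\<in>F. scale (r a) a)"
      unfolding mp.span_explicit by auto
    show "\<exists>F c. finite F \<and> F \<subseteq> B \<and> v - (\<Sum>b\<in>F. scale (c b) b) \<in> W"
      using F mp.subspace_0[OF W] by (intro exI[of _ F] exI[of _ r]) simp
  qed (rule mp.span_superset, rule assms(5))
  have "mp.span B \<subseteq> V" by (rule mp.span_minimal[OF assms(4,2)])
  from quotient_dim_mono[OF W this assms(3)] show ?thesis
    using quotient_dim_eq_card[OF W B] by simp
qed

text \<open>Forms dual to the evaluations at the points are independent modulo any ideal vanishing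
  there. If the ideal contains all forms of degree \<open>k\<close> that vanish on \<open>V\<close>,
  they also span: subtract the interpolant.\<close>

lemma interpolation_basis:
  assumes I: "is_ideal n I" and V: "finite V" "V \<subseteq> punctured_space n"
    and distinct: "\<And>v w. v \<in> V \<Longrightarrow> w \<in> V \<Longrightarrow> (v, w) \<in> proportional \<Longrightarrow> v = w"
    and zero: "\<And>v p. v \<in> V \<Longrightarrow> p \<in> I \<Longrightarrow> eval_mpoly v p = 0"
    and k: "card V \<le> k"
  shows "card V \<le> hilbert_function n I k"
    and "(\<And>p. p \<in> graded_part n k \<Longrightarrow> (\<And>v. v \<in> V \<Longrightarrow> eval_mpoly v p = 0) \<Longrightarrow> p \<in> I) \<Longrightarrow>
      hilbert_function n I k = card V"
proof -
  have "\<exists>p. p \<in> graded_part n k \<and> eval_mpoly v p = 1 \<and> (\<forall>w\<in>V. w \<noteq> v \<longrightarrow> eval_mpoly w p = 0)"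
    if "v \<in> V" for v
    using interpolation_form[OF V that k] distinct[OF that] by metis
  then obtain P where P: "\<And>v. v \<in> V \<Longrightarrow> P v \<in> graded_part n k"
    "\<And>v. v \<in> V \<Longrightarrow> eval_mpoly v (P v) = 1"
    "\<And>v w. v \<in> V \<Longrightarrow> w \<in> V \<Longrightarrow> w \<noteq> v \<Longrightarrow> eval_mpoly w (P v) = 0"
    by metis
  have inj: "inj_on P V" by (rule inj_onI) (metis P(2,3) zero_neq_one)
  have indep: "c b = 0" if F: "finite F" "F \<subseteq> P ` V" "(\<Sum>b\<in>F. scale (c b) b) \<in> I" "b \<in> F" for F c b
  proof -
    obtain v where v: "v \<in> V" "b = P v" using F by auto
    have "0 = eval_mpoly v (\<Sum>b\<in>F. scale (c b) b)" using zero[OF v(1) F(3)] by simp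
    also have "\<dots> = (\<Sum>b'\<in>F. c b' * eval_mpoly v b')" by (simp add: eval_sum)
    also have "\<dots> = (\<Sum>b'\<in>{b}. c b' * eval_mpoly v b')"
      using F v P(3) by (intro sum.mono_neutral_right) auto
    finally show ?thesis using P(2)[OF v(1)] v(2) by simp
  qed
  have card: "card (P ` V) = card V" by (rule card_image[OF inj])
  have "card (P ` V) \<le> hilbert_function n I k"
    unfolding hilbert_function_def
    by (rule card_le_quotient_dim[OF ideal_subspace[OF I] subspace_graded_part
          finite_dim_graded_part[OF ideal_subspace[OF I]]]) (use P(1) in auto, rule indep)
  then show "card V \<le> hilbert_function n I k" using card by simp
  assume full: "\<And>p. p \<in> graded_part n k \<Longrightarrow> (\<And>v. v \<in> V \<Longrightarrow> eval_mpoly v p = 0) \<Longrightarrow> p \<in> I"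
  have "quotient_basis (graded_part n k) I (P ` V)"
  proof (rule quotient_basisI)
    fix p assume p: "p \<in> graded_part n k"
    define r where "r = p - (\<Sum>v\<in>V. scale (eval_mpoly v p) (P v))"
    have "r \<in> I"
    proof (rule full)
      show "r \<in> graded_part n k"
        unfolding r_def using p P(1) by (intro graded_part_diff graded_part_sum graded_part_scale)
      fix w assume w: "w \<in> V"
      have "eval_mpoly w (\<Sum>v\<in>V. scale (eval_mpoly v p) (P v)) = (\<Sum>v\<in>{w}. eval_mpoly v p * eval_mpoly w (P v))"
        unfolding eval_sum eval_scale
        by (rule sum.mono_neutral_right) (use V(1) w P(3) in auto)
      then show "eval_mpoly w r = 0" using P(2)[OF w] by (simp add: r_def)
    qed
    moreover have "(\<Sum>v\<in>V. scale (eval_mpoly v p) (P v)) =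
        (\<Sum>b\<in>P ` V. scale (eval_mpoly (the_inv_into V P b) p) b)"
      by (subst sum.reindex[OF inj]) (simp add: the_inv_into_f_f[OF inj])
    ultimately show "\<exists>F c. finite F \<and> F \<subseteq> P ` V \<and> p - (\<Sum>b\<in>F. scale (c b) b) \<in> I"
      using V(1) by (intro exI[of _ "P ` V"] exI[of _ "\<lambda>b. eval_mpoly (the_inv_into V P b) p"]) (simp add: r_def)
  qed (use P(1) in auto, rule indep)
  then show "hilbert_function n I k = card V"
    unfolding hilbert_function_def using quotient_dim_eq_card[OF ideal_subspace[OF I]] card by metis
qed

text \<open>Interpolation bounds the size of every set of pairwise nonproportional zeros by
  \<open>C\<close>. A largest such set represents all projective zeros, since a missing one could be
  added.\<close>

lemma zero_reps_of_bounded: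
  assumes I: "homogeneous_ideal n I" and bound: "\<And>k. hilbert_function n I k \<le> C"
  obtains V where "zero_reps n I V"
proof -
  note I' = homogeneous_ideal_is_ideal[OF I]
  define Q where "Q V \<longleftrightarrow> finite V \<and> V \<subseteq> punctured_space n \<and>
     (\<forall>v\<in>V. \<forall>w\<in>V. (v, w) \<in> proportional \<longrightarrow> v = w) \<and> (\<forall>v\<in>V. \<forall>p\<in>I. eval_mpoly v p = 0)" for V
  have "Q {}" by (simp add: Q_def)
  moreover have "card V \<le> C" if "Q V" for V
  proof -
    have "card V \<le> hilbert_function n I (card V)"
      by (rule interpolation_basis(1)[OF I']) (use that in \<open>auto simp: Q_def\<close>)
    then show ?thesis using bound le_trans by blast
  qed
  then have "\<forall>V. Q V \<longrightarrow> card V < Suc C" by (simp add: less_Suc_eq_le)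
  ultimately obtain V where V: "Q V" "\<And>V'. Q V' \<Longrightarrow> card V' \<le> card V"
    using ex_has_greatest_nat[of Q "{}" card "Suc C"] by blast
  have "\<exists>v\<in>V. (v, w) \<in> proportional"
    if w: "w \<in> punctured_space n" "\<And>p. p \<in> I \<Longrightarrow> eval_mpoly w p = 0" for w
  proof (rule ccontr)
    assume no: "\<not> (\<exists>v\<in>V. (v, w) \<in> proportional)"
    then have "w \<notin> V" using proportional_refl by blast
    moreover have "\<forall>v\<in>V. (v, w) \<notin> proportional \<and> (w, v) \<notin> proportional"
      using no proportional_sym by blast
    then have "Q (insert w V)"
      using V(1) w unfolding Q_def by auto
    ultimately show False using V(2)[of "insert w V"] V(1) by (simp add: Q_def)
  qed
  moreover have "\<forall>p\<in>I. eval_mpoly w p = 0" if "v \<in> V" "(v, w) \<in> proportional" for v w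
    using zero_ideal_proportional[OF I that(2)] V(1) that(1) by (auto simp: Q_def)
  ultimately have "\<forall>w\<in>punctured_space n. (\<forall>p\<in>I. eval_mpoly w p = 0) \<longleftrightarrow> (\<exists>v\<in>V. (v, w) \<in> proportional)"
    by meson
  then have "zero_reps n I V"
    using V(1) unfolding zero_reps_def Q_def by simp
  then show ?thesis by (rule that)
qed

text \<open>A hyperplane through none of the zeros leaves \<open>I + (l)\<close> without projective
  zeros, so this ideal fills all high degrees.\<close>

lemma zero_reps_linear_form:
  assumes I: "homogeneous_ideal n I" and V: "zero_reps n I V"
  obtains l K where "l \<in> graded_part n 1" "\<And>v. v \<in> V \<Longrightarrow> eval_mpoly v l \<noteq> 0"
    "\<And>k. k \<ge> K \<Longrightarrow> graded_part n k \<subseteq> ideal_adjoin n I l"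
proof -
  note I' = homogeneous_ideal_is_ideal[OF I]
  obtain l where l: "l \<in> graded_part n 1" "\<And>v. v \<in> V \<Longrightarrow> eval_mpoly v l \<noteq> 0"
    by (rule linear_form_avoiding[OF zero_reps_finite[OF V]]) (use zero_reps_punctured[OF V] in auto)
  have full: "\<exists>p\<in>ideal_adjoin n I l. eval_mpoly w p \<noteq> 0" if w: "w \<in> punctured_space n" for w
  proof (rule ccontr)
    assume "\<not> ?thesis"
    then have zero: "eval_mpoly w p = 0" if "p \<in> ideal_adjoin n I l" for p using that by blast
    then have "eval_mpoly w p = 0" if "p \<in> I" for p
      using that ideal_adjoin_superset[of I n l] by blast
    then obtain v where v: "v \<in> V" "(v, w) \<in> proportional"
      by (rule zero_reps_cover[OF V w])
    have "eval_mpoly w l = 0" by (rule zero[OF ideal_adjoin_mem[OF I']])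
    then show False using eval_proportional[OF v(2) l(1)] l(2)[OF v(1)] by simp
  qed
  show ?thesis
  proof (rule eventually_graded_subset[OF is_ideal_adjoin[OF I' graded_part_poly_ring[OF l(1)]]])
    show "\<exists>p\<in>ideal_adjoin n I l. eval_mpoly w p \<noteq> 0" if "w \<in> punctured_space n" for w
      by (rule full[OF that])
  qed (rule that[OF l])
qed

lemma eventually_const_antimono:
  fixes H :: "nat \<Rightarrow> nat"
  assumes "\<And>k. k \<ge> K \<Longrightarrow> H (Suc k) \<le> H k"
  obtains c K' where "K' \<ge> K" "\<And>k. k \<ge> K' \<Longrightarrow> H k = c"
proof -
  obtain K' where K': "K' \<ge> K" "\<And>k. k \<ge> K \<Longrightarrow> H K' \<le> H k"
    using ex_has_least_nat[of "\<lambda>k. k \<ge> K" K H] by blast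
  have le: "H k \<le> H K'" if "k \<ge> K'" for k
    using that by (induction rule: dec_induct) (use assms K'(1) in \<open>auto intro: le_trans\<close>)
  have "H k = H K'" if "k \<ge> K'" for k
    using le[OF that] K' that by (meson le_antisym le_trans)
  with K'(1) show ?thesis by (rule that)
qed

text \<open>Once \<open>I + (l)\<close> fills degree \<open>k + 1\<close>, multiplication by
  \<open>l\<close> maps degree \<open>k\<close> of \<open>S/I\<close> onto degree
  \<open>k + 1\<close>, so the values descend and must stabilize.\<close>

lemma hilbert_function_eventually_const:
  assumes I: "homogeneous_ideal n I" and l: "l \<in> graded_part n 1"
    and full: "\<And>k. k \<ge> K \<Longrightarrow> graded_part n k \<subseteq> ideal_adjoin n I l"
  obtains c K' where "\<And>k. k \<ge> K' \<Longrightarrow> hilbert_function n I k = c"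
proof -
  note I' = homogeneous_ideal_is_ideal[OF I]
  note l' = graded_part_poly_ring[OF l]
  have decr: "hilbert_function n I (Suc k) \<le> hilbert_function n I k" if k: "k \<ge> K" for k
  proof -
    have "hilbert_function n (ideal_adjoin n I l) (Suc k) = 0"
      using full[of "Suc k"] k hilbert_function_eq_0_iff[OF is_ideal_adjoin[OF I' l']] by simp
    then have "hilbert_function n I (Suc k) = hilbert_function n (colon n I l) k"
      using hilbert_function_adjoin[OF I l, of k] by simp
    also have "\<dots> \<le> hilbert_function n I k"
      by (intro hilbert_function_antimono I' is_ideal_colon colon_superset l')
    finally show ?thesis .
  qed
  show ?thesis
  proof (rule eventually_const_antimono[of K "hilbert_function n I"])
    show "hilbert_function n I (Suc k) \<le> hilbert_function n I k" if "k \<ge> K" for k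
      by (rule decr[OF that])
  qed (rule that)
qed

section \<open>Bezout's theorem for forms of finite colength\<close>

lemma hilbert_function_cong:
  assumes "is_ideal n I" "is_ideal n K" "\<And>p. p \<in> graded_part n k \<Longrightarrow> p \<in> I \<longleftrightarrow> p \<in> K"
  shows "hilbert_function n I k = hilbert_function n K k"
  unfolding hilbert_function_def
  by (rule quotient_dim_cong[OF subspace_graded_part ideal_subspace[OF assms(1)] ideal_subspace[OF assms(2)]])
    (use assms(3) in auto)

text \<open>If \<open>g\<close> is regular modulo \<open>I\<close>, the colon ideal is
  \<open>I\<close> and the sum over it cancels: what remains of the right-hand side are its last
  \<open>e\<close> values.\<close>

lemma sum_hilbert_function_adjoin:
  assumes I: "homogeneous_ideal n I" and g: "g \<in> graded_part n e"
  shows "(\<Sum>k<M + e. hilbert_function n (ideal_adjoin n I g) k) + (\<Sum>k<M. hilbert_function n (colon n I g) k)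
    = (\<Sum>k<M + e. hilbert_function n I k)"
proof (induction M)
  case 0
  show ?case using hilbert_function_adjoin_low[OF I g] by simp
next
  case (Suc M)
  then show ?case using hilbert_function_adjoin[OF I g, of M] by simp
qed

lemma hilbert_function_colon_le:
  assumes "homogeneous_ideal n I" "g \<in> graded_part n e"
  shows "hilbert_function n (colon n I g) k \<le> hilbert_function n I k"
  by (intro hilbert_function_antimono is_ideal_colon colon_superset
      homogeneous_ideal_is_ideal[OF assms(1)] graded_part_poly_ring[OF assms(2)])

text \<open>Beyond \<open>K + e\<close> the value at \<open>k\<close> is at most the value at
  \<open>k - e\<close>. Descending in steps of \<open>e\<close> ends in the initial range, where the
  sum dominates every term.\<close>

lemma hilbert_function_bounded:
  assumes I: "homogeneous_ideal n I" and h: "h \<in> graded_part n e" and e: "e \<ge> 1"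
    and full: "\<And>k. k \<ge> K \<Longrightarrow> graded_part n k \<subseteq> ideal_adjoin n I h"
  shows "hilbert_function n I k \<le> (\<Sum>j\<le>K + e. hilbert_function n I j)"
proof (induction k rule: less_induct)
  case (less k)
  show ?case
  proof (cases "k \<le> K + e")
    case True
    then show ?thesis by (intro member_le_sum) auto
  next
    case False
    have "hilbert_function n (ideal_adjoin n I h) k = 0"
      using full[of k] False hilbert_function_eq_0_iff[OF homogeneous_ideal_is_ideal[OF homogeneous_ideal_adjoin[OF I h]]]
      by simp
    then have "hilbert_function n I k = hilbert_function n (colon n I h) (k - e)"
      using hilbert_function_adjoin[OF I h, of "k - e"] False by simp
    also have "\<dots> \<le> hilbert_function n I (k - e)" by (rule hilbert_function_colon_le[OF I h])
    also have "\<dots> \<le> (\<Sum>j\<le>K + e. hilbert_function n I j)" using less[of "k - e"] False e by simp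
    finally show ?thesis .
  qed
qed

lemma sum_eq_imp_eq_nat:
  fixes f g :: "nat \<Rightarrow> nat"
  assumes "\<And>k. k < M \<Longrightarrow> f k \<le> g k" "(\<Sum>k<M. g k) \<le> (\<Sum>k<M. f k)" "k < M"
  shows "f k = g k"
proof (rule ccontr)
  assume "f k \<noteq> g k"
  then have "f k < g k" using assms(1,3) by (simp add: le_neq_implies_less)
  then have "(\<Sum>k<M. f k) < (\<Sum>k<M. g k)"
    using assms(1,3) by (intro sum_strict_mono_ex1) auto
  then show False using assms(2) by simp
qed

text \<open>
  Cohen--Macaulayness enters here: the lower bound on the eventual value of the Hilbert function
  of \<open>I\<close> together with the colength of \<open>I + (l)\<close> forces the linear form \<open>l\<close> to be regular modulo
  \<open>I\<close>, and then \<open>h\<close> is regular too because a power of \<open>l\<close> lies in \<open>I + (h)\<close>.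
\<close>

lemma colength_exchange:
  assumes I: "homogeneous_ideal n I" and h: "h \<in> graded_part n e" and e: "e \<ge> 1"
    and full: "\<And>k. k \<ge> K \<Longrightarrow> graded_part n k \<subseteq> ideal_adjoin n I h"
    and lower: "\<And>c K'. (\<And>k. k \<ge> K' \<Longrightarrow> hilbert_function n I k = c) \<Longrightarrow> P \<le> c"
    and linear: "\<And>l L. l \<in> graded_part n 1 \<Longrightarrow> (\<And>k. k \<ge> L \<Longrightarrow> graded_part n k \<subseteq> ideal_adjoin n I l) \<Longrightarrow>
      (\<Sum>k<L. hilbert_function n (ideal_adjoin n I l) k) = P"
  shows "(\<Sum>k<K. hilbert_function n (ideal_adjoin n I h) k) = e * P"
proof -
  note I' = homogeneous_ideal_is_ideal[OF I]
  let ?H = "hilbert_function n I"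
  obtain V where "zero_reps n I V"
    by (rule zero_reps_of_bounded[OF I hilbert_function_bounded[OF I h e full]])
  then obtain l L where l: "l \<in> graded_part n 1"
    and L: "\<And>k. k \<ge> L \<Longrightarrow> graded_part n k \<subseteq> ideal_adjoin n I l"
    using zero_reps_linear_form[OF I] by metis
  obtain c K' where c: "\<And>k. k \<ge> K' \<Longrightarrow> ?H k = c"
    using hilbert_function_eventually_const[OF I l L] by metis
  have "P \<le> c" by (rule lower[OF c])
  \<comment> \<open>The exact sequence for \<open>l\<close> makes \<open>P\<close> plus the sum over
    the colon ideal equal to \<open>c\<close> plus the sum over \<open>I\<close>. The colon sum is
    the smaller one, so \<open>c \<le> P\<close>; with \<open>P \<le> c\<close> equality holds
    everywhere.\<close>
  have key: "c = P \<and> hilbert_function n (colon n I l) k = ?H k" for k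
  proof -
    define M where "M = Suc (max k (max L K'))"
    have "(\<Sum>k<M + 1. hilbert_function n (ideal_adjoin n I l) k) = P"
      by (rule linear[OF l]) (rule L, simp add: M_def)
    then have "P + (\<Sum>k<M. hilbert_function n (colon n I l) k) = (\<Sum>k<M. ?H k) + c"
      using sum_hilbert_function_adjoin[OF I l, of M] c[of M] by (simp add: M_def)
    moreover have "(\<Sum>k<M. hilbert_function n (colon n I l) k) \<le> (\<Sum>k<M. ?H k)"
      by (intro sum_mono hilbert_function_colon_le[OF I l])
    ultimately have "c = P" "(\<Sum>k<M. ?H k) \<le> (\<Sum>k<M. hilbert_function n (colon n I l) k)"
      using \<open>P \<le> c\<close> by linarith+
    moreover have "k < M" by (simp add: M_def)
    ultimately show ?thesis
      using sum_eq_imp_eq_nat[of M "hilbert_function n (colon n I l)" ?H k]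
        hilbert_function_colon_le[OF I l] by blast
  qed
  have regular: "q \<in> I" if "q \<in> graded_part n k" "q * l \<in> I" for q k
  proof (rule hilbert_function_eq_subset[OF I' is_ideal_colon[OF I' graded_part_poly_ring[OF l]]])
    show "I \<subseteq> colon n I l" by (rule colon_superset[OF I' graded_part_poly_ring[OF l]])
    show "q \<in> colon n I l" using that by (simp add: colon_def graded_part_poly_ring)
  qed (use key that in auto)
  have regular_power: "q \<in> I" if "q \<in> graded_part n k" "q * l ^ N \<in> I" for q k N
    using that
  proof (induction N)
    case (Suc N)
    have "q * l ^ N \<in> graded_part n (k + N)"
      using graded_part_mult[OF Suc.prems(1) graded_part_power[OF l, of N]] by simp
    then have "q * l ^ N \<in> I"
      by (rule regular) (use Suc.prems(2) in \<open>simp add: mult_ac\<close>)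
    then show ?case by (rule Suc.IH[OF Suc.prems(1)])
  qed simp
  have colon_h: "hilbert_function n (colon n I h) k = ?H k" for k
  proof (rule hilbert_function_cong[OF is_ideal_colon[OF I' graded_part_poly_ring[OF h]] I'])
    fix q assume q: "q \<in> graded_part n k"
    show "q \<in> colon n I h \<longleftrightarrow> q \<in> I"
    proof
      assume "q \<in> colon n I h"
      then have qh: "q * h \<in> I" by (simp add: colon_def)
      have "l ^ K \<in> ideal_adjoin n I h"
        using full[of K] graded_part_power[OF l, of K] by auto
      then obtain a r where ar: "l ^ K = a + r * h" "a \<in> I" "r \<in> poly_ring n" by (rule ideal_adjoinE)
      have "q * l ^ K = q * a + r * (q * h)" by (simp add: ar(1) algebra_simps)
      also have "\<dots> \<in> I"
        by (intro ideal_add[OF I'] ideal_mult[OF I'] ar qh graded_part_poly_ring[OF q])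
      finally show "q \<in> I" by (rule regular_power[OF q])
    qed (use colon_superset[OF I' graded_part_poly_ring[OF h]] in auto)
  qed
  \<comment> \<open>From \<open>K'\<close> on the Hilbert function of \<open>I\<close> is
    \<open>c\<close>, so regularity of \<open>h\<close> leaves \<open>e\<close> consecutive values
    \<open>c\<close> as the colength.\<close>
  define M where "M = max K K'"
  have "(\<Sum>k<M + e. ?H k) = (\<Sum>k<M. ?H k) + (\<Sum>k\<in>{M..<M + e}. ?H k)"
    by (simp add: lessThan_atLeast0 sum.atLeastLessThan_concat)
  also have "(\<Sum>k\<in>{M..<M + e}. ?H k) = e * c"
    using c by (simp add: M_def)
  finally have "(\<Sum>k<M + e. hilbert_function n (ideal_adjoin n I h) k) = e * c"
    using sum_hilbert_function_adjoin[OF I h, of M] by (simp add: colon_h)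
  also have "(\<Sum>k<M + e. hilbert_function n (ideal_adjoin n I h) k) =
      (\<Sum>k<K. hilbert_function n (ideal_adjoin n I h) k)"
    using full hilbert_function_eq_0_iff[OF homogeneous_ideal_is_ideal[OF homogeneous_ideal_adjoin[OF I h]]]
    by (intro sum.mono_neutral_right) (auto simp: M_def)
  finally show ?thesis using key by simp
qed

text \<open>With one generator fewer than variables the growth theorem is applied in order
  \<open>r = 1\<close>: an eventual value \<open>c\<close> is the slope of the cumulated function,
  and the product of the degrees bounds this slope from below.\<close>

lemma prod_degrees_le_hilbert_function:
  assumes "finite A" "\<And>i. i \<in> A \<Longrightarrow> h i \<in> graded_part n (e i)" "\<And>i. i \<in> A \<Longrightarrow> e i \<ge> 1"
    and "card A = n" and const: "\<And>k. k \<ge> K \<Longrightarrow> hilbert_function n (ideal_span n h A) k = c"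
  shows "(\<Prod>i\<in>A. e i) \<le> c"
proof -
  let ?H = "hilbert_function n (ideal_span n h A)"
  define Q where "Q = (\<Sum>j<K. ?H j)"
  have C: "(\<Sum>j\<le>k. ?H j) \<le> Q + c * (k + 1)" for k
  proof -
    have "(\<Sum>j\<le>k. ?H j) \<le> (\<Sum>j\<le>k. (if j < K then ?H j else 0) + c)"
      using const by (intro sum_mono) auto
    also have "\<dots> = (\<Sum>j\<in>{..k} \<inter> {..<K}. ?H j) + c * (k + 1)"
      by (simp add: sum.distrib sum.If_cases lessThan_def)
    also have "(\<Sum>j\<in>{..k} \<inter> {..<K}. ?H j) \<le> Q"
      unfolding Q_def by (intro sum_mono2) auto
    finally show ?thesis by simp
  qed
  \<comment> \<open>The initial degrees contribute the constant \<open>Q\<close>, which no shift can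
    absorb if \<open>c = 0\<close>. The slope \<open>c + 1/2\<close>, written as
    \<open>(2 * c + 1) / 2\<close>, always leaves room, and integrality removes the half.\<close>
  have "2 * (\<Prod>i\<in>A. e i) \<le> 2 * c + 1"
  proof (rule hilbert_growth[OF assms(1-3), where r = 1])
    fix k
    have "2 * (\<Sum>j\<le>k. ?H j) \<le> 2 * (Q + c * (k + 1))" using C by (rule mult_le_mono2)
    also have "\<dots> \<le> (2 * c + 1) * (k + 2 * Q + 1)" by (simp add: algebra_simps)
    finally show "2 * (\<Sum>j\<le>k. ?H j) \<le> (2 * c + 1) * ((k + 2 * Q + 1) choose 1)" by simp
  qed (use assms(4) in auto)
  then show ?thesis by linarith
qed

lemma hilbert_function_span_0:
  assumes "finite A" "\<And>i. i \<in> A \<Longrightarrow> h i \<in> graded_part n (e i)" "\<And>i. i \<in> A \<Longrightarrow> e i \<ge> 1"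
  shows "hilbert_function n (ideal_span n h A) 0 = 1"
  using assms
proof (induction A rule: finite_induct)
  case empty
  have "monoms_of_degree n 0 = {0}" by (auto simp: monoms_of_degree_def mdeg_eq_0_iff)
  then show ?case by (simp add: hilbert_function_zero)
next
  case (insert x A)
  have "homogeneous_ideal n (ideal_span n h A)"
    by (rule homogeneous_ideal_span) (use insert in auto)
  moreover have "h x \<in> graded_part n (e x)" "0 < e x" using insert.prems[of x] by auto
  ultimately show ?case
    using hilbert_function_adjoin_low[of n _ "h x" "e x" 0] insert by (simp add: ideal_span_insert)
qed

lemma graded_part_1_span: "graded_part n 1 \<subseteq> mp.span (xvar ` {..n})"
proof
  fix p assume p: "p \<in> graded_part n 1"
  have "sngl m (lkp p m) \<in> mp.span (xvar ` {..n})" if m: "m \<in> Poly_Mapping.keys p" for m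
  proof -
    have mm: "m \<in> monoms n" "mdeg m = 1" using p m by (auto simp: graded_part_iff)
    then have "m \<noteq> 0" by auto
    then obtain i where i: "i \<in> Poly_Mapping.keys m" by (metis ex_in_conv keys_eq_empty)
    then have "i \<le> n" using mm by (auto simp: monoms_def)
    have "lkp m i \<ge> 1" using i by (simp add: in_keys_iff Suc_le_eq)
    have eq: "m = (m - sngl i 1) + sngl i 1"
      using \<open>lkp m i \<ge> 1\<close> by (intro poly_mapping_eqI) (auto simp: lookup_add lookup_minus lookup_single_if)
    then have "mdeg m = mdeg (m - sngl i 1) + 1" by (metis mdeg_add mdeg_single)
    then have "m - sngl i 1 = 0" using mm(2) by (simp add: mdeg_eq_0_iff)
    with eq have "m = sngl i 1" by simp
    then have "sngl m (lkp p m) = scale (lkp p m) (xvar i)" by (simp add: xvar_def scale_single)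
    then show ?thesis using \<open>i \<le> n\<close> by (auto intro: mp.span_scale mp.span_base)
  qed
  then have "(\<Sum>m\<in>Poly_Mapping.keys p. sngl m (lkp p m)) \<in> mp.span (xvar ` {..n})"
    by (rule mp.span_sum)
  then show "p \<in> mp.span (xvar ` {..n})" by (simp add: poly_mapping_sum_single)
qed

text \<open>If one form were a combination of the others, \<open>n\<close> forms would have finite
  colength, and the lower bound would read \<open>1 \<le> 0\<close>. So the \<open>n + 1\<close>
  forms are independent, span all variables and generate the maximal ideal.\<close>

lemma colength_linear:
  assumes A: "finite A" "card A = Suc n" and h: "\<And>i. i \<in> A \<Longrightarrow> h i \<in> graded_part n 1"
    and full: "\<And>k. k \<ge> K \<Longrightarrow> graded_part n k \<subseteq> ideal_span n h A"
  shows "(\<Sum>k<K. hilbert_function n (ideal_span n h A) k) = 1"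
proof -
  let ?I = "ideal_span n h A"
  have I: "is_ideal n ?I"
    by (rule is_ideal_span[OF A(1)]) (rule graded_part_poly_ring[OF h])
  have not_span: "h j \<notin> mp.span (h ` (A - {j}))" if j: "j \<in> A" for j
  proof
    assume "h j \<in> mp.span (h ` (A - {j}))"
    let ?I' = "ideal_span n h (A - {j})"
    have I': "is_ideal n ?I'"
      by (rule is_ideal_span) (use A(1) h graded_part_poly_ring in auto)
    have "h ` (A - {j}) \<subseteq> ?I'" using A(1) by (auto intro!: ideal_span_mem)
    then have "h j \<in> ?I'"
      using mp.span_minimal[OF _ ideal_subspace[OF I']] \<open>h j \<in> mp.span _\<close> by blast
    then have "?I \<subseteq> ?I'"
      using A(1) by (intro ideal_span_subset[OF I']) (metis Diff_iff finite_Diff ideal_span_mem singletonD)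
    then have "hilbert_function n ?I' k = 0" if "k \<ge> K" for k
      using full[OF that] hilbert_function_eq_0_iff[OF I'] by blast
    then have "(\<Prod>i\<in>A - {j}. 1 :: nat) \<le> 0"
      by (intro prod_degrees_le_hilbert_function[of "A - {j}" h n "\<lambda>_. 1"]) (use A h j in auto)
    then show False by simp
  qed
  have inj: "inj_on h A"
  proof (rule inj_onI, rule ccontr)
    fix i j assume ij: "i \<in> A" "j \<in> A" "h i = h j" "i \<noteq> j"
    then have "h j \<in> h ` (A - {j})" by (intro image_eqI[of _ _ i]) auto
    then have "h j \<in> mp.span (h ` (A - {j}))" by (rule mp.span_base)
    then show False using not_span[OF ij(2)] by simp
  qed
  have indep: "mp.independent (h ` A)"
  proof
    assume "mp.dependent (h ` A)"
    then obtain j where j: "j \<in> A" "h j \<in> mp.span (h ` A - {h j})"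
      unfolding mp.dependent_def by auto
    have "h ` A - {h j} \<subseteq> h ` (A - {j})" by auto
    from mp.span_mono[OF this] show False using not_span[OF j(1)] j(2) by auto
  qed
  have "graded_part n 1 \<subseteq> mp.span (h ` A)"
  proof
    fix p assume p: "p \<in> graded_part n 1"
    show "p \<in> mp.span (h ` A)"
    proof (rule ccontr)
      assume notin: "p \<notin> mp.span (h ` A)"
      then have "mp.independent (insert p (h ` A))" by (rule mp.independent_insertI[OF _ indep])
      moreover have "insert p (h ` A) \<subseteq> mp.span (xvar ` {..n})"
        using p h graded_part_1_span by blast
      ultimately have "card (insert p (h ` A)) \<le> card (xvar ` {..n})"
        using mp.independent_span_bound[of "xvar ` {..n}"] by blast
      also have "\<dots> \<le> Suc n" using card_image_le[of "{..n}" xvar] by simp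
      finally have "card (insert p (h ` A)) \<le> Suc n" .
      moreover have "p \<notin> h ` A" using notin mp.span_base by blast
      ultimately show False
        using A by (simp add: card_image[OF inj])
    qed
  qed
  also have "\<dots> \<subseteq> ?I"
    using A(1) by (intro mp.span_minimal ideal_subspace[OF I]) (auto intro: ideal_span_mem)
  finally have deg1: "graded_part n 1 \<subseteq> ?I" .
  have zero: "hilbert_function n ?I k = 0" if "k \<ge> 1" for k
    unfolding hilbert_function_eq_0_iff[OF I]
  proof
    fix p assume p: "p \<in> graded_part n k"
    show "p \<in> ?I"
    proof (rule mem_ideal_if_monoms[OF I])
      fix m assume m: "m \<in> Poly_Mapping.keys p"
      then have mm: "m \<in> monoms n" "m \<noteq> 0" using p that by (auto simp: graded_part_iff)
      then obtain i where i: "i \<in> Poly_Mapping.keys m" by (metis ex_in_conv keys_eq_empty)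
      then have "i \<le> n" using mm by (auto simp: monoms_def)
      have "1 \<le> lkp m i" using i by (simp add: in_keys_iff Suc_le_eq)
      note split = single_split_xvar[OF mm(1) this, of "lkp p m"]
      have "xvar i \<in> ?I" using deg1 xvar_graded[OF \<open>i \<le> n\<close>] by blast
      from ideal_mult[OF I this split(2)] show "sngl m (lkp p m) \<in> ?I"
        using split(1) by simp
    qed
  qed
  have one: "hilbert_function n ?I 0 = 1"
    by (rule hilbert_function_span_0[OF A(1), where e = "\<lambda>_. 1"]) (use h in auto)
  have "K \<noteq> 0" using full[of 0] one hilbert_function_eq_0_iff[OF I, of 0] by auto
  then have "(\<Sum>k<K. hilbert_function n ?I k) = (\<Sum>k\<in>{0}. hilbert_function n ?I k)"
    using zero by (intro sum.mono_neutral_right) auto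
  then show ?thesis using one by simp
qed

text \<open>The induction counts the generators whose degree is not 1, while the index set keeps its
  size. \<open>colength_exchange\<close> asks for the colength with an arbitrary linear form in
  place of \<open>h j\<close>, and this is what the induction hypothesis provides.\<close>

theorem bezout_colength:
  assumes "finite A" "card A = Suc n" "\<And>i. i \<in> A \<Longrightarrow> h i \<in> graded_part n (e i)"
    "\<And>i. i \<in> A \<Longrightarrow> e i \<ge> 1" "\<And>k. k \<ge> K \<Longrightarrow> graded_part n k \<subseteq> ideal_span n h A"
  shows "(\<Sum>k<K. hilbert_function n (ideal_span n h A) k) = (\<Prod>i\<in>A. e i)"
  using assms
proof (induction "card {i \<in> A. e i \<noteq> 1}" arbitrary: h e K rule: less_induct)
  case less
  show ?case
  proof (cases "\<forall>i\<in>A. e i = 1")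
    case True
    then show ?thesis using colength_linear[OF less.prems(1,2), of h K] less.prems(3,5) by simp
  next
    case False
    then obtain j where j: "j \<in> A" "e j \<noteq> 1" by blast
    let ?I = "ideal_span n h (A - {j})" and ?P = "\<Prod>i\<in>A - {j}. e i"
    have A: "finite (A - {j})" "card (A - {j}) = n" "insert j (A - {j}) = A"
      using less.prems(1,2) j by auto
    have I: "homogeneous_ideal n ?I"
      by (rule homogeneous_ideal_span[OF A(1), where e = e]) (use less.prems(3) in auto)
    have span: "ideal_span n h A = ideal_adjoin n ?I (h j)"
      using ideal_span_insert[OF A(1), of j n h] A(3) by simp
    have "(\<Sum>k<K. hilbert_function n (ideal_adjoin n ?I (h j)) k) = e j * ?P"
    proof (rule colength_exchange[OF I less.prems(3)[OF j(1)] less.prems(4)[OF j(1)]])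
      show "graded_part n k \<subseteq> ideal_adjoin n ?I (h j)" if "k \<ge> K" for k
        using less.prems(5)[OF that] span by simp
      show "?P \<le> c" if "\<And>k. k \<ge> K' \<Longrightarrow> hilbert_function n ?I k = c" for c K'
        by (rule prod_degrees_le_hilbert_function[OF A(1) _ _ A(2) that]) (use less.prems(3,4) in auto)
      fix l L assume l: "l \<in> graded_part n 1" "\<And>k. k \<ge> L \<Longrightarrow> graded_part n k \<subseteq> ideal_adjoin n ?I l"
      let ?h = "h(j := l)" and ?e = "e(j := 1)"
      have "ideal_span n ?h (A - {j}) = ?I" by (rule ideal_span_cong) auto
      then have span': "ideal_span n ?h A = ideal_adjoin n ?I l"
        using ideal_span_insert[OF A(1), of j n ?h] A(3) by simp
      have "{i \<in> A. ?e i \<noteq> 1} \<subset> {i \<in> A. e i \<noteq> 1}" using j by auto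
      then have smaller: "card {i \<in> A. ?e i \<noteq> 1} < card {i \<in> A. e i \<noteq> 1}"
        by (rule psubset_card_mono[rotated]) (use less.prems(1) in simp)
      have "(\<Sum>k<L. hilbert_function n (ideal_span n ?h A) k) = (\<Prod>i\<in>A. ?e i)"
        by (rule less.hyps[OF smaller less.prems(1,2)]) (use l less.prems(3,4) span' in auto)
      also have "\<dots> = (\<Prod>i\<in>A - {j}. ?e i)"
        using prod.remove[OF less.prems(1) j(1), of ?e] by simp
      also have "\<dots> = ?P" by (rule prod.cong) auto
      finally show "(\<Sum>k<L. hilbert_function n (ideal_adjoin n ?I l) k) = ?P" by (simp add: span')
    qed
    also have "e j * ?P = (\<Prod>i\<in>A. e i)" by (rule prod.remove[OF less.prems(1) j(1), symmetric])
    finally show ?thesis by (simp add: span)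
  qed
qed

section \<open>The eventual Hilbert function of finitely many projective points\<close>

lemma card_monoms_le:
  "card (\<Union>k\<le>D. monoms_of_degree n k) \<le> (D + 1) ^ Suc n"
proof -
  let ?X = "\<Union>k\<le>D. monoms_of_degree n k"
  have "card ?X \<le> card (PiE {..n} (\<lambda>_. {..D}))"
  proof (rule card_inj_on_le)
    show "inj_on (\<lambda>m. restrict (lkp m) {..n}) ?X"
    proof (rule inj_onI, rule poly_mapping_eqI)
      fix m m' i
      assume m: "m \<in> ?X" "m' \<in> ?X" "restrict (lkp m) {..n} = restrict (lkp m') {..n}"
      then have keys: "Poly_Mapping.keys m \<subseteq> {..n}" "Poly_Mapping.keys m' \<subseteq> {..n}"
        by (auto simp: monoms_of_degree_def monoms_def)
      show "lkp m i = lkp m' i"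
      proof (cases "i \<le> n")
        case True
        then show ?thesis using fun_cong[OF m(3), of i] by simp
      next
        case False
        then have "i \<notin> Poly_Mapping.keys m" "i \<notin> Poly_Mapping.keys m'" using keys by auto
        then show ?thesis by (simp add: in_keys_iff)
      qed
    qed
    show "(\<lambda>m. restrict (lkp m) {..n}) ` ?X \<subseteq> PiE {..n} (\<lambda>_. {..D})"
      by (intro image_subsetI)
        (auto simp: monoms_of_degree_def restrict_PiE_iff intro: le_trans[OF lookup_le_mdeg])
  qed (auto intro: finite_PiE)
  then show ?thesis by (simp add: card_PiE)
qed

text \<open>By the Nullstellensatz for the zero ideal, a polynomial that vanishes everywhere is
  nilpotent, hence zero.\<close>

lemma exists_nonvanishing_point:
  assumes "R \<in> poly_ring n" "R \<noteq> 0"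
  obtains y where "eval_mpoly y R \<noteq> 0"
proof (rule ccontr)
  assume "\<not> thesis"
  then have "\<exists>N. R ^ N \<in> {0}"
    using that by (intro nullstellensatz[OF homogeneous_ideal_is_ideal[OF homogeneous_ideal_zero] assms(1)]) auto
  then show False using assms(2) by simp
qed

text \<open>
  More forms than variables are algebraically dependent, so that the polynomial map defined by
  them misses a point: any point where a relation between the forms does not vanish.
\<close>

lemma exists_point_outside_image:
  assumes F: "\<And>i. i \<le> Suc n \<Longrightarrow> F i \<in> graded_part n e" and e: "e \<ge> 1"
  obtains y where "\<forall>x. \<exists>i\<le>Suc n. eval_mpoly x (F i) \<noteq> y i"
proof -
  \<comment> \<open>There are \<open>M ^ (n + 2)\<close> products with exponents below
    \<open>M\<close>, all of degree at most \<open>D\<close>, in a space of dimension at most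
    \<open>(D + 1) ^ (n + 1)\<close>. Since \<open>D + 1 \<le> b * M\<close>, the choice
    \<open>M > b ^ (n + 1)\<close> makes the products outnumber the dimension.\<close>
  define b where "b = (n + 3) * e"
  define M where "M = b ^ Suc n + 1"
  define D where "D = (n + 2) * (M * e)"
  let ?C = "PiE {..Suc n} (\<lambda>_. {..<M})"
  define q where "q \<alpha> = (\<Prod>i\<le>Suc n. F i ^ \<alpha> i)" for \<alpha> :: "nat \<Rightarrow> nat"
  let ?S = "(\<lambda>m. sngl m (1 :: complex)) ` (\<Union>k\<le>D. monoms_of_degree n k)"
  have M: "M \<ge> 1" by (simp add: M_def)
  have finC: "finite ?C" by (intro finite_PiE) auto
  have finS: "finite ?S" by (simp add: finite_monoms_of_degree)
  have "card ?S \<le> (D + 1) ^ Suc n"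
    using card_image_le[of "\<Union>k\<le>D. monoms_of_degree n k" "\<lambda>m. sngl m (1 :: complex)"]
      card_monoms_le[of n D] finite_monoms_of_degree[of n] by simp
  also have "D + 1 \<le> b * M"
  proof -
    have "1 \<le> M * e" using M e by simp
    then show ?thesis by (simp add: D_def b_def algebra_simps)
  qed
  then have "(D + 1) ^ Suc n \<le> (b * M) ^ Suc n" by (rule power_mono) simp
  also have "\<dots> = b ^ Suc n * M ^ Suc n" by (rule power_mult_distrib)
  also have "\<dots> < M * M ^ Suc n" using M by (simp add: M_def)
  also have "\<dots> = card ?C" by (simp add: card_PiE)
  finally have less: "card ?S < card ?C" .
  have span: "q \<alpha> \<in> mp.span ?S" if \<alpha>: "\<alpha> \<in> ?C" for \<alpha>
  proof -
    have q: "q \<alpha> \<in> graded_part n (\<Sum>i\<le>Suc n. \<alpha> i * e)"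
      unfolding q_def using F by (intro graded_part_prod graded_part_power) auto
    have "(\<Sum>i\<le>Suc n. \<alpha> i * e) \<le> (\<Sum>i\<le>Suc n. M * e)"
      using \<alpha> by (intro sum_mono mult_le_mono1) (auto simp: PiE_iff less_imp_le)
    also have "\<dots> = D" by (simp add: D_def)
    finally show ?thesis
      using q by (intro poly_ring_span graded_part_poly_ring[OF q]) (auto simp: graded_part_iff)
  qed
  obtain u \<alpha>0 where u: "(\<Sum>\<alpha>\<in>?C. scale (u \<alpha>) (q \<alpha>)) = 0" "\<alpha>0 \<in> ?C" "u \<alpha>0 \<noteq> 0"
    by (rule family_dependent[OF finC finS less span])
  \<comment> \<open>The relation is read as a polynomial \<open>R\<close> in \<open>n + 2\<close>
    new variables. It is nonzero because distinct exponent tuples give distinct monomials, yet it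
    vanishes at every value of the map given by the \<open>F i\<close>.\<close>
  define mon where "mon \<alpha> = (\<Sum>i\<le>Suc n. sngl i (\<alpha> i))" for \<alpha> :: "nat \<Rightarrow> nat"
  have lookup_mon: "lkp (mon \<alpha>) i = (if i \<le> Suc n then \<alpha> i else 0)" for \<alpha> i
    by (simp add: mon_def lookup_sum lookup_single_if del: sum.atMost_Suc)
  have keys_mon: "Poly_Mapping.keys (mon \<alpha>) \<subseteq> {..Suc n}" for \<alpha>
    by (auto simp: in_keys_iff lookup_mon split: if_splits)
  have inj: "\<alpha> = \<beta>" if "\<alpha> \<in> ?C" "\<beta> \<in> ?C" "mon \<alpha> = mon \<beta>" for \<alpha> \<beta>
    using that(1,2) by (rule PiE_ext) (metis lookup_mon that(3) atMost_iff)
  define R where "R = (\<Sum>\<alpha>\<in>?C. sngl (mon \<alpha>) (u \<alpha>))"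
  have "R \<in> poly_ring (Suc n)"
    unfolding R_def using keys_mon by (intro poly_ring_sum poly_ring_single) (auto simp: monoms_def)
  moreover have "lkp R (mon \<alpha>0) = (\<Sum>\<alpha>\<in>{\<alpha>0}. u \<alpha>)"
    unfolding R_def lookup_sum lookup_single_if
    by (rule sum.mono_neutral_cong_right[OF finC]) (use u(2) inj in auto)
  then have "R \<noteq> 0" using u(3) by auto
  ultimately obtain y where y: "eval_mpoly y R \<noteq> 0" by (rule exists_nonvanishing_point)
  have eval_R: "eval_mpoly z R = (\<Sum>\<alpha>\<in>?C. u \<alpha> * (\<Prod>i\<le>Suc n. z i ^ \<alpha> i))" for z
    unfolding R_def eval_sum eval_single
    by (intro sum.cong refl) (simp add: monom_val_superset[OF _ keys_mon] lookup_mon del: prod.atMost_Suc)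
  have "\<exists>i\<le>Suc n. eval_mpoly x (F i) \<noteq> y i" for x
  proof (rule ccontr)
    assume "\<not> ?thesis"
    then have xy: "eval_mpoly x (F i) = y i" if "i \<le> Suc n" for i using that by blast
    have "eval_mpoly y R = eval_mpoly x (\<Sum>\<alpha>\<in>?C. scale (u \<alpha>) (q \<alpha>))"
      unfolding eval_R eval_sum eval_scale q_def eval_prod eval_power
      using xy by (intro sum.cong prod.cong arg_cong2[where f = "(*)"] refl) auto
    then show False using y u(1) by simp
  qed
  then have "\<forall>x. \<exists>i\<le>Suc n. eval_mpoly x (F i) \<noteq> y i" ..
  then show ?thesis by (rule that)
qed

lemma exists_complex_root:
  assumes "e \<ge> 1"
  obtains w :: complex where "w ^ e = z"
proof -
  let ?p = "Polynomial.monom 1 e - [:z:]"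
  have "Polynomial.coeff ?p e \<noteq> 0 \<or> e = 0" by (cases e) auto
  then have "Polynomial.degree ?p \<noteq> 0"
    using assms le_degree[of ?p e] by auto
  then obtain w where "poly ?p w = 0"
    using fundamental_theorem_of_algebra[of ?p] constant_degree by metis
  then show ?thesis by (intro that[of w]) (simp add: poly_monom)
qed

text \<open>Projection from a point \<open>y\<close> outside the image. The forms \<open>g i\<close>
  vanish together at \<open>w\<close> only if the values of the \<open>F i\<close> at
  \<open>w\<close> are proportional to \<open>y\<close>; rescaling \<open>w\<close> would then
  produce \<open>y\<close> itself.\<close>

lemma noether_normalization:
  assumes F: "\<And>i. i \<le> Suc n \<Longrightarrow> F i \<in> graded_part n e" and e: "e \<ge> 1"
    and nz: "\<forall>w\<in>punctured_space n. \<exists>i\<le>Suc n. eval_mpoly w (F i) \<noteq> 0"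
  obtains A :: "nat set" and g where
    "finite A" "card A = Suc n" "\<forall>i\<in>A. g i \<in> graded_part n e"
    "\<forall>I. is_ideal n I \<longrightarrow> F ` {..Suc n} \<subseteq> I \<longrightarrow> g ` A \<subseteq> I"
    "\<forall>w\<in>punctured_space n. \<exists>i\<in>A. eval_mpoly w (g i) \<noteq> 0"
proof -
  obtain y where y: "\<forall>x. \<exists>i\<le>Suc n. eval_mpoly x (F i) \<noteq> y i"
    by (rule exists_point_outside_image[OF F e])
  \<comment> \<open>The origin is mapped to 0 because the degree is positive, so the missed point is
    not 0.\<close>
  obtain s where s: "s \<le> Suc n" "y s \<noteq> 0"
  proof -
    obtain i where i: "i \<le> Suc n" "eval_mpoly (\<lambda>_. 0) (F i) \<noteq> y i" using y by blast
    moreover have "eval_mpoly (\<lambda>_. 0) (F i) = 0"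
      using eval_cmult[OF F[OF i(1)], of 0 "\<lambda>_. 0"] e by (auto simp: zero_power)
    ultimately show ?thesis using that[of i] by simp
  qed
  define g where "g i = scale (y s) (F i) - scale (y i) (F s)" for i
  let ?A = "{..Suc n} - {s}"
  show ?thesis
  proof (rule that[of ?A g])
    show "finite ?A" "card ?A = Suc n" using s(1) by auto
    show "\<forall>i\<in>?A. g i \<in> graded_part n e"
      unfolding g_def using F s(1) by (intro ballI graded_part_diff graded_part_scale) auto
    have "g i \<in> I" if I: "is_ideal n I" "F ` {..Suc n} \<subseteq> I" "i \<in> ?A" for I i
      unfolding g_def scale_def using I(2,3) s(1)
      by (intro ideal_diff[OF I(1)] ideal_mult[OF I(1)]) auto
    then show "\<forall>I. is_ideal n I \<longrightarrow> F ` {..Suc n} \<subseteq> I \<longrightarrow> g ` ?A \<subseteq> I" by blast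
    show "\<forall>w\<in>punctured_space n. \<exists>i\<in>?A. eval_mpoly w (g i) \<noteq> 0"
    proof (rule ballI, rule ccontr)
      fix w assume w: "w \<in> punctured_space n"
      assume "\<not> (\<exists>i\<in>?A. eval_mpoly w (g i) \<noteq> 0)"
      then have zero: "eval_mpoly w (g i) = 0" if "i \<in> ?A" for i using that by blast
      define c where "c = eval_mpoly w (F s) / y s"
      have Fw: "eval_mpoly w (F i) = c * y i" if "i \<le> Suc n" for i
        using zero[of i] that s by (cases "i = s") (auto simp: c_def g_def field_simps)
      obtain j where "j \<le> Suc n" "eval_mpoly w (F j) \<noteq> 0" using nz w by blast
      then have "c \<noteq> 0" using Fw by auto
      \<comment> \<open>Scaling by \<open>\<mu>\<close> multiplies all \<open>F i\<close> by the
        same factor \<open>1 / c\<close>, as they share the degree \<open>e\<close>.\<close>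
      obtain \<mu> where \<mu>: "\<mu> ^ e = 1 / c" by (rule exists_complex_root[OF e])
      have "eval_mpoly (\<lambda>i. \<mu> * w i) (F i) = y i" if "i \<le> Suc n" for i
        using \<open>c \<noteq> 0\<close> by (simp add: eval_cmult[OF F[OF that]] Fw[OF that] \<mu>)
      then show False using y by blast
    qed
  qed
qed

lemma eval_ideal_adjoin:
  assumes "p \<in> ideal_adjoin n I g" "\<And>k. k \<in> I \<Longrightarrow> eval_mpoly w k = 0" "eval_mpoly w g = 0"
  shows "eval_mpoly w p = 0"
  using assms by (auto elim!: ideal_adjoinE)

lemma eval_ideal_span:
  "p \<in> ideal_span n h A \<Longrightarrow> (\<And>i. i \<in> A \<Longrightarrow> eval_mpoly w (h i) = 0) \<Longrightarrow> eval_mpoly w p = 0"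
  by (auto simp: ideal_span_def eval_sum intro!: sum.neutral)

lemma graded_part_not_vanishing:
  assumes "w \<in> punctured_space n"
  obtains p where "p \<in> graded_part n k" "eval_mpoly w p \<noteq> 0"
proof -
  obtain i where i: "i \<le> n" "w i \<noteq> 0" by (rule punctured_nonzero[OF assms])
  have "xvar i ^ k \<in> graded_part n k" using graded_part_power[OF xvar_graded[OF i(1)], of k] by simp
  then show ?thesis by (rule that) (use i in simp)
qed

text \<open>Every common zero of the \<open>f i\<close> and \<open>l ^ e\<close> is one of
  \<open>l\<close>, so normalization applies to these \<open>n + 2\<close> forms of equal degree.
  Bezout bounds \<open>e * c\<close> by \<open>e ^ (n + 1)\<close>, and one factor \<open>e\<close>
  cancels.\<close>

lemma hilbert_function_le_power:
  assumes f: "\<And>i. i \<le> n \<Longrightarrow> f i \<in> graded_part n e" and e: "e \<ge> 1"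
    and l: "l \<in> graded_part n 1"
    and L: "\<And>k. k \<ge> L \<Longrightarrow> graded_part n k \<subseteq> ideal_adjoin n (ideal_span n f {..n}) l"
    and c: "\<And>k. k \<ge> K \<Longrightarrow> hilbert_function n (ideal_span n f {..n}) k = c"
  shows "c \<le> e ^ n"
proof -
  let ?J = "ideal_span n f {..n}" and ?J' = "ideal_adjoin n (ideal_span n f {..n}) (l ^ e)"
  have J: "homogeneous_ideal n ?J" by (rule homogeneous_ideal_span[where e = "\<lambda>_. e"]) (use f in auto)
  note I = homogeneous_ideal_is_ideal[OF J]
  have le: "l ^ e \<in> graded_part n e" using graded_part_power[OF l, of e] by simp
  have J': "is_ideal n ?J'" by (rule is_ideal_adjoin[OF I graded_part_poly_ring[OF le]])
  define F where "F i = (if i \<le> n then f i else l ^ e)" for i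
  have F: "F i \<in> graded_part n e" for i using f le by (simp add: F_def)
  have nz: "\<forall>w\<in>punctured_space n. \<exists>i\<le>Suc n. eval_mpoly w (F i) \<noteq> 0"
  proof (rule ballI, rule ccontr)
    fix w assume w: "w \<in> punctured_space n"
    assume "\<not> (\<exists>i\<le>Suc n. eval_mpoly w (F i) \<noteq> 0)"
    then have F0: "eval_mpoly w (F i) = 0" if "i \<le> Suc n" for i using that by blast
    have "eval_mpoly w (f i) = 0" if "i \<le> n" for i using F0[of i] that by (simp add: F_def)
    then have J0: "eval_mpoly w k = 0" if "k \<in> ?J" for k using eval_ideal_span[OF that] by simp
    have "eval_mpoly w l = 0" using F0[of "Suc n"] e by (simp add: F_def)
    moreover obtain p where "p \<in> graded_part n L" "eval_mpoly w p \<noteq> 0"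
      by (rule graded_part_not_vanishing[OF w])
    ultimately show False
      using eval_ideal_adjoin[where p = p and g = l, OF _ J0] L[OF order_refl] by (meson subsetD)
  qed
  obtain A :: "nat set" and g where A: "finite A" "card A = Suc n" and g': "\<forall>i\<in>A. g i \<in> graded_part n e"
    and g_mem: "\<forall>I. is_ideal n I \<longrightarrow> F ` {..Suc n} \<subseteq> I \<longrightarrow> g ` A \<subseteq> I"
    and g_nz: "\<forall>w\<in>punctured_space n. \<exists>i\<in>A. eval_mpoly w (g i) \<noteq> 0"
    by (rule noether_normalization[OF F e nz])
  have g: "g i \<in> graded_part n e" if "i \<in> A" for i using g' that by blast
  let ?G = "ideal_span n g A"
  have G: "is_ideal n ?G" by (rule is_ideal_span[OF A(1)]) (rule graded_part_poly_ring[OF g])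
  have "F i \<in> ?J'" for i
    using ideal_adjoin_mem[OF I] ideal_adjoin_superset[of ?J n "l ^ e"] ideal_span_mem[of "{..n}" i f n]
    by (auto simp: F_def)
  then have "g ` A \<subseteq> ?J'" using g_mem J' by (simp add: image_subset_iff)
  then have "?G \<subseteq> ?J'" by (intro ideal_span_subset[OF J']) auto
  obtain N where N: "\<And>k. k \<ge> N \<Longrightarrow> graded_part n k \<subseteq> ?G"
  proof (rule eventually_graded_subset[OF G])
    show "\<exists>p\<in>?G. eval_mpoly w p \<noteq> 0" if "w \<in> punctured_space n" for w
      using g_nz that ideal_span_mem[OF A(1)] by blast
  qed blast
  define M where "M = max N K"
  have "e * c = (\<Sum>k\<in>{M..<M + e}. hilbert_function n ?J k)" using c by (simp add: M_def)
  \<comment> \<open>In the exact sequence for \<open>l ^ e\<close> the colon ideal uses up at most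
    the degrees below \<open>M\<close>; the last \<open>e\<close> values are left for
    \<open>?J'\<close>.\<close>
  also have "\<dots> \<le> (\<Sum>k<M + e. hilbert_function n ?J' k)"
  proof -
    have "(\<Sum>k<M + e. hilbert_function n ?J k) =
        (\<Sum>k<M. hilbert_function n ?J k) + (\<Sum>k\<in>{M..<M + e}. hilbert_function n ?J k)"
      by (simp add: lessThan_atLeast0 sum.atLeastLessThan_concat)
    moreover have "(\<Sum>k<M. hilbert_function n (colon n ?J (l ^ e)) k) \<le> (\<Sum>k<M. hilbert_function n ?J k)"
      by (intro sum_mono hilbert_function_colon_le[OF J le])
    ultimately show ?thesis using sum_hilbert_function_adjoin[OF J le, of M] by linarith
  qed
  also have "\<dots> \<le> (\<Sum>k<M + e. hilbert_function n ?G k)"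
    by (intro sum_mono hilbert_function_antimono G J' \<open>?G \<subseteq> ?J'\<close>)
  also have "\<dots> = (\<Prod>i\<in>A. e)"
    by (rule bezout_colength[OF A g e]) (use N in \<open>auto simp: M_def\<close>)
  also have "\<dots> = e * e ^ n" using A(2) by simp
  finally show ?thesis using e by simp
qed

section \<open>Multiplicities\<close>

text \<open>\<open>S/I\<close> is the direct sum of its graded pieces because \<open>I\<close> is
  homogeneous. An element of two pieces would have two degrees and be 0, which is never a basis
  element.\<close>

lemma quotient_basis_graded_union:
  assumes I: "homogeneous_ideal n I" and B: "\<And>k. quotient_basis (graded_part n k) I (B k)"
  shows "quotient_basis (poly_ring n) I (\<Union>k. B k)" and "j \<noteq> k \<Longrightarrow> B j \<inter> B k = {}"
proof -
  note I' = homogeneous_ideal_is_ideal[OF I]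
  have graded: "b \<in> graded_part n k" if "b \<in> B k" for b k
    using quotient_basis_subset[OF B] that by blast
  have hcomp_B: "hcomp k b = (if b \<in> B k then b else 0)" if "b \<in> B j" for b j k
  proof (cases "j = k")
    case False
    have "b \<notin> B k"
    proof
      assume "b \<in> B k"
      have "b = hcomp k b" using hcomp_of_graded[OF graded[OF \<open>b \<in> B k\<close>], of k] by simp
      also have "\<dots> = 0" using hcomp_of_graded[OF graded[OF that], of k] False by simp
      finally have "b = 0" .
      then show False using quotient_basis_not_mem[OF B that] ideal_0[OF I'] by simp
    qed
    then show ?thesis using hcomp_of_graded[OF graded[OF that]] False by simp
  qed (use that hcomp_of_graded[OF graded[OF that]] in simp)
  show "B j \<inter> B k = {}" if "j \<noteq> k"
  proof -
    have "b = 0" if "b \<in> B j" "b \<in> B k" for b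
      using hcomp_of_graded[OF graded[OF that(1)], of k] hcomp_of_graded[OF graded[OF that(2)], of k]
        \<open>j \<noteq> k\<close> by simp
    then show ?thesis using quotient_basis_not_mem[OF B] ideal_0[OF I'] by blast
  qed
  show "quotient_basis (poly_ring n) I (\<Union>k. B k)"
  proof (rule quotient_basisI)
    show "(\<Union>k. B k) \<subseteq> poly_ring n" using graded graded_part_poly_ring by blast
  next
    fix F c b assume F: "finite F" "F \<subseteq> (\<Union>k. B k)" "(\<Sum>b\<in>F. scale (c b) b) \<in> I" "b \<in> F"
    then obtain k where k: "b \<in> B k" by blast
    have "hcomp k (\<Sum>b\<in>F. scale (c b) b) = (\<Sum>b\<in>F. if b \<in> B k then scale (c b) b else 0)"
      unfolding hcomp_sum hcomp_scale using F(2) hcomp_B by (intro sum.cong) auto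
    also have "\<dots> = (\<Sum>b\<in>F \<inter> B k. scale (c b) b)"
      using F(1) by (simp add: sum.inter_restrict)
    finally have "(\<Sum>b\<in>F \<inter> B k. scale (c b) b) \<in> I"
      using homogeneous_ideal_hcomp[OF I F(3), of k] by simp
    then show "c b = 0" by (rule quotient_basis_indep[OF B, rotated 2]) (use F k in auto)
  next
    fix v assume v: "v \<in> poly_ring n"
    have "\<exists>s. s \<in> mp.span (\<Union>k. B k) \<and> hcomp k v - s \<in> I" for k
    proof -
      obtain F c where F: "finite F" "F \<subseteq> B k" "hcomp k v - (\<Sum>b\<in>F. scale (c b) b) \<in> I"
        by (rule quotient_basis_span[OF B hcomp_graded[OF v]])
      moreover have "(\<Sum>b\<in>F. scale (c b) b) \<in> mp.span (\<Union>k. B k)"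
        using F(2) by (intro mp.span_sum mp.span_scale mp.span_base) auto
      ultimately show ?thesis by blast
    qed
    then obtain s where s: "\<And>k. s k \<in> mp.span (\<Union>k. B k)" "\<And>k. hcomp k v - s k \<in> I"
      by metis
    let ?A = "mdeg ` Poly_Mapping.keys v"
    have "(\<Sum>k\<in>?A. hcomp k v - s k) \<in> I" by (rule ideal_sum[OF I' s(2)])
    then have diff: "v - (\<Sum>k\<in>?A. s k) \<in> I" by (simp add: sum_subtractf sum_hcomp_keys)
    have "(\<Sum>k\<in>?A. s k) \<in> mp.span (\<Union>k. B k)" by (rule mp.span_sum[OF s(1)])
    then obtain F r where "finite F" "F \<subseteq> (\<Union>k. B k)" "(\<Sum>k\<in>?A. s k) = (\<Sum>b\<in>F. scale (r b) b)"
      unfolding mp.span_explicit by auto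
    with diff show "\<exists>F c. finite F \<and> F \<subseteq> (\<Union>k. B k) \<and> v - (\<Sum>b\<in>F. scale (c b) b) \<in> I"
      by (intro exI[of _ F] exI[of _ r]) simp
  qed
qed

lemma ideal_multiplicity_finite:
  assumes I: "homogeneous_ideal n I" and full: "\<And>k. k \<ge> K \<Longrightarrow> graded_part n k \<subseteq> I"
  shows "ideal_multiplicity n I = of_nat (\<Sum>k<K. hilbert_function n I k)"
proof -
  note I' = homogeneous_ideal_is_ideal[OF I]
  note sub = ideal_subspace[OF I']
  have "\<exists>B. quotient_basis (graded_part n k) I B" for k
    using quotient_basis_exists[OF sub] by metis
  then obtain B where B: "\<And>k. quotient_basis (graded_part n k) I (B k)" by metis
  have "k < K" if "b \<in> B k" for b k
    using quotient_basis_subset[OF B, of k] quotient_basis_not_mem[OF B that] full[of k] that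
    by (meson not_le subsetD)
  then have union: "(\<Union>k. B k) = (\<Union>k\<in>{..<K}. B k)" by blast
  have fin: "finite (B k)" for k
    by (rule finite_quotient_basis[OF sub finite_dim_graded_part[OF sub] B])
  note qb = quotient_basis_graded_union(1)[OF I B]
  have "finite_dim_quotient (poly_ring n) I"
    unfolding finite_dim_quotient_def
    by (rule exI[of _ "\<Union>k. B k"]) (use qb union fin in simp)
  moreover have "quotient_dim (poly_ring n) I = (\<Sum>k<K. card (B k))"
    unfolding quotient_dim_eq_card[OF sub qb] union
    by (rule card_UN_disjoint) (use fin quotient_basis_graded_union(2)[OF I B] in auto)
  moreover have "hilbert_function n I k = card (B k)" for k
    unfolding hilbert_function_def by (rule quotient_dim_eq_card[OF sub B])
  ultimately show ?thesis by (simp add: ideal_multiplicity_def)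
qed

lemma hilbert_polynomial_const:
  assumes "\<And>k. k \<ge> K \<Longrightarrow> hilbert_function n I k = c"
  shows "hilbert_polynomial n I = [:of_nat c:]"
  unfolding hilbert_polynomial_def
proof (rule the_equality)
  show "\<forall>\<^sub>F k in sequentially. poly [:of_nat c:] (of_nat k) = (of_nat (hilbert_function n I k) :: rat)"
    unfolding eventually_sequentially using assms by auto
  fix P :: "rat poly"
  assume "\<forall>\<^sub>F k in sequentially. poly P (of_nat k) = of_nat (hilbert_function n I k)"
  then obtain N where N: "\<And>k. k \<ge> N \<Longrightarrow> poly P (of_nat k) = of_nat (hilbert_function n I k)"
    unfolding eventually_sequentially by blast
  have "of_nat ` {max N K..} \<subseteq> {x. poly (P - [:of_nat c:]) x = 0}"
    using N assms by auto
  moreover have "infinite (of_nat ` {max N K..} :: rat set)"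
    by (simp add: finite_image_iff inj_on_def infinite_Ici)
  ultimately have "infinite {x. poly (P - [:of_nat c:]) x = 0}"
    using finite_subset by blast
  then show "P = [:of_nat c:]" using poly_roots_finite[of "P - [:of_nat c:]"] by auto
qed

text \<open>Since \<open>c \<ge> 1\<close>, all large degrees contribute basis elements and the
  quotient has infinite dimension. So the Hilbert polynomial branch applies, with degree 0 and
  factorial 1.\<close>

lemma ideal_multiplicity_const:
  assumes I: "homogeneous_ideal n I" and c: "\<And>k. k \<ge> K \<Longrightarrow> hilbert_function n I k = c" "c \<ge> 1"
  shows "ideal_multiplicity n I = of_nat c"
proof -
  note sub = ideal_subspace[OF homogeneous_ideal_is_ideal[OF I]]
  have "\<exists>B. quotient_basis (graded_part n k) I B" for k
    using quotient_basis_exists[OF sub] by metis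
  then obtain B where B: "\<And>k. quotient_basis (graded_part n k) I (B k)" by metis
  have "\<not> finite_dim_quotient (poly_ring n) I"
  proof
    assume "finite_dim_quotient (poly_ring n) I"
    then have fin: "finite (\<Union>k. B k)"
      by (rule finite_quotient_basis[OF sub _ quotient_basis_graded_union(1)[OF I B]])
    have "B k \<noteq> {}" if "k \<ge> K" for k
      using quotient_dim_eq_card[OF sub B, of k] c(1)[OF that] c(2) by (auto simp: hilbert_function_def)
    then have "\<exists>x. k \<ge> K \<longrightarrow> x \<in> B k" for k by blast
    then obtain b where b: "\<And>k. k \<ge> K \<Longrightarrow> b k \<in> B k" by metis
    have "inj_on b {K..}"
    proof (rule inj_onI, rule ccontr)
      fix j k assume jk: "j \<in> {K..}" "k \<in> {K..}" "b j = b k" "j \<noteq> k"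
      then have "b k \<in> B j \<inter> B k" using b[of j] b[of k] by simp
      then show False using quotient_basis_graded_union(2)[OF I B jk(4)] by blast
    qed
    moreover have "b ` {K..} \<subseteq> (\<Union>k. B k)" using b by auto
    ultimately have "finite {K..}" using fin by (metis finite_imageD finite_subset)
    then show False by (simp add: infinite_Ici)
  qed
  then show ?thesis
    using hilbert_polynomial_const[OF c(1)] by (simp add: ideal_multiplicity_def)
qed

section \<open>The Jacobian ideal and its radical\<close>

lemma partial_deriv_graded:
  assumes f: "f \<in> graded_part n d"
  shows "partial_deriv i f \<in> graded_part n (d - 1)"
  unfolding partial_deriv_def
proof (rule graded_part_sum)
  fix m assume m: "m \<in> Poly_Mapping.keys f"
  then have mm: "m \<in> monoms n" "mdeg m = d" using f by (auto simp: graded_part_iff)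
  show "sngl (m - sngl i 1) (of_nat (lkp m i) * lkp f m) \<in> graded_part n (d - 1)"
  \<comment> \<open>If \<open>x_i\<close> does not occur in \<open>m\<close>, truncated subtraction
    gives a monomial of the wrong degree, but its coefficient is 0.\<close>
  proof (cases "lkp m i = 0")
    case False
    have eq: "m = (m - sngl i 1) + sngl i 1"
      using False by (intro poly_mapping_eqI) (auto simp: lookup_add lookup_minus lookup_single_if)
    then have "mdeg m = mdeg (m - sngl i 1) + 1" by (metis mdeg_add mdeg_single)
    then have "mdeg (m - sngl i 1) = d - 1" using mm(2) by simp
    moreover have "Poly_Mapping.keys (m - sngl i 1) \<subseteq> Poly_Mapping.keys m"
      by (auto simp: in_keys_iff lookup_minus)
    then have "m - sngl i 1 \<in> monoms n" using mm(1) by (auto simp: monoms_def)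
    ultimately show ?thesis using graded_part_single by metis
  qed simp
qed

lemma jacobian_ideal_eq_span: "jacobian_ideal n f = ideal_span n (\<lambda>i. partial_deriv i f) {..n}"
proof -
  have "{partial_deriv i f | i. i \<le> n} = (\<lambda>i. partial_deriv i f) ` {..n}" by auto
  then show ?thesis unfolding jacobian_ideal_def by (simp add: ideal_gen_eq_span)
qed

lemma homogeneous_jacobian_ideal:
  assumes "f \<in> graded_part n d"
  shows "homogeneous_ideal n (jacobian_ideal n f)"
  unfolding jacobian_ideal_eq_span
  by (rule homogeneous_ideal_span[where e = "\<lambda>_. d - 1"]) (use partial_deriv_graded[OF assms] in auto)

text \<open>\<open>singular_points\<close> tests all vectors of a class and \<open>zero_reps\<close>
  a single one; homogeneity of the Jacobian ideal bridges the difference.\<close>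

lemma singular_points_zero_reps:
  assumes f: "f \<in> graded_part n d" and fin: "finite (singular_points n f)"
  obtains V where "zero_reps n (jacobian_ideal n f) V" "card V = card (singular_points n f)"
proof -
  let ?J = "jacobian_ideal n f" and ?S = "singular_points n f"
  note J = homogeneous_jacobian_ideal[OF f]
  have cls_eq: "proportional `` {v} = proportional `` {w}" if "(v, w) \<in> proportional" for v w
    using that proportional_sym proportional_trans by blast
  have J_zero: "(\<forall>p\<in>?J. eval_mpoly v p = 0) \<longleftrightarrow> (\<forall>i\<le>n. eval_mpoly v (partial_deriv i f) = 0)" for v
  proof
    assume "\<forall>p\<in>?J. eval_mpoly v p = 0"
    then show "\<forall>i\<le>n. eval_mpoly v (partial_deriv i f) = 0"
      using ideal_span_mem[of "{..n}" _ "\<lambda>i. partial_deriv i f" n] unfolding jacobian_ideal_eq_span by auto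
  qed (auto simp: jacobian_ideal_eq_span intro: eval_ideal_span)
  have "\<exists>x. x \<in> punctured_space n \<and> X = proportional `` {x}" if "X \<in> ?S" for X
    using that unfolding singular_points_def proj_space_def by (auto elim!: quotientE)
  then obtain r where r: "\<And>X. X \<in> ?S \<Longrightarrow> r X \<in> punctured_space n"
    "\<And>X. X \<in> ?S \<Longrightarrow> X = proportional `` {r X}" by metis
  have inj: "inj_on r ?S" by (rule inj_onI) (metis r(2))
  have zero_r: "\<forall>p\<in>?J. eval_mpoly (r X) p = 0" if "X \<in> ?S" for X
  proof -
    have "r X \<in> X" using r(2)[OF that] proportional_refl by blast
    then show ?thesis using that unfolding J_zero singular_points_def by blast
  qed
  have "(\<forall>p\<in>?J. eval_mpoly w p = 0) \<longleftrightarrow> (\<exists>v\<in>r ` ?S. (v, w) \<in> proportional)"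
    if w: "w \<in> punctured_space n" for w
  proof
    assume w0: "\<forall>p\<in>?J. eval_mpoly w p = 0"
    let ?X = "proportional `` {w}"
    have "\<forall>p\<in>?J. eval_mpoly v p = 0" if "v \<in> ?X" for v
      using zero_ideal_proportional[OF J, of w v] that w0 by auto
    then have X: "?X \<in> ?S"
      using w unfolding J_zero singular_points_def proj_space_def by (auto intro: quotientI)
    have "r ?X \<in> ?X" using r(2)[OF X] proportional_refl by blast
    then have "(r ?X, w) \<in> proportional" using proportional_sym by blast
    then show "\<exists>v\<in>r ` ?S. (v, w) \<in> proportional" using X by blast
  next
    assume "\<exists>v\<in>r ` ?S. (v, w) \<in> proportional"
    then obtain X where X: "X \<in> ?S" "(r X, w) \<in> proportional" by blast
    show "\<forall>p\<in>?J. eval_mpoly w p = 0"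
      using zero_ideal_proportional[OF J X(2)] zero_r[OF X(1)] by blast
  qed
  moreover have "r X = r Y" if "X \<in> ?S" "Y \<in> ?S" "(r X, r Y) \<in> proportional" for X Y
    using cls_eq[OF that(3)] r(2) that(1,2) by metis
  ultimately have "zero_reps n ?J (r ` ?S)"
    unfolding zero_reps_def using fin r(1) by auto
  then show ?thesis by (rule that) (rule card_image[OF inj])
qed

text \<open>The Nullstellensatz makes membership a statement about values, from which closure under
  addition is immediate and homogeneity is accessible.\<close>

lemma radical_iff:
  assumes J: "is_ideal n J"
  shows "p \<in> radical n J \<longleftrightarrow> p \<in> poly_ring n \<and>
    (\<forall>a. (\<forall>k\<in>J. eval_mpoly a k = 0) \<longrightarrow> eval_mpoly a p = 0)"
proof (intro iffI conjI allI impI)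
  assume "p \<in> radical n J"
  then obtain N where N: "p \<in> poly_ring n" "p ^ N \<in> J" by (auto simp: radical_def)
  then show "p \<in> poly_ring n" by simp
  fix a assume "\<forall>k\<in>J. eval_mpoly a k = 0"
  then have "eval_mpoly a (p ^ N) = 0" using N(2) by blast
  then show "eval_mpoly a p = 0" by simp
next
  assume p: "p \<in> poly_ring n \<and> (\<forall>a. (\<forall>k\<in>J. eval_mpoly a k = 0) \<longrightarrow> eval_mpoly a p = 0)"
  then have "\<exists>N. p ^ N \<in> J" by (intro nullstellensatz[OF J]) auto
  then show "p \<in> radical n J" using p by (simp add: radical_def)
qed

text \<open>Here \<open>t = 0\<close> is allowed, unlike in \<open>proportional\<close>.\<close>

lemma eval_homogeneous_cone:
  assumes J: "homogeneous_ideal n J" and zero: "\<forall>k\<in>J. eval_mpoly a k = 0" and k: "k \<in> J"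
  shows "eval_mpoly (\<lambda>i. t * a i) k = 0"
proof -
  have "eval_mpoly (\<lambda>i. t * a i) (hcomp j k) = 0" for j
    using eval_cmult[OF hcomp_graded[OF ideal_poly_ring[OF homogeneous_ideal_is_ideal[OF J] k]]]
      zero homogeneous_ideal_hcomp[OF J k] by simp
  then have "eval_mpoly (\<lambda>i. t * a i) (\<Sum>j\<in>mdeg ` Poly_Mapping.keys k. hcomp j k) = 0"
    by (simp add: eval_sum)
  then show ?thesis by (simp add: sum_hcomp_keys)
qed

text \<open>Along the line through a zero \<open>a\<close> of \<open>J\<close>, the value of
  \<open>p\<close> at \<open>t a\<close> is a polynomial in \<open>t\<close> whose coefficients are
  the values of the homogeneous components at \<open>a\<close>. It vanishes identically, hence so do
  its coefficients.\<close>

lemma homogeneous_radical: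
  assumes J: "homogeneous_ideal n J"
  shows "homogeneous_ideal n (radical n J)"
proof -
  note J' = homogeneous_ideal_is_ideal[OF J]
  have "is_ideal n (radical n J)"
    by (auto simp: is_ideal_def radical_iff[OF J'])
  moreover have "hcomp k p \<in> radical n J" if p: "p \<in> radical n J" for p k
    unfolding radical_iff[OF J']
  proof (intro conjI allI impI)
    have pr: "p \<in> poly_ring n" using p radical_iff[OF J'] by blast
    show "hcomp k p \<in> poly_ring n" by (rule graded_part_poly_ring[OF hcomp_graded[OF pr]])
    fix a assume a: "\<forall>k\<in>J. eval_mpoly a k = 0"
    \<comment> \<open>Including \<open>k\<close> lets the coefficient at \<open>k\<close> be read
      off even if \<open>p\<close> has no term of that degree.\<close>
    let ?A = "insert k (mdeg ` Poly_Mapping.keys p)"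
    define P where "P = (\<Sum>j\<in>?A. Polynomial.monom (eval_mpoly a (hcomp j p)) j)"
    have "poly P t = 0" for t
    proof -
      have "poly P t = (\<Sum>j\<in>?A. eval_mpoly (\<lambda>i. t * a i) (hcomp j p))"
        unfolding P_def poly_sum poly_monom eval_cmult[OF hcomp_graded[OF pr]]
        by (simp add: mult.commute)
      also have "\<dots> = eval_mpoly (\<lambda>i. t * a i) p"
        unfolding eval_sum[symmetric] by (subst sum_hcomp) auto
      also have "\<dots> = 0"
        using p eval_homogeneous_cone[OF J a] unfolding radical_iff[OF J'] by blast
      finally show ?thesis .
    qed
    then have "P = 0" by (simp add: poly_all_0_iff_0[symmetric])
    then have "0 = Polynomial.coeff P k" by simp
    also have "\<dots> = (\<Sum>j\<in>?A. if j = k then eval_mpoly a (hcomp j p) else 0)"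
      unfolding P_def coeff_sum coeff_monom ..
    also have "\<dots> = eval_mpoly a (hcomp k p)" by simp
    finally show "eval_mpoly a (hcomp k p) = 0" by simp
  qed
  ultimately show ?thesis by (simp add: homogeneous_ideal_def)
qed

text \<open>The radical is tested on affine zeros: multiples of the representatives, and possibly
  the origin. Forms of positive degree vanish at the origin, which explains
  \<open>k \<ge> 1\<close>.\<close>

lemma hilbert_function_radical:
  assumes J: "homogeneous_ideal n J" and V: "zero_reps n J V" and k: "k \<ge> card V" "k \<ge> 1"
  shows "hilbert_function n (radical n J) k = card V"
proof (rule interpolation_basis(2))
  note J' = homogeneous_ideal_is_ideal[OF J]
  show "is_ideal n (radical n J)" by (rule homogeneous_ideal_is_ideal[OF homogeneous_radical[OF J]])
  show "eval_mpoly v p = 0" if "v \<in> V" "p \<in> radical n J" for v p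
    using that zero_reps_zero[OF V] unfolding radical_iff[OF J'] by blast
  show "p \<in> radical n J" if p: "p \<in> graded_part n k" "\<And>v. v \<in> V \<Longrightarrow> eval_mpoly v p = 0" for p
    unfolding radical_iff[OF J']
  proof (intro conjI allI impI)
    show pr: "p \<in> poly_ring n" by (rule graded_part_poly_ring[OF p(1)])
    fix a assume a: "\<forall>q\<in>J. eval_mpoly a q = 0"
    define b where "b i = (if i \<le> n then a i else 0)" for i
    have eval_b: "eval_mpoly b q = eval_mpoly a q" if "q \<in> poly_ring n" for q
      by (rule eval_cong[OF that]) (simp add: b_def)
    show "eval_mpoly a p = 0"
    proof (cases "b \<in> punctured_space n")
      case True
      have "eval_mpoly b q = 0" if "q \<in> J" for q
        using eval_b[OF ideal_poly_ring[OF J' that]] a that by simp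
      then obtain v where v: "v \<in> V" "(v, b) \<in> proportional"
        by (rule zero_reps_cover[OF V True])
      then show ?thesis
        using eval_proportional[OF v(2) p(1)] p(2)[OF v(1)] eval_b[OF pr] by simp
    next
      case False
      \<comment> \<open>Writing the origin as a zero multiple turns homogeneity into the factor
        \<open>0 ^ k\<close>.\<close>
      then have "b = (\<lambda>i. 0 * b i)" by (auto simp: punctured_space_def b_def fun_eq_iff)
      then have "eval_mpoly b p = 0 ^ k * eval_mpoly b p" using eval_cmult[OF p(1), of 0 b] by simp
      then show ?thesis using k(2) eval_b[OF pr] by (simp add: zero_power)
    qed
  qed
qed (use zero_reps_finite[OF V] zero_reps_punctured[OF V] zero_reps_distinct[OF V] k in auto)

lemma ideal_multiplicity_radical:
  assumes J: "homogeneous_ideal n J" and V: "zero_reps n J V" "V \<noteq> {}"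
  shows "ideal_multiplicity n (radical n J) = of_nat (card V)"
proof (rule ideal_multiplicity_const[OF homogeneous_radical[OF J]])
  show "card V \<ge> 1" using zero_reps_finite[OF V(1)] V(2) by (simp add: Suc_le_eq card_gt_0_iff)
  show "hilbert_function n (radical n J) k = card V" if "k \<ge> max 1 (card V)" for k
    by (rule hilbert_function_radical[OF J V(1)]) (use that in auto)
qed

text \<open>For \<open>d = 2\<close> the bound \<open>(d - 1) ^ n\<close> is not strictly below
  \<open>(d - 1) ^ (n + 1)\<close>. In one variable \<open>f\<close> is a nonzero multiple of
  \<open>x_0^2\<close>, and smoothness is visible directly.\<close>

lemma unary_quadric_deriv_nonzero:
  assumes f: "f \<in> graded_part 0 2" "f \<noteq> 0" and v: "v \<in> punctured_space 0"
  shows "eval_mpoly v (partial_deriv 0 f) \<noteq> 0"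
proof -
  have keys: "m = sngl 0 2" if "m \<in> Poly_Mapping.keys f" for m
  proof -
    have m: "Poly_Mapping.keys m \<subseteq> {0}" "mdeg m = 2"
      using f(1) that by (auto simp: graded_part_iff monoms_def)
    have eq: "m = sngl 0 (lkp m 0)" using poly_mapping_sum_single[of "{0}" m] m(1) by simp
    have "lkp m 0 = 2" using arg_cong[OF eq, of mdeg] m(2) by simp
    then show ?thesis using eq by metis
  qed
  have "Poly_Mapping.keys f \<noteq> {}" using f(2) by simp
  then have K: "Poly_Mapping.keys f = {sngl 0 2}" using keys by blast
  have "sngl 0 2 - sngl 0 1 = (sngl 0 1 :: monom)"
    by (rule poly_mapping_eqI) (simp add: lookup_minus lookup_single_if del: single_one single_numeral)
  then have "partial_deriv 0 f = sngl (sngl 0 1) (2 * lkp f (sngl 0 2))"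
    by (simp add: partial_deriv_def K del: single_one single_numeral)
  then have "eval_mpoly v (partial_deriv 0 f) = 2 * lkp f (sngl 0 2) * v 0"
    by (simp add: eval_single monom_val_def del: single_one single_numeral)
  moreover have "lkp f (sngl 0 2) \<noteq> 0" unfolding in_keys_iff[symmetric] K by simp
  moreover obtain i where "i \<le> 0" "v i \<noteq> 0" by (rule punctured_nonzero[OF v])
  ultimately show ?thesis by simp
qed

text \<open>Bezout needs derivatives of positive degree, hence \<open>d \<ge> 2\<close>; in general
  it is only recorded that the multiplicity is a natural number.\<close>

lemma jacobian_multiplicity_smooth:
  assumes f: "f \<in> graded_part n d" and V: "zero_reps n (jacobian_ideal n f) {}"
  shows "\<exists>c. ideal_multiplicity n (jacobian_ideal n f) = of_nat c \<and> (d \<ge> 2 \<longrightarrow> c = (d - 1) ^ (n + 1))"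
proof -
  let ?J = "jacobian_ideal n f"
  note J = homogeneous_jacobian_ideal[OF f]
  obtain K where K: "\<And>k. k \<ge> K \<Longrightarrow> graded_part n k \<subseteq> ?J"
  proof (rule eventually_graded_subset[OF homogeneous_ideal_is_ideal[OF J]])
    show "\<exists>p\<in>?J. eval_mpoly w p \<noteq> 0" if "w \<in> punctured_space n" for w
      using zero_reps_cover[OF V that] by blast
  qed blast
  have "(\<Sum>k<K. hilbert_function n ?J k) = (d - 1) ^ (n + 1)" if "d \<ge> 2"
  proof -
    have "(\<Sum>k<K. hilbert_function n ?J k) = (\<Prod>i\<in>{..n}. d - 1)"
      unfolding jacobian_ideal_eq_span
    proof (rule bezout_colength)
      show "graded_part n k \<subseteq> ideal_span n (\<lambda>i. partial_deriv i f) {..n}" if "k \<ge> K" for k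
        using K[OF that] by (simp add: jacobian_ideal_eq_span)
    qed (use partial_deriv_graded[OF f] that in auto)
    then show ?thesis by simp
  qed
  then show ?thesis using ideal_multiplicity_finite[OF J K] by blast
qed

text \<open>Interpolation at the zeros gives \<open>c \<ge> 1\<close>, which decides the branch of
  \<open>ideal_multiplicity\<close>. Derivatives of positive degree, hence \<open>d \<ge> 2\<close>,
  enter the upper bound.\<close>

lemma jacobian_multiplicity_singular:
  assumes f: "f \<in> graded_part n d" and V: "zero_reps n (jacobian_ideal n f) V" "V \<noteq> {}"
  obtains c K where "ideal_multiplicity n (jacobian_ideal n f) = of_nat c" "c \<ge> 1"
    "\<forall>k\<ge>K. hilbert_function n (jacobian_ideal n f) k = c" "d \<ge> 2 \<longrightarrow> c \<le> (d - 1) ^ n"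
proof -
  let ?J = "jacobian_ideal n f"
  note J = homogeneous_jacobian_ideal[OF f]
  note J' = homogeneous_ideal_is_ideal[OF J]
  obtain l L where l: "l \<in> graded_part n 1" and L: "\<And>k. k \<ge> L \<Longrightarrow> graded_part n k \<subseteq> ideal_adjoin n ?J l"
    using zero_reps_linear_form[OF J V(1)] by metis
  obtain c K where c: "\<And>k. k \<ge> K \<Longrightarrow> hilbert_function n ?J k = c"
    using hilbert_function_eventually_const[OF J l L] by metis
  have "card V \<le> hilbert_function n ?J (max K (card V))"
    by (rule interpolation_basis(1)[OF J' zero_reps_finite[OF V(1)]])
      (use zero_reps_punctured[OF V(1)] zero_reps_distinct[OF V(1)] zero_reps_zero[OF V(1)] in auto)
  moreover have "card V \<ge> 1" using zero_reps_finite[OF V(1)] V(2) by (simp add: Suc_le_eq card_gt_0_iff)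
  ultimately have "c \<ge> 1" using c[of "max K (card V)"] by simp
  have "c \<le> (d - 1) ^ n" if "d \<ge> 2"
  proof (rule hilbert_function_le_power)
    show "l \<in> graded_part n 1" by (rule l)
    show "graded_part n k \<subseteq> ideal_adjoin n (ideal_span n (\<lambda>i. partial_deriv i f) {..n}) l" if "k \<ge> L" for k
      using L[OF that] by (simp add: jacobian_ideal_eq_span)
    show "hilbert_function n (ideal_span n (\<lambda>i. partial_deriv i f) {..n}) k = c" if "k \<ge> K" for k
      using c[OF that] by (simp add: jacobian_ideal_eq_span)
  qed (use partial_deriv_graded[OF f] that in auto)
  then show ?thesis
    using that[of c K] ideal_multiplicity_const[OF J c \<open>c \<ge> 1\<close>] \<open>c \<ge> 1\<close> c by blast
qed

text \<open>For \<open>d = 2\<close> and \<open>n \<ge> 1\<close>, the sum of the squares of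
  \<open>x_0\<close>, ..., \<open>x_(n-1)\<close> has one singular point and Jacobian ideal
  generated by these variables, of multiplicity \<open>1 = (d - 1) ^ (n + 1)\<close>. The
  implication in (b) fails for it and is therefore stated outside this range.\<close>

theorem proposition3p5:
  fixes n d :: nat
    and f :: mpoly
    and ord1 ord2 :: "(monom \<times> monom) set"
    and G1 G2 :: "mpoly set"
    and mult1 mult2 :: rat
  assumes "f \<in> poly_ring n" and "f \<noteq> 0" and "homogeneous d f"
    and "finite (singular_points n f)"
    and "monomial_order n ord1" and "groebner_basis n ord1 G1 (jacobian_ideal n f)"
    and "monomial_order n ord2" and "groebner_basis n ord2 G2 (radical n (jacobian_ideal n f))"
    and "mult1 = ideal_multiplicity n (ideal_gen n G1)"
    and "mult2 = ideal_multiplicity n (ideal_gen n G2)"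
  shows "(mult1 < (of_nat d - 1) ^ (n + 1) \<longrightarrow>
            \<not> smooth_hypersurface n f \<and> mult2 = of_nat (card (singular_points n f)))
       \<and> (d \<noteq> 2 \<or> n = 0 \<longrightarrow>
            mult1 = (of_nat d - 1) ^ (n + 1) \<longrightarrow> smooth_hypersurface n f)"
proof -
  let ?J = "jacobian_ideal n f"
  have f: "f \<in> graded_part n d" using assms(1,3) by (simp add: graded_part_def)
  note J = homogeneous_jacobian_ideal[OF f]
  have mult1: "mult1 = ideal_multiplicity n ?J"
    using assms(6,9) by (simp add: groebner_basis_def)
  have mult2: "mult2 = ideal_multiplicity n (radical n ?J)"
    using assms(8,10) by (simp add: groebner_basis_def)
  obtain V where V: "zero_reps n ?J V" "card V = card (singular_points n f)"
    by (rule singular_points_zero_reps[OF f assms(4)])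
  have smooth: "smooth_hypersurface n f \<longleftrightarrow> V = {}"
    using V(2) zero_reps_finite[OF V(1)] assms(4) unfolding smooth_hypersurface_def
    by (metis card_0_eq)
  \<comment> \<open>For \<open>d = 0\<close> the rational power is that of \<open>-1\<close>,
    whereas truncated subtraction would give 0.\<close>
  have power: "(of_nat d - 1 :: rat) ^ (n + 1) = of_nat ((d - 1) ^ (n + 1))" if "d \<ge> 1"
    using that by (simp add: of_nat_diff)
  have deriv_0: "?J = {0}" if "d = 0"
  proof -
    have "partial_deriv i f = 0" for i
    proof -
      have "lkp m i = 0" if "m \<in> Poly_Mapping.keys f" for m
        using f that \<open>d = 0\<close> lookup_le_mdeg[of m i] by (auto simp: graded_part_iff)
      then show ?thesis unfolding partial_deriv_def by (intro sum.neutral) auto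
    qed
    then show ?thesis by (auto simp: jacobian_ideal_eq_span ideal_span_def intro!: exI[of _ "\<lambda>_. 0"])
  qed
  show ?thesis
  proof (cases "V = {}")
    case True
    \<comment> \<open>A constant has vanishing derivatives, so every point would be
      singular.\<close>
    have "d \<noteq> 0"
    proof
      assume "d = 0"
      define w :: "nat \<Rightarrow> complex" where "w i = (if i = 0 then 1 else 0)" for i
      have "w \<in> punctured_space n" by (auto simp: punctured_space_def w_def)
      then show False
        using zero_reps_cover[OF V(1), of w] True deriv_0[OF \<open>d = 0\<close>] by auto
    qed
    obtain c where c: "mult1 = of_nat c" "d \<ge> 2 \<longrightarrow> c = (d - 1) ^ (n + 1)"
      using jacobian_multiplicity_smooth[OF f] V(1) True unfolding mult1 by blast
    \<comment> \<open>For \<open>d = 1\<close> the power is 0, and any natural number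
      \<open>c\<close> suffices.\<close>
    have "(d - 1) ^ (n + 1) \<le> c" using c(2) \<open>d \<noteq> 0\<close> by (cases "d = 1") auto
    then have "\<not> mult1 < (of_nat d - 1) ^ (n + 1)"
      using power \<open>d \<noteq> 0\<close> unfolding c(1) by (metis not_le of_nat_le_iff One_nat_def Suc_leI neq0_conv)
    then show ?thesis using smooth True by simp
  next
    case False
    have "mult2 = of_nat (card (singular_points n f))"
      unfolding mult2 using ideal_multiplicity_radical[OF J V(1) False] V(2) by simp
    moreover obtain c K where c: "mult1 = of_nat c" "c \<ge> 1" "\<forall>k\<ge>K. hilbert_function n ?J k = c"
      "d \<ge> 2 \<longrightarrow> c \<le> (d - 1) ^ n"
      using jacobian_multiplicity_singular[OF f V(1) False] unfolding mult1 by blast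
    moreover have "mult1 \<noteq> (of_nat d - 1) ^ (n + 1)" if d: "d \<noteq> 2 \<or> n = 0"
    proof -
      consider "d = 0" "n = 0" | "d = 0" "n \<ge> 1" | "d = 1" | "d = 2" "n = 0" | "d \<ge> 3"
        using d by linarith
      then show ?thesis
      proof cases
        case 1
        \<comment> \<open>The power equals \<open>-1\<close> here, which is not a natural
          number.\<close>
        then show ?thesis using c(1) by simp
      next
        case 2
        \<comment> \<open>With \<open>J = 0\<close> and at least two variables the Hilbert function
          is unbounded; in this degree it would exceed its eventual value \<open>c\<close>.\<close>
        let ?k = "max K c"
        have "?k + 1 = (?k + 1) choose ?k" by (simp add: binomial_symmetric)
        also have "\<dots> \<le> (?k + n) choose ?k" using 2(2) by (intro binomial_right_mono) simp
        also have "\<dots> \<le> hilbert_function n ?J ?k"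
          unfolding deriv_0[OF 2(1)] hilbert_function_zero by (rule card_monoms_of_degree)
        also have "\<dots> = c" using c(3) by simp
        finally show ?thesis by simp
      next
        case 3
        then show ?thesis using c(1,2) by simp
      next
        case 4
        obtain v where v: "v \<in> V" using False by blast
        have "partial_deriv 0 f \<in> ?J"
          unfolding jacobian_ideal_eq_span using ideal_span_mem[of "{..n}" 0 "\<lambda>i. partial_deriv i f" n] by simp
        then have "eval_mpoly v (partial_deriv 0 f) = 0" by (rule zero_reps_zero[OF V(1) v])
        then show ?thesis
          using unary_quadric_deriv_nonzero[of f v] f assms(2) zero_reps_punctured[OF V(1) v] 4 by auto
      next
        case 5
        have "c \<le> (d - 1) ^ n" using c(4) 5 by simp
        \<comment> \<open>Strictness holds since \<open>d - 1\<close> is at least 2.\<close>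
        also have "\<dots> < (d - 1) ^ (n + 1)" using 5 by simp
        finally have "of_nat c \<noteq> (of_nat ((d - 1) ^ (n + 1)) :: rat)" by (metis nat_neq_iff of_nat_eq_iff)
        then show ?thesis using power 5 c(1) by simp
      qed
    qed
    ultimately show ?thesis using smooth False by blast
  qed
qed

end
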